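(* Let $n\ge3$ be an integer. For given constants $v_+>0$, $\theta_+>0$, $u_-\neq0$, $v_->0$ and $\theta_->0$, set $\eta_-:=v_--v_+$, $\chi_-:=\theta_--\theta_+$, and consider the following problem for functions $\eta,\chi$ on $[1,\infty)$ together with a constant $\alpha\in\mathbb{R}$: \[ \begin{cases} \eta_r+\dfrac{R\theta_+r^{n-1}}{\epsilon\mu v_+^2}\eta=\dfrac{Rr^{n-1}}{\epsilon\mu v_+}\chi+F(\eta,\chi),\\[2mm] \chi_r=-\dfrac{\alpha}{\kappa r^{n-1}}+\dfrac{\epsilon c_P}{\kappa r^{n-1}}\chi+\dfrac{\epsilon^3}{2}\dfrac{(v_++\eta)^2}{\kappa r^{3(n-1)}}-\epsilon^2\mu\dfrac{(v_++\eta)\eta_r}{\kappa r^{2(n-1)}}+\dfrac{1}{\kappa r^{n-1}}\displaystyle\int_r^\infty\Phi(\eta,\eta_r)(s)\,ds,\quad r>1,\\[2mm] \lim_{r\to\infty}\eta(r)=0,\quad\lim_{r\to\infty}\chi(r)=0,\\[1mm] \eta(1)=\eta_-,\ \chi(1)=\chi_-\quad\text{if } u_->0;\qquad \chi(1)=\chi_-\quad\text{if } u_-<0, \end{cases} \] where $\epsilon:=u_-/v_-$ if $u_->0$ and $\epsilon:=u_-/(v_++\eta(1))$ if $u_-<0$, and \[ F(\eta,\chi)(r):=\frac{Rr^{n-1}\chi\eta}{\epsilon\mu v_+(v_++\eta)}+\frac{R\theta_+r^{n-1}\eta^2}{\epsilon\mu v_+^2(v_++\eta)}+\frac{\epsilon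 v_+}{2\mu r^{n-1}}+\frac{\epsilon\eta}{\mu r^{n-1}}-\frac{\epsilon(n-1)r^{n-1}}{\mu}\int_r^\infty\frac{\eta(s)}{s^{2n-1}}\,ds, \] \[ \Phi(\eta,\eta_r)(r):=-4\epsilon^2\nu(n-1)\frac{(v_++\eta)\eta_r}{r^n}+2\epsilon^2\nu n(n-1)\frac{(v_++\eta)^2}{r^{n+1}}. \] Then for any $v_+>0$ and $\theta_+>0$ there exist positive constants $\epsilon_0$ and $C$ such that: (I) If $u_->0$ and $|u_-|+|\eta_-|+|\chi_-|\le\epsilon_0$, there exists a unique smooth solution $(\eta,\chi)$ of the problem satisfying $|\eta(r)|,|\chi(r)|\le Cr^{-(n-2)}(|u_-|+|\eta_-|+|\chi_-|)$ for all $r\ge1$. (II) If $u_-<0$ and $|u_-|+|\chi_-|\le\epsilon_0$, there exists a unique smooth solution $(\eta,\chi)$ of the problem satisfying $|\eta(r)|,|\chi(r)|\le Cr^{-(n-2)}(|u_-|+|\chi_-|)$ for all $r\ge1$.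
   Context: Here $\eta=v-v_+$ and $\chi=\theta-\theta_+$, where $v=1/\rho$ is the specific volume of a radially symmetric stationary flow of a viscous heat-conductive polytropic ideal gas outside the unit sphere in $\mathbb{R}^n$. Fixed constants: $R>0$ (gas constant), $c_V>0$ (specific heat at constant volume), $c_P:=R+c_V$; viscosity coefficients $\nu>0$, $\lambda$ with $2\nu+n\lambda\ge0$, $\mu:=2\nu+\lambda>0$; heat conductivity $\kappa>0$. The constant $\alpha$ is part of the unknowns (determined by the solution so that $\chi(1)=\chi_-$). The constants $\epsilon_0,C$ may depend on $v_+,\theta_+$ and the fixed constants $n,R,c_V,\nu,\lambda,\kappa$, but not on $u_-,\eta_-,\chi_-$. *)

theory Defs
  imports "HOL-Analysis.Analysis"
begin

definition smooth_on :: "real set \<Rightarrow> (real \<Rightarrow> real) \<Rightarrow> bool" where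
  "smooth_on S f \<longleftrightarrow> (\<exists>D :: nat \<Rightarrow> real \<Rightarrow> real. D 0 = f \<and>
      (\<forall>k. \<forall>x\<in>S. (D k has_real_derivative D (Suc k) x) (at x within S)))"

definition F_term :: "nat \<Rightarrow> real \<Rightarrow> real \<Rightarrow> real \<Rightarrow> real \<Rightarrow> real \<Rightarrow>
    (real \<Rightarrow> real) \<Rightarrow> (real \<Rightarrow> real) \<Rightarrow> real \<Rightarrow> real" where
  "F_term n R mu vp thp eps eta chi r =
     R * r^(n-1) * chi r * eta r / (eps * mu * vp * (vp + eta r))
   + R * thp * r^(n-1) * (eta r)^2 / (eps * mu * vp^2 * (vp + eta r))
   + eps * vp / (2 * mu * r^(n-1))
   + eps * eta r / (mu * r^(n-1))
   - eps * (real n - 1) * r^(n-1) / mu * integral {r..} (\<lambda>s. eta s / s^(2*n-1))"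

definition Phi_term :: "nat \<Rightarrow> real \<Rightarrow> real \<Rightarrow> real \<Rightarrow>
    (real \<Rightarrow> real) \<Rightarrow> (real \<Rightarrow> real) \<Rightarrow> real \<Rightarrow> real" where
  "Phi_term n nu eps vp eta eta_r r =
     - 4 * eps^2 * nu * (real n - 1) * (vp + eta r) * eta_r r / r^n
     + 2 * eps^2 * nu * real n * (real n - 1) * (vp + eta r)^2 / r^(n+1)"

definition is_solution :: "nat \<Rightarrow> real \<Rightarrow> real \<Rightarrow> real \<Rightarrow> real \<Rightarrow> real \<Rightarrow> real \<Rightarrow> real \<Rightarrow>
    real \<Rightarrow> real \<Rightarrow> real \<Rightarrow> (real \<Rightarrow> real) \<Rightarrow> (real \<Rightarrow> real) \<Rightarrow> real \<Rightarrow> bool" where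
  "is_solution n R cV nu lam kappa vp thp um vm thm eta chi alpha \<longleftrightarrow>
    (let cP = R + cV; mu = 2 * nu + lam; etam = vm - vp; chim = thm - thp;
         eps = (if um > 0 then um / vm else um / (vp + eta 1)) in
     smooth_on {1..} eta \<and> smooth_on {1..} chi \<and>
     (\<forall>r>1. (\<lambda>s. eta s / s^(2*n-1)) integrable_on {r..}) \<and>
     (\<forall>r>1. (\<lambda>s. Phi_term n nu eps vp eta (deriv eta) s) integrable_on {r..}) \<and>
     (\<forall>r>1. deriv eta r + R * thp * r^(n-1) / (eps * mu * vp^2) * eta r
             = R * r^(n-1) / (eps * mu * vp) * chi r + F_term n R mu vp thp eps eta chi r) \<and>
     (\<forall>r>1. deriv chi r =
             - alpha / (kappa * r^(n-1)) + eps * cP / (kappa * r^(n-1)) * chi r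
             + eps^3 / 2 * (vp + eta r)^2 / (kappa * r^(3*(n-1)))
             - eps^2 * mu * (vp + eta r) * deriv eta r / (kappa * r^(2*(n-1)))
             + 1 / (kappa * r^(n-1)) * integral {r..} (\<lambda>s. Phi_term n nu eps vp eta (deriv eta) s)) \<and>
     (eta \<longlongrightarrow> 0) at_top \<and> (chi \<longlongrightarrow> 0) at_top \<and>
     (if um > 0 then eta 1 = etam \<and> chi 1 = chim else chi 1 = chim))"

end

theory Submission
  imports Defs
begin

text \<open>
  Write \<open>n = k + 2\<close>. The integrand \<open>\<Phi>\<close> is an exact derivative, and the first equation
  eliminates \<open>\<eta>\<^sub>r\<close> from the second. What remains is a transport equation for \<open>\<eta>\<close>, strongly damped
  (forwards for \<open>\<epsilon> > 0\<close>, backwards for \<open>\<epsilon> < 0\<close>) and driven linearly by \<open>\<chi>\<close>, and an equation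
  \<open>\<chi>\<^sub>r = - \<alpha> / (\<kappa> r\<^sup>n\<^sup>-\<^sup>1) + G\<close> in which \<open>G\<close> is quadratic in the data. Barriers of the form \<open>M / r\<^sup>k\<close>
  bound the solutions of both linear problems uniformly in small \<open>\<epsilon>\<close>, so that first updating \<open>\<chi>\<close> and
  then \<open>\<eta>\<close> is a contraction on a ball of the space with norm \<open>sup r\<^sup>k \<bar>f r\<bar>\<close>. For \<open>u\<^sub>- < 0\<close> the flux \<open>\<epsilon>\<close>
  depends on \<open>\<eta> 1\<close>, but a change of \<open>\<epsilon>\<close> enters the transport equation only through the ratio
  \<open>\<epsilon>\<^sub>1 / \<epsilon>\<^sub>2 - 1\<close>, multiplied by a source that is itself small. Smoothness holds because the solution,
  \<open>r\<close>, \<open>1 / r\<close>, \<open>1 / (v\<^sub>+ + \<eta>)\<close> and the tail integral of \<open>\<eta>\<close> generate an algebra closed under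
  differentiation.
\<close>

section \<open>Linear problems on the half-line\<close>

text \<open>The obstacle is the factor \<open>1 / \<epsilon>\<close> in the equation for \<eta>,
  which is singular as \<epsilon> tends to 0. Multiplied by \<open>\<epsilon> / r^(n-1)\<close>,
  that equation keeps a damping coefficient free of \<epsilon>, and \<epsilon> is left only in front
  of the derivative and in quadratic terms. The linear coupling to \<chi> is not small, so updating
  both functions at once need not contract. If \<chi> is updated first, its increment is already
  small compared with the distance of the inputs, and the coupling does no harm. The weight comes
  from the \<alpha> term: \<open>1 / r^(n-1)\<close> integrates to a multiple of
  \<open>1 / r^k\<close>, the slowest decay present. The unknown \<alpha> is the coefficient of this
  homogeneous solution and is fixed by the value of \<chi> at 1. For \<open>\<epsilon> < 0\<close>
  no value of \<eta> at 1 is prescribed; boundedness at infinity selects the solution.\<close>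

lemma nonneg_has_integral_tail:
  fixes Q q :: "real \<Rightarrow> real"
  assumes Q: "\<And>s. s \<ge> 1 \<Longrightarrow> (Q has_real_derivative - q s) (at s within {1..})"
    and q: "\<And>s. s \<ge> 1 \<Longrightarrow> 0 \<le> q s" and lim: "(Q \<longlongrightarrow> 0) at_top" and r: "r \<ge> 1"
  shows "(q has_integral Q r) {r..}"
proof -
  have I: "(q has_integral (Q r - Q y)) {r..y}" if "r \<le> y" for y
  proof -
    have "((\<lambda>s. - Q s) has_vector_derivative q s) (at s within {r..y})" if "s \<in> {r..y}" for s
    proof -
      have "((\<lambda>s. - Q s) has_real_derivative - (- q s)) (at s within {r..y})"
        by (intro DERIV_minus DERIV_subset[OF Q]) (use r that in auto)
      then show ?thesis by (simp add: has_real_derivative_iff_has_vector_derivative)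
    qed
    from fundamental_theorem_of_calculus[OF that this] show ?thesis by simp
  qed
  show ?thesis
  proof (rule has_integral_to_inf)
    show "q integrable_on {r..y}" for y
      using I[of y] by (cases "r \<le> y") (auto simp: integrable_on_def)
    have "((\<lambda>y. Q r - Q y) \<longlongrightarrow> Q r - 0) at_top"
      by (intro tendsto_intros lim)
    moreover have "eventually (\<lambda>y. Q r - Q y = integral {r..y} q) at_top"
      using eventually_ge_at_top[of r] by eventually_elim (metis I integral_unique)
    ultimately show "((\<lambda>y. integral {r..y} q) \<longlongrightarrow> Q r) at_top"
      using tendsto_cong by fastforce
  qed (use q r in auto)
qed

text \<open>The majorant enters through an explicit primitive \<open>Q\<close> vanishing at
  infinity, so the same data give integrability, the bound and the derivative. \<open>Q\<close> is
  an inverse power for the integral terms and an exponential for the transport equation solved from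
  infinity.\<close>

lemma dominated_tail:
  fixes p Q q :: "real \<Rightarrow> real"
  assumes p: "continuous_on {1..} p"
    and Q: "\<And>s. s \<ge> 1 \<Longrightarrow> (Q has_real_derivative - q s) (at s within {1..})"
    and le: "\<And>s. s \<ge> 1 \<Longrightarrow> \<bar>p s\<bar> \<le> q s" and lim: "(Q \<longlongrightarrow> 0) at_top" and r: "r \<ge> 1"
  shows "p integrable_on {r..}" and "\<bar>integral {r..} p\<bar> \<le> Q r"
    and "((\<lambda>r. integral {r..} p) has_real_derivative - p r) (at r within {1..})"
proof -
  have q: "(q has_integral Q t) {t..}" if "t \<ge> 1" for t
    by (rule nonneg_has_integral_tail[OF Q _ lim that]) (use le abs_ge_zero order_trans in \<open>blast+\<close>)
  have int: "p integrable_on {t..}" if t: "t \<ge> 1" for t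
  proof (rule measurable_bounded_by_integrable_imp_integrable)
    show "p \<in> borel_measurable (lebesgue_on {t..})"
      by (rule continuous_imp_measurable_on_sets_lebesgue) (use t in \<open>auto intro: continuous_on_subset[OF p]\<close>)
    show "q integrable_on {t..}" using q[OF t] by (auto simp: integrable_on_def)
  qed (use t le in auto)
  show "p integrable_on {r..}" by (rule int[OF r])
  have "norm (integral {r..} p) \<le> integral {r..} q"
    by (rule integral_norm_bound_integral) (use int[OF r] q[OF r] r le in \<open>auto simp: integrable_on_def\<close>)
  then show "\<bar>integral {r..} p\<bar> \<le> Q r" using q[OF r] by (simp add: integral_unique)
  have split: "integral {t..} p = integral {1..} p - integral {1..t} p" if t: "t \<ge> 1" for t
  proof -
    have "negligible ({1..t} \<inter> {t..})"
      by (rule negligible_subset[OF negligible_sing[of t]]) auto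
    moreover have "p integrable_on {1..t}"
      by (intro integrable_continuous_real continuous_on_subset[OF p]) auto
    moreover have "{1..} = {1..t} \<union> {t..}" using t by auto
    ultimately show ?thesis using int[OF t] by simp
  qed
  have "((\<lambda>u. integral {1..u} p) has_real_derivative p r) (at r within {1..r+1})"
    by (rule integral_has_real_derivative) (use r in \<open>auto intro: continuous_on_subset[OF p]\<close>)
  \<comment> \<open>The two sets agree on the neighbourhood \<open>{..<r+1}\<close> of
    \<open>r\<close>; at \<open>r = 1\<close> the derivative stays one-sided.\<close>
  then have "((\<lambda>u. integral {1..u} p) has_real_derivative p r) (at r within {1..})"
    by (subst at_within_nhd[where S = "{..<r+1}" and U = "{1..r+1}"]) (use r in force)+
  then have D: "((\<lambda>u. integral {1..} p - integral {1..u} p) has_real_derivative 0 - p r) (at r within {1..})"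
    by (intro DERIV_diff DERIV_const)
  show "((\<lambda>r. integral {r..} p) has_real_derivative - p r) (at r within {1..})"
    by (rule has_field_derivative_transform_within[OF D[simplified], of 1])
       (use r in \<open>auto intro: split[symmetric]\<close>)
qed

lemma inverse_power_has_derivative:
  fixes s M :: real
  assumes "s \<ge> 1" "k \<ge> 1"
  shows "((\<lambda>s. M / s^k) has_real_derivative - (real k * M / s^(k+1))) (at s within X)"
proof -
  have "((\<lambda>s. M / s^k) has_real_derivative (0 * s^k - M * (real k * s^(k-1))) / (s^k * s^k)) (at s within X)"
    using assms by (auto intro!: derivative_eq_intros)
  moreover have "s^k * s^k = s^(k-1) * s^(k+1)"
    using assms by (cases k) simp_all
  then have "(0 * s^k - M * (real k * s^(k-1))) / (s^k * s^k) = - (real k * M / s^(k+1))"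
    using assms by (simp add: field_simps)
  ultimately show ?thesis by simp
qed

lemma tendsto_inverse_power_at_top:
  fixes M :: real
  assumes "k \<ge> 1"
  shows "((\<lambda>s. M / s^k) \<longlongrightarrow> 0) at_top"
  using assms by (intro tendsto_divide_0[OF tendsto_const] filterlim_at_top_imp_at_infinity
     filterlim_pow_at_top filterlim_ident) auto

text \<open>A source of order \<open>1 / r^(k+1)\<close> integrates to the weight
  \<open>1 / r^k\<close> of the norm. The primitive brings a factor \<open>1 / real k\<close>, which
  is at most 1 and is dropped.\<close>

lemma power_tail:
  fixes p :: "real \<Rightarrow> real"
  assumes p: "continuous_on {1..} p" and k: "k \<ge> 1"
    and le: "\<And>s. s \<ge> 1 \<Longrightarrow> \<bar>p s\<bar> \<le> M / s^(k+1)" and r: "r \<ge> 1"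
  shows "p integrable_on {r..}" and "\<bar>integral {r..} p\<bar> \<le> M / r^k"
    and "((\<lambda>r. integral {r..} p) has_real_derivative - p r) (at r within {1..})"
proof -
  have M: "M \<ge> 0" using le[of 1] by auto
  have D: "((\<lambda>s. M / real k / s^k) has_real_derivative - (M / s^(k+1))) (at s within {1..})"
    if "s \<ge> 1" for s
    using inverse_power_has_derivative[OF that k, of "M / real k" "{1..}"] k by simp
  note T = dominated_tail[OF p D le tendsto_inverse_power_at_top[OF k] r]
  show "p integrable_on {r..}" "((\<lambda>r. integral {r..} p) has_real_derivative - p r) (at r within {1..})"
    by (rule T(1) T(3); simp)+
  have "\<bar>integral {r..} p\<bar> \<le> M / real k / r^k" by (rule T(2)) simp_all
  also have "\<dots> \<le> M / r^k"
    using r k M by (intro divide_right_mono) (auto simp: divide_le_eq mult_le_cancel_left1)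
  finally show "\<bar>integral {r..} p\<bar> \<le> M / r^k" .
qed

section \<open>The equation for \<chi>: comparison with inverse powers\<close>

lemma nonneg_if_decreasing_to_0:
  fixes f :: "real \<Rightarrow> real"
  assumes "continuous_on {1..} f" "(f \<longlongrightarrow> 0) at_top"
    and D: "\<And>x. x > 1 \<Longrightarrow> \<exists>y. DERIV f x :> y \<and> y \<le> 0" and r: "r \<ge> 1"
  shows "0 \<le> f r"
proof (rule tendsto_upperbound[OF assms(2)])
  have "f y \<le> f r" if "y \<ge> r" for y
    by (rule DERIV_nonpos_imp_decreasing_open[OF that])
       (use r D in \<open>auto intro: continuous_on_subset[OF assms(1)]\<close>)
  then show "eventually (\<lambda>y. f y \<le> f r) at_top"
    using eventually_ge_at_top[of r] by (rule eventually_mono[rotated])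
qed simp

text \<open>The derivative of \<open>M / r^k\<close> is \<open>- (real k * M / r^(k+1))\<close>,
  which outweighs \<open>p\<close> because \<open>k \<ge> 1\<close>. So \<open>M / r^k + E r\<close>
  and \<open>M / r^k - E r\<close> both decrease to 0.\<close>

lemma abs_le_of_DERIV_le_inverse_power:
  fixes E p :: "real \<Rightarrow> real"
  assumes E: "continuous_on {1..} E" "(E \<longlongrightarrow> 0) at_top" and k: "k \<ge> 1"
    and D: "\<And>r. r > 1 \<Longrightarrow> DERIV E r :> p r"
    and p: "\<And>r. r > 1 \<Longrightarrow> \<bar>p r\<bar> \<le> M / r^(k+1)" and M: "M \<ge> 0" and r: "r \<ge> 1"
  shows "\<bar>E r\<bar> \<le> M / r^k"
proof -
  have *: "0 \<le> M / r^k + s * E r" if s: "s = 1 \<or> s = -1" for s :: real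
  proof (rule nonneg_if_decreasing_to_0[OF _ _ _ r])
    show "continuous_on {1..} (\<lambda>r. M / r^k + s * E r)"
      by (intro continuous_intros E) auto
    show "((\<lambda>r. M / r^k + s * E r) \<longlongrightarrow> 0) at_top"
      using tendsto_add[OF tendsto_inverse_power_at_top[OF k, of M] tendsto_mult[OF tendsto_const[of s] E(2)]] by simp
    fix x :: real assume x: "x > 1"
    have "DERIV (\<lambda>r. M / r^k + s * E r) x :> - (real k * M / x^(k+1)) + s * p x"
      by (rule DERIV_add[OF inverse_power_has_derivative[OF _ k] DERIV_cmult[OF D[OF x]]]) (use x in auto)
    moreover have "M / x^(k+1) \<le> real k * M / x^(k+1)"
      using k x M by (intro divide_right_mono) (auto simp: mult_le_cancel_right1)
    then have "- (real k * M / x^(k+1)) + s * p x \<le> 0" using p[OF x] s by (auto simp: abs_le_iff)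
    ultimately show "\<exists>y. DERIV (\<lambda>r. M / r^k + s * E r) x :> y \<and> y \<le> 0" by blast
  qed
  show ?thesis using *[of 1] *[of "-1"] by simp
qed

text \<open>No bound on \<open>A\<close> is assumed. Its term is the derivative of
  \<open>b / r^k\<close> with \<open>b = A / real k\<close>; the remainder is controlled by the
  barrier, and evaluation at 1 then bounds \<open>b\<close> by \<open>\<bar>D 1\<bar> + M\<close>.
  Using the barrier twice gives \<open>2 * M\<close>.\<close>

lemma diffusion_bound:
  fixes D p :: "real \<Rightarrow> real"
  assumes D: "continuous_on {1..} D" "(D \<longlongrightarrow> 0) at_top" and k: "k \<ge> 1"
    and D': "\<And>r. r > 1 \<Longrightarrow> DERIV D r :> - A / r^(k+1) + p r"
    and p: "\<And>r. r > 1 \<Longrightarrow> \<bar>p r\<bar> \<le> M / r^(k+1)" and M: "M \<ge> 0" and r: "r \<ge> 1"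
  shows "\<bar>D r\<bar> \<le> (\<bar>D 1\<bar> + 2 * M) / r^k"
proof -
  define b where "b = A / real k"
  define E where "E = (\<lambda>r. D r - b / r^k)"
  have E: "\<bar>E r\<bar> \<le> M / r^k" if "r \<ge> 1" for r
  proof (rule abs_le_of_DERIV_le_inverse_power[OF _ _ k _ p M that])
    show "continuous_on {1..} E" unfolding E_def by (intro continuous_intros D) auto
    show "(E \<longlongrightarrow> 0) at_top" unfolding E_def
      using tendsto_diff[OF D(2) tendsto_inverse_power_at_top[OF k, of b]] by simp
    show "DERIV E x :> p x" if "x > 1" for x
      unfolding E_def using DERIV_diff[OF D'[OF that] inverse_power_has_derivative[OF _ k, of x b]] that k
      by (simp add: b_def)
  qed
  have "\<bar>b\<bar> \<le> \<bar>D 1\<bar> + M" using E[of 1] unfolding E_def by auto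
  then have "\<bar>b / r^k\<bar> \<le> (\<bar>D 1\<bar> + M) / r^k" using r by (simp add: divide_right_mono)
  moreover have "\<bar>D r\<bar> \<le> \<bar>E r\<bar> + \<bar>b / r^k\<bar>" unfolding E_def by linarith
  ultimately show ?thesis using E[OF r] by (simp add: add_divide_distrib)
qed

lemma diffusion_solution:
  fixes p :: "real \<Rightarrow> real"
  assumes p: "continuous_on {1..} p" and k: "k \<ge> 1"
    and le: "\<And>s. s \<ge> 1 \<Longrightarrow> \<bar>p s\<bar> \<le> M / s^(k+1)"
  obtains D A where "\<And>r. r \<ge> 1 \<Longrightarrow> (D has_real_derivative - A / r^(k+1) + p r) (at r within {1..})"
    "D 1 = c" "(D \<longlongrightarrow> 0) at_top"
proof
  \<comment> \<open>The coefficient of the homogeneous solution \<open>1 / r^k\<close> is adjusted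
    to meet the value \<open>c\<close> at 1; \<open>A\<close> becomes
    \<open>real k * b\<close>.\<close>
  define b where "b = c + integral {1..} p"
  define D where "D = (\<lambda>r. b / r^k - integral {r..} p)"
  note T = power_tail[OF p k le]
  show "(D has_real_derivative - (real k * b) / r^(k+1) + p r) (at r within {1..})" if "r \<ge> 1" for r
    using DERIV_diff[OF inverse_power_has_derivative[OF that k, of b] T(3)[OF _ that]]
    unfolding D_def by simp
  show "D 1 = c" by (simp add: D_def b_def)
  have "((\<lambda>r. integral {r..} p) \<longlongrightarrow> 0) at_top"
    by (rule Lim_null_comparison[OF _ tendsto_inverse_power_at_top[OF k, of M]])
       (use T(2) in \<open>auto intro!: eventually_at_top_linorderI[of 1]\<close>)
  then show "(D \<longlongrightarrow> 0) at_top"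
    unfolding D_def using tendsto_diff[OF tendsto_inverse_power_at_top[OF k, of b]] by fastforce
qed

section \<open>The equation for \<eta>: integrating factor and comparison\<close>

lemma exp_power_has_derivative:
  fixes b r :: real
  shows "((\<lambda>r. exp (b * r^(k+2))) has_real_derivative exp (b * r^(k+2)) * (b * real (k+2) * r^(k+1))) (at r within X)"
proof -
  have "((\<lambda>r. b * r^(k+2)) has_real_derivative b * (real (k+2) * r^(k+1))) (at r within X)"
    using DERIV_cmult[OF DERIV_pow[of "k+2" r X], of b] by simp
  from DERIV_chain2[OF DERIV_exp this] show ?thesis by (simp only: mult.assoc)
qed

lemma exp_power_tendsto_0:
  fixes b :: real
  assumes "b < 0"
  shows "((\<lambda>r. exp (b * r^(k+2))) \<longlongrightarrow> 0) at_top"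
proof -
  have "filterlim (\<lambda>r::real. r^(k+2)) at_top at_top"
    by (rule filterlim_pow_at_top) (auto intro: filterlim_ident)
  then have "filterlim (\<lambda>r. b * r^(k+2)) at_bot at_top"
    using assms filterlim_tendsto_neg_mult_at_bot tendsto_const by blast
  then show ?thesis by (rule filterlim_compose[OF exp_at_bot])
qed

text \<open>After multiplication by the integrating factor, \<open>L / r^k + y r\<close> and
  \<open>L / r^k - y r\<close> become monotone: increasing from a nonnegative value at 1 for
  \<open>e > 0\<close>, decreasing to 0 for \<open>e < 0\<close>. Hence \<open>y 1\<close> counts
  only in the first case and boundedness is asked only in the second. The bound does not degenerate
  as \<open>e\<close> tends to 0.\<close>

lemma transport_bound:
  fixes y q :: "real \<Rightarrow> real" and a e M :: real
  assumes y: "continuous_on {1..} y"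
    and D: "\<And>r. r > 1 \<Longrightarrow> DERIV y r :> r^(k+1) / e * (q r - a * y r)"
    and q: "\<And>r. r > 1 \<Longrightarrow> \<bar>q r\<bar> \<le> M / r^k" and M: "M \<ge> 0"
    and e: "e \<noteq> 0" "\<bar>e\<bar> * real k \<le> a / 2" and a: "a > 0" and k: "k \<ge> 1"
    and bdd: "e < 0 \<Longrightarrow> \<exists>B. \<forall>r\<ge>1. \<bar>y r\<bar> \<le> B" and r: "r \<ge> 1"
  shows "\<bar>y r\<bar> \<le> (2 * M / a + (if e > 0 then \<bar>y 1\<bar> else 0)) / r^k"
proof -
  define L where "L = 2 * M / a + (if e > 0 then \<bar>y 1\<bar> else 0)"
  have L: "L \<ge> 0" "a * L \<ge> 2 * M" using M a by (auto simp: L_def field_simps)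
  define b where "b = a / (e * real (k+2))"
  have b: "b * real (k+2) = a / e" using e by (simp add: b_def)
  have *: "0 \<le> L / r^k + s * y r" if s: "s = 1 \<or> s = -1" for s
  proof -
    define z where "z = (\<lambda>r. L / r^k + s * y r)"
    define f where "f = (\<lambda>r. exp (b * r^(k+2)) * z r)"
    have zc: "continuous_on {1..} z" unfolding z_def by (intro continuous_intros y) auto
    have fc: "continuous_on {1..} f" unfolding f_def by (intro continuous_intros zc)
    \<comment> \<open>\<open>g x / e\<close> is \<open>z'\<close> plus the damping term
      \<open>(a / e) * x^(k+1) * z x\<close>. For its sign, \<open>a * L\<close> is split into
      halves: one absorbs \<open>q\<close>, as \<open>a * L \<ge> 2 * M\<close>, the other absorbs
      the derivative of the barrier, as \<open>\<bar>e\<bar> * real k \<le> a / 2\<close>.\<close>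
    define g where "g = (\<lambda>x. x^(k+1) * (a * L / x^k + s * q x) - e * real k * L / x^(k+1))"
    have g: "g x \<ge> 0" if x: "x > 1" for x
    proof -
      have 1: "a * L / x^k - M / x^k \<le> a * L / x^k + s * q x" using q[OF x] s by auto
      have "a * L - M \<le> (a * L - M) * x" using x L M by (simp add: mult_le_cancel_left1)
      also have "\<dots> = x^(k+1) * (a * L / x^k - M / x^k)" using x by (simp add: field_simps)
      also have "\<dots> \<le> x^(k+1) * (a * L / x^k + s * q x)" using 1 x by (intro mult_left_mono) auto
      finally have A: "a * L - M \<le> x^(k+1) * (a * L / x^k + s * q x)" .
      have "e * real k * L \<le> \<bar>e\<bar> * real k * L" using L(1) by (intro mult_right_mono) auto
      also have "\<dots> \<le> a / 2 * L" using e L(1) by (intro mult_right_mono) auto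
      finally have "e * real k * L / x^(k+1) \<le> a / 2 * L / x^(k+1)" using x by (intro divide_right_mono) auto
      also have "\<dots> \<le> a / 2 * L / 1" using x a L(1) by (intro divide_left_mono) (auto intro: one_le_power simp del: power_Suc)
      finally show ?thesis using A L(2) unfolding g_def div_by_1 by linarith
    qed
    have fD: "DERIV f x :> exp (b * x^(k+2)) * (g x / e)" if x: "x > 1" for x
    proof -
      have "DERIV z x :> - (real k * L / x^(k+1)) + s * (x^(k+1) / e * (q x - a * y x))"
        unfolding z_def by (rule DERIV_add[OF inverse_power_has_derivative[OF _ k] DERIV_cmult[OF D[OF x]]]) (use x in auto)
      from DERIV_mult[OF exp_power_has_derivative this, of b k]
      have "DERIV f x :> exp (b * x^(k+2)) * (a / e * x^(k+1)) * z x +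
         (- (real k * L / x^(k+1)) + s * (x^(k+1) / e * (q x - a * y x))) * exp (b * x^(k+2))"
        unfolding f_def b by simp
      moreover have "a / e * x^(k+1) * z x + (- (real k * L / x^(k+1)) + s * (x^(k+1) / e * (q x - a * y x))) = g x / e"
        unfolding g_def z_def using e by (simp add: algebra_simps add_divide_distrib diff_divide_distrib)
      ultimately show ?thesis by (metis (no_types, lifting) distrib_left mult.assoc mult.commute)
    qed
    have "0 \<le> f r"
    proof (cases "e > 0")
      case True
      have "f 1 \<le> f r"
      proof (rule DERIV_nonneg_imp_increasing_open[OF r])
        fix x :: real assume x: "1 < x"
        have "0 \<le> exp (b * x^(k+2)) * (g x / e)" using g[OF x] True by simp
        then show "\<exists>y. DERIV f x :> y \<and> 0 \<le> y" using fD[OF x] by blast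
      qed (auto intro: continuous_on_subset[OF fc])
      moreover have "0 \<le> 2 * M / a" using M a by simp
      then have "0 \<le> z 1" using True s by (auto simp: z_def L_def)
      ultimately show ?thesis by (auto simp: f_def intro: order_trans[rotated])
    next
      case False
      then have e': "e < 0" using e by simp
      then obtain B where B: "\<And>r. r \<ge> 1 \<Longrightarrow> \<bar>y r\<bar> \<le> B" using bdd by blast
      \<comment> \<open>The integrating factor now tends to 0 at infinity, so for bounded
        \<open>y\<close> the limit 0 of \<open>f\<close> takes the place of an initial
        value.\<close>
      have b0: "b < 0" using e' a by (simp add: b_def divide_pos_neg mult_neg_pos)
      show ?thesis
      proof (rule nonneg_if_decreasing_to_0[OF fc _ _ r])
        have "((\<lambda>r. (L + B) * exp (b * r^(k+2))) \<longlongrightarrow> (L + B) * 0) at_top"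
          by (intro tendsto_intros exp_power_tendsto_0 b0)
        then have 0: "((\<lambda>r. (L + B) * exp (b * r^(k+2))) \<longlongrightarrow> 0) at_top" by simp
        show "(f \<longlongrightarrow> 0) at_top"
        proof (rule Lim_null_comparison[OF _ 0])
          have "norm (f x) \<le> (L + B) * exp (b * x^(k+2))" if x: "x \<ge> 1" for x
          proof -
            have "L / x^k \<le> L / 1" using L x by (intro divide_left_mono) auto
            moreover have "0 \<le> L / x^k" using L x by simp
            ultimately have "\<bar>z x\<bar> \<le> L + B" unfolding z_def using B[OF x] s by auto
            then show ?thesis by (simp add: f_def abs_mult mult.commute mult_left_mono)
          qed
          then show "\<forall>\<^sub>F x in at_top. norm (f x) \<le> (L + B) * exp (b * x^(k+2))"
            by (rule eventually_at_top_linorderI)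
        qed
        fix x :: real assume x: "1 < x"
        have "exp (b * x^(k+2)) * (g x / e) \<le> 0"
          using g[OF x] e' by (intro mult_nonneg_nonpos divide_nonneg_neg) auto
        then show "\<exists>y. DERIV f x :> y \<and> y \<le> 0" using fD[OF x] by blast
      qed
    qed
    then show ?thesis by (simp add: f_def z_def zero_le_mult_iff)
  qed
  show ?thesis using *[of 1] *[of "-1"] unfolding L_def by simp
qed

text \<open>Variation of constants, integrating from 1 outwards for \<open>e > 0\<close> and from
  infinity inwards for \<open>e < 0\<close>. The second choice leaves no free constant, so
  \<open>c\<close> is met only for \<open>e > 0\<close>; in return it gives the boundedness that
  \<open>transport_bound\<close> requires.\<close>

lemma transport_solution:
  fixes q :: "real \<Rightarrow> real" and a e :: real
  assumes q: "continuous_on {1..} q" and le: "\<And>r. r \<ge> 1 \<Longrightarrow> \<bar>q r\<bar> \<le> M"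
    and a: "a > 0" and e: "e \<noteq> 0"
  obtains y where "\<And>r. r \<ge> 1 \<Longrightarrow> (y has_real_derivative r^(k+1) / e * (q r - a * y r)) (at r within {1..})"
    "e > 0 \<Longrightarrow> y 1 = c" "\<And>r. e < 0 \<Longrightarrow> r \<ge> 1 \<Longrightarrow> \<bar>y r\<bar> \<le> M / a"
proof -
  define b where "b = a / (e * real (k+2))"
  have b: "b * real (k+2) = a / e" using e by (simp add: b_def)
  define p where "p = (\<lambda>r. exp (b * r^(k+2)) * (r^(k+1) / e * q r))"
  have p: "continuous_on {1..} p" unfolding p_def using e by (intro continuous_intros q) auto
  have sol: "((\<lambda>r. exp (- b * r^(k+2)) * P r) has_real_derivative r^(k+1) / e * (q r - a * (exp (- b * r^(k+2)) * P r))) (at r within {1..})"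
    if P: "(P has_real_derivative p r) (at r within {1..})" for P r
  proof -
    have "exp (- b * r^(k+2)) * p r = r^(k+1) / e * q r"
      by (simp add: p_def mult.assoc[symmetric] exp_minus del: power_Suc mult.assoc)
    moreover have "exp (- b * r^(k+2)) * (- b * real (k+2) * r^(k+1)) = - (a / e) * r^(k+1) * exp (- b * r^(k+2))"
      using b by (simp del: of_nat_add add: mult.commute mult.left_commute)
    ultimately have "exp (- b * r^(k+2)) * (- b * real (k+2) * r^(k+1)) * P r + p r * exp (- b * r^(k+2))
        = - (a / e) * r^(k+1) * exp (- b * r^(k+2)) * P r + r^(k+1) / e * q r"
      by (simp only: mult.commute[of "p r"])
    also have "\<dots> = r^(k+1) / e * (q r - a * (exp (- b * r^(k+2)) * P r))"
      by (simp add: right_diff_distrib mult_ac)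
    finally show ?thesis
      by (rule DERIV_cong[OF DERIV_mult[OF exp_power_has_derivative[of "-b" k r] P]])
  qed
  show ?thesis
  proof (cases "e > 0")
    case True
    define P where "P = (\<lambda>r. c * exp b + integral {1..r} p)"
    have P: "(P has_real_derivative p r) (at r within {1..})" if r: "r \<ge> 1" for r
    proof -
      have "((\<lambda>u. integral {1..u} p) has_real_derivative p r) (at r within {1..r+1})"
        by (rule integral_has_real_derivative) (use r in \<open>auto intro: continuous_on_subset[OF p]\<close>)
      then have "((\<lambda>u. integral {1..u} p) has_real_derivative p r) (at r within {1..})"
        by (subst at_within_nhd[where S = "{..<r+1}" and U = "{1..r+1}"]) (use r in force)+
      from DERIV_add[OF DERIV_const this] show ?thesis unfolding P_def by simp
    qed
    show ?thesis
      by (rule that[of "\<lambda>r. exp (- b * r^(k+2)) * P r"], rule sol[OF P])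
         (use True in \<open>auto simp: P_def exp_minus\<close>)
  next
    case False
    then have e': "e < 0" using e by simp
    then have b0: "b < 0" using a by (simp add: b_def divide_pos_neg mult_neg_pos)
    \<comment> \<open>The weight \<open>r^(k+1)\<close> is, up to a constant, the derivative of the
      exponent, so the majorant of \<open>p\<close> has this elementary primitive; dividing by the
      integrating factor leaves exactly \<open>M / a\<close>.\<close>
    define Q where "Q = (\<lambda>r. M / a * exp (b * r^(k+2)))"
    have QD: "(Q has_real_derivative - (- (M / e) * r^(k+1) * exp (b * r^(k+2)))) (at r within {1..})" for r
    proof -
      have "(Q has_real_derivative M / a * (exp (b * r^(k+2)) * (a / e * r^(k+1)))) (at r within {1..})"
        unfolding Q_def b[symmetric] by (rule DERIV_cmult[OF exp_power_has_derivative])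
      then show ?thesis by (rule DERIV_cong) (use a in simp)
    qed
    have Q0: "(Q \<longlongrightarrow> 0) at_top"
      unfolding Q_def using tendsto_mult[OF tendsto_const[of "M / a"] exp_power_tendsto_0[OF b0, of k]] by simp
    have pQ: "\<bar>p s\<bar> \<le> - (M / e) * s^(k+1) * exp (b * s^(k+2))" if "s \<ge> 1" for s
    proof -
      have "\<bar>p s\<bar> = \<bar>q s\<bar> * (- (1 / e) * s^(k+1) * exp (b * s^(k+2)))"
        using e' that by (simp add: p_def abs_mult)
      also have "\<dots> \<le> M * (- (1 / e) * s^(k+1) * exp (b * s^(k+2)))"
        using e' that le by (intro mult_right_mono mult_nonneg_nonneg) auto
      finally show ?thesis by simp
    qed
    note T = dominated_tail[OF p QD pQ Q0]
    define P where "P = (\<lambda>r. - integral {r..} p)"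
    have P: "(P has_real_derivative p r) (at r within {1..})" if r: "r \<ge> 1" for r
      using DERIV_minus[OF T(3)[OF _ r]] by (simp add: P_def)
    show ?thesis
    proof (rule that[of "\<lambda>r. exp (- b * r^(k+2)) * P r"], rule sol[OF P])
      fix r :: real assume r: "r \<ge> 1"
      have "\<bar>exp (- b * r^(k+2)) * P r\<bar> = exp (- b * r^(k+2)) * \<bar>integral {r..} p\<bar>"
        by (simp add: abs_mult P_def)
      also have "\<dots> \<le> exp (- b * r^(k+2)) * Q r"
        by (rule mult_left_mono[OF T(2)]) (use r in auto)
      also have "\<dots> = M / a" by (simp add: Q_def exp_minus)
      finally show "\<bar>exp (- b * r^(k+2)) * P r\<bar> \<le> M / a" .
    qed (use False in auto)
  qed
qed

section \<open>A contraction principle\<close>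

definition decays :: "nat \<Rightarrow> real \<Rightarrow> (real \<Rightarrow> real) \<Rightarrow> bool" where
  "decays k \<sigma> f \<longleftrightarrow> continuous_on {1..} f \<and> (\<forall>r\<ge>1. \<bar>f r\<bar> \<le> \<sigma> / r^k)"

text \<open>Contraction principle for a relation instead of a map: contractivity is only needed between
  related pairs, so the images never have to be constructed explicitly.\<close>

lemma relational_fixed_point:
  fixes Rel :: "(real \<Rightarrow> real) \<Rightarrow> (real \<Rightarrow> real) \<Rightarrow> (real \<Rightarrow> real) \<Rightarrow> (real \<Rightarrow> real) \<Rightarrow> bool"
  assumes s: "\<sigma> \<ge> 0"
    and ex: "\<And>f g. decays k \<sigma> f \<Longrightarrow> decays k \<sigma> g \<Longrightarrow> \<exists>f' g'. decays k \<sigma> f' \<and> decays k \<sigma> g' \<and> Rel f g f' g'"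
    and lip: "\<And>f1 g1 f1' g1' f2 g2 f2' g2' d. decays k \<sigma> f1 \<Longrightarrow> decays k \<sigma> g1 \<Longrightarrow> decays k \<sigma> f1' \<Longrightarrow> decays k \<sigma> g1' \<Longrightarrow>
        decays k \<sigma> f2 \<Longrightarrow> decays k \<sigma> g2 \<Longrightarrow> decays k \<sigma> f2' \<Longrightarrow> decays k \<sigma> g2' \<Longrightarrow> Rel f1 g1 f1' g1' \<Longrightarrow> Rel f2 g2 f2' g2' \<Longrightarrow>
        (\<And>r. r \<ge> 1 \<Longrightarrow> \<bar>f1 r - f2 r\<bar> \<le> d / r^k) \<Longrightarrow> (\<And>r. r \<ge> 1 \<Longrightarrow> \<bar>g1 r - g2 r\<bar> \<le> d / r^k) \<Longrightarrow>
        (\<forall>r\<ge>1. \<bar>f1' r - f2' r\<bar> \<le> (d/4) / r^k \<and> \<bar>g1' r - g2' r\<bar> \<le> (d/4) / r^k)"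
  shows "\<exists>f g f' g'. decays k \<sigma> f \<and> decays k \<sigma> g \<and> decays k \<sigma> f' \<and> decays k \<sigma> g' \<and> Rel f g f' g' \<and> (\<forall>r\<ge>1. f r = f' r \<and> g r = g' r)"
proof -
  \<comment> \<open>\<open>enc\<close> multiplies by \<open>r^k\<close> and extends constantly to
    the left of 1; \<open>dec\<close> undoes this on \<open>{1..}\<close>. The weighted ball thus
    becomes a ball of bounded continuous functions, where completeness is available.\<close>
  define dec :: "(real \<Rightarrow>\<^sub>C real) \<Rightarrow> real \<Rightarrow> real" where "dec = (\<lambda>F r. F r / r^k)"
  define enc :: "(real \<Rightarrow> real) \<Rightarrow> (real \<Rightarrow>\<^sub>C real)" where
    "enc = (\<lambda>f. Bcontfun (\<lambda>r. f (max 1 r) * (max 1 r)^k))"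
  have decA: "decays k \<sigma> (dec F)" if "norm F \<le> \<sigma>" for F
  proof -
    have "\<bar>F r\<bar> \<le> \<sigma>" for r using norm_bounded[of F r] that by simp
    then show ?thesis unfolding decays_def dec_def
      by (auto intro!: continuous_intros divide_right_mono)
  qed
  have encb: "\<bar>f (max 1 r) * (max 1 r)^k\<bar> \<le> \<sigma>" if "decays k \<sigma> f" for f and r :: real
  proof -
    have "\<bar>f (max 1 r)\<bar> \<le> \<sigma> / (max 1 r)^k" using that unfolding decays_def by auto
    then show ?thesis by (simp add: abs_mult pos_le_divide_eq)
  qed
  have enc: "enc f r = f (max 1 r) * (max 1 r)^k" if "decays k \<sigma> f" for f r
  proof -
    have "continuous_on UNIV (\<lambda>r::real. f (max 1 r))"
      by (rule continuous_on_compose2[of "{1..}" f]) (use that in \<open>auto simp: decays_def intro!: continuous_intros\<close>)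
    then have "(\<lambda>r. f (max 1 r) * (max 1 r)^k) \<in> bcontfun"
      by (intro bcontfun_normI[of _ \<sigma>] continuous_intros) (use encb[OF that] in auto)
    then show ?thesis unfolding enc_def by (simp add: Bcontfun_inverse)
  qed
  define B where "B = cball (0::real \<Rightarrow>\<^sub>C real) \<sigma> \<times> cball (0::real \<Rightarrow>\<^sub>C real) \<sigma>"
  have "\<forall>x\<in>B. \<exists>f' g'. decays k \<sigma> f' \<and> decays k \<sigma> g' \<and> Rel (dec (fst x)) (dec (snd x)) f' g'"
    using ex decA by (auto simp: B_def)
  then obtain T1 T2 where T: "\<And>x. x \<in> B \<Longrightarrow> decays k \<sigma> (T1 x) \<and> decays k \<sigma> (T2 x) \<and> Rel (dec (fst x)) (dec (snd x)) (T1 x) (T2 x)"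
    by metis
  define T where "T = (\<lambda>x. (enc (T1 x), enc (T2 x)))"
  have "\<exists>!x. x \<in> B \<and> T x = x"
  proof (rule Banach_fix[where c = "1/2"])
    show "complete B" unfolding B_def complete_eq_closed by (intro closed_Times closed_cball)
    show "B \<noteq> {}" using s by (auto simp: B_def)
    have "norm (enc f) \<le> \<sigma>" if "decays k \<sigma> f" for f
      by (rule norm_bound) (use encb[OF that] enc[OF that] in simp)
    then show "T ` B \<subseteq> B" using T by (auto simp: T_def B_def)
    \<comment> \<open>Each component contracts by \<open>1/4\<close>; the norm of a pair is at most
      the sum of the norms of its components, which leaves \<open>1/2\<close>.\<close>
    show "dist (T x) (T y) \<le> 1/2 * dist x y" if "x \<in> B" "y \<in> B" for x y
    proof -
      define d where "d = dist x y"
      have d: "\<bar>dec F r - dec G r\<bar> \<le> d / r^k" if "dist F G \<le> d" "r \<ge> 1" for F G r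
      proof -
        have "dist (F r) (G r) \<le> d" using dist_bounded[of F r G] that by simp
        then show ?thesis using that unfolding dec_def
          by (simp add: diff_divide_distrib[symmetric] dist_real_def divide_right_mono)
      qed
      have dxy: "dist (fst x) (fst y) \<le> d" "dist (snd x) (snd y) \<le> d"
        by (auto simp: d_def dist_fst_le dist_snd_le)
      have A4: "decays k \<sigma> (dec (fst x))" "decays k \<sigma> (dec (snd x))" "decays k \<sigma> (dec (fst y))" "decays k \<sigma> (dec (snd y))"
        using that decA by (auto simp: B_def)
      note Tx = T[OF that(1)] and Ty = T[OF that(2)]
      have L: "\<forall>r\<ge>1. \<bar>T1 x r - T1 y r\<bar> \<le> (d/4) / r^k \<and> \<bar>T2 x r - T2 y r\<bar> \<le> (d/4) / r^k"
        by (rule lip[of "dec (fst x)" "dec (snd x)" _ _ "dec (fst y)" "dec (snd y)"])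
           (use A4 Tx Ty d dxy in auto)
      have E: "dist (enc f) (enc g) \<le> d/4" if "decays k \<sigma> f" "decays k \<sigma> g" "\<And>r. r \<ge> 1 \<Longrightarrow> \<bar>f r - g r\<bar> \<le> (d/4) / r^k" for f g
      proof (rule dist_bound)
        fix r
        have "\<bar>f (max 1 r) - g (max 1 r)\<bar> \<le> (d/4) / (max 1 r)^k" by (rule that) simp
        then have "\<bar>f (max 1 r) - g (max 1 r)\<bar> * (max 1 r)^k \<le> d/4"
          by (subst (asm) pos_le_divide_eq) auto
        then show "dist (enc f r) (enc g r) \<le> d/4"
          by (simp add: enc that dist_real_def left_diff_distrib[symmetric] abs_mult)
      qed
      have "dist (T x) (T y) = norm (enc (T1 x) - enc (T1 y), enc (T2 x) - enc (T2 y))"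
        by (simp add: T_def dist_norm)
      also have "\<dots> \<le> dist (enc (T1 x)) (enc (T1 y)) + dist (enc (T2 x)) (enc (T2 y))"
        unfolding dist_norm by (rule norm_Pair_le)
      also have "\<dots> \<le> d/4 + d/4" using Tx Ty L by (intro add_mono E) auto
      finally show ?thesis by (simp add: d_def)
    qed
  qed auto
  then obtain x where x: "x \<in> B" "T x = x" by blast
  have "dec (enc f) r = f r" if "decays k \<sigma> f" "r \<ge> 1" for f r
    using that by (simp add: enc dec_def max_absorb2)
  moreover have "fst x = enc (T1 x)" "snd x = enc (T2 x)" using x(2) by (auto simp: T_def prod_eq_iff)
  ultimately have "\<forall>r\<ge>1. dec (fst x) r = T1 x r \<and> dec (snd x) r = T2 x r" using T[OF x(1)] by metis
  moreover have "decays k \<sigma> (dec (fst x))" "decays k \<sigma> (dec (snd x))" using x(1) decA by (auto simp: B_def)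
  ultimately show ?thesis using T[OF x(1)] by blast
qed

section \<open>Nonlinear source terms\<close>

text \<open>\<open>ord W s d j u v\<close>: with respect to a size \<open>s \<le> 1\<close> and a distance \<open>d\<close> of the data, the two values
  \<open>u\<close> and \<open>v\<close> of a quantity are of order \<open>j\<close> in the size, and differ by an amount of order \<open>j - 1\<close>
  times the distance (for \<open>j = 0\<close>, just the distance).\<close>

definition ord :: "'t set \<Rightarrow> ('t \<Rightarrow> real) \<Rightarrow> ('t \<Rightarrow> real) \<Rightarrow> nat \<Rightarrow> ('t \<Rightarrow> real) \<Rightarrow> ('t \<Rightarrow> real) \<Rightarrow> bool" where
  "ord W s d j u v \<longleftrightarrow> (\<forall>t\<in>W. 0 \<le> s t \<and> s t \<le> 1 \<and> 0 \<le> d t) \<and>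
     (\<exists>c\<ge>0. \<forall>t\<in>W. \<bar>u t\<bar> \<le> c * s t^j \<and> \<bar>v t\<bar> \<le> c * s t^j \<and> \<bar>u t - v t\<bar> \<le> c * s t^(j-1) * d t)"

section \<open>Calculus of orders of smallness\<close>

lemma ord_add:
  assumes "ord W s d j u v" "ord W s d j u' v'"
  shows "ord W s d j (\<lambda>t. u t + u' t) (\<lambda>t. v t + v' t)"
proof -
  from assms obtain c c' where c: "c \<ge> 0" "c' \<ge> 0"
    "\<And>t. t \<in> W \<Longrightarrow> \<bar>u t\<bar> \<le> c * s t^j \<and> \<bar>v t\<bar> \<le> c * s t^j \<and> \<bar>u t - v t\<bar> \<le> c * s t^(j-1) * d t"
    "\<And>t. t \<in> W \<Longrightarrow> \<bar>u' t\<bar> \<le> c' * s t^j \<and> \<bar>v' t\<bar> \<le> c' * s t^j \<and> \<bar>u' t - v' t\<bar> \<le> c' * s t^(j-1) * d t"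
    unfolding ord_def by metis
  show ?thesis unfolding ord_def
  proof (intro conjI exI[of _ "c + c'"] ballI)
    fix t assume t: "t \<in> W"
    show "\<bar>u t + u' t\<bar> \<le> (c + c') * s t^j" "\<bar>v t + v' t\<bar> \<le> (c + c') * s t^j"
      "\<bar>u t + u' t - (v t + v' t)\<bar> \<le> (c + c') * s t^(j-1) * d t"
      using c(3)[OF t] c(4)[OF t] by (simp_all add: distrib_right) linarith+
  qed (use c assms in \<open>auto simp: ord_def\<close>)
qed

lemma ord_uminus: "ord W s d j u v \<Longrightarrow> ord W s d j (\<lambda>t. - u t) (\<lambda>t. - v t)"
  unfolding ord_def by (auto simp: abs_minus_commute)

lemma ord_diff:
  "ord W s d j u v \<Longrightarrow> ord W s d j u' v' \<Longrightarrow> ord W s d j (\<lambda>t. u t - u' t) (\<lambda>t. v t - v' t)"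
  using ord_add[OF _ ord_uminus, of W s d j u v u' v'] by simp

lemma ord_mult:
  assumes "ord W s d j u v" "ord W s d j' u' v'"
  shows "ord W s d (j + j') (\<lambda>t. u t * u' t) (\<lambda>t. v t * v' t)"
proof -
  from assms obtain c c' where c: "c \<ge> 0" "c' \<ge> 0"
    "\<And>t. t \<in> W \<Longrightarrow> \<bar>u t\<bar> \<le> c * s t^j \<and> \<bar>v t\<bar> \<le> c * s t^j \<and> \<bar>u t - v t\<bar> \<le> c * s t^(j-1) * d t"
    "\<And>t. t \<in> W \<Longrightarrow> \<bar>u' t\<bar> \<le> c' * s t^j' \<and> \<bar>v' t\<bar> \<le> c' * s t^j' \<and> \<bar>u' t - v' t\<bar> \<le> c' * s t^(j'-1) * d t"
    unfolding ord_def by metis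
  show ?thesis unfolding ord_def
  proof (intro conjI exI[of _ "2 * (c * c')"] ballI)
    fix t assume t: "t \<in> W"
    have s: "0 \<le> s t" "s t \<le> 1" "0 \<le> d t" using assms t by (auto simp: ord_def)
    note ct = c(3)[OF t] c(4)[OF t]
    have pos: "0 \<le> c * c' * s t^(j+j')" using c s by simp
    have P: "\<bar>x * y\<bar> \<le> 2 * (c * c') * s t^(j+j')" if "\<bar>x\<bar> \<le> c * s t^j" "\<bar>y\<bar> \<le> c' * s t^j'" for x y
    proof -
      have "\<bar>x\<bar> * \<bar>y\<bar> \<le> c * s t^j * (c' * s t^j')"
        using that c s by (intro mult_mono) auto
      also have "\<dots> = c * c' * s t^(j+j')" by (simp add: power_add)
      finally show ?thesis using pos by (simp add: abs_mult)
    qed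
    show "\<bar>u t * u' t\<bar> \<le> 2 * (c * c') * s t^(j+j')" "\<bar>v t * v' t\<bar> \<le> 2 * (c * c') * s t^(j+j')"
      using ct by (auto intro: P)
    \<comment> \<open>Subtraction is truncated: for \<open>j = 0\<close> or \<open>j' = 0\<close>
      the left exponent may exceed the right one by 1, which is harmless because
      \<open>s t \<le> 1\<close>.\<close>
    have e1: "s t^(j-1) * s t^j' \<le> s t^(j+j'-1)" and e2: "s t^j * s t^(j'-1) \<le> s t^(j+j'-1)"
      using s by (auto simp: power_add[symmetric] intro!: power_decreasing)
    have "\<bar>u t - v t\<bar> * \<bar>u' t\<bar> \<le> (c * s t^(j-1) * d t) * (c' * s t^j')"
      using ct c s by (intro mult_mono) auto
    also have "\<dots> = c * c' * d t * (s t^(j-1) * s t^j')" by (simp add: mult_ac)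
    also have "\<dots> \<le> c * c' * d t * s t^(j+j'-1)" using c s e1 by (intro mult_left_mono) auto
    finally have 1: "\<bar>u t - v t\<bar> * \<bar>u' t\<bar> \<le> c * c' * d t * s t^(j+j'-1)" .
    have "\<bar>v t\<bar> * \<bar>u' t - v' t\<bar> \<le> (c * s t^j) * (c' * s t^(j'-1) * d t)"
      using ct c s by (intro mult_mono) auto
    also have "\<dots> = c * c' * d t * (s t^j * s t^(j'-1))" by (simp add: mult_ac)
    also have "\<dots> \<le> c * c' * d t * s t^(j+j'-1)" using c s e2 by (intro mult_left_mono) auto
    finally have 2: "\<bar>v t\<bar> * \<bar>u' t - v' t\<bar> \<le> c * c' * d t * s t^(j+j'-1)" .
    have "\<bar>u t * u' t - v t * v' t\<bar> = \<bar>(u t - v t) * u' t + v t * (u' t - v' t)\<bar>"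
      by (simp add: algebra_simps)
    also have "\<dots> \<le> \<bar>u t - v t\<bar> * \<bar>u' t\<bar> + \<bar>v t\<bar> * \<bar>u' t - v' t\<bar>"
      unfolding abs_mult[symmetric] by (rule abs_triangle_ineq)
    also have "\<dots> \<le> 2 * (c * c') * s t^(j+j'-1) * d t" using 1 2 by (simp add: mult_ac)
    finally show "\<bar>u t * u' t - v t * v' t\<bar> \<le> 2 * (c * c') * s t^(j+j'-1) * d t" .
  qed (use c assms in \<open>auto simp: ord_def\<close>)
qed

lemma ord_weaken:
  assumes "ord W s d j u v" "i \<le> j"
  shows "ord W s d i u v"
proof -
  from assms obtain c where c: "c \<ge> 0"
    "\<And>t. t \<in> W \<Longrightarrow> \<bar>u t\<bar> \<le> c * s t^j \<and> \<bar>v t\<bar> \<le> c * s t^j \<and> \<bar>u t - v t\<bar> \<le> c * s t^(j-1) * d t"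
    unfolding ord_def by metis
  show ?thesis unfolding ord_def
  proof (intro conjI exI[of _ c] ballI)
    fix t assume t: "t \<in> W"
    have s: "0 \<le> s t" "s t \<le> 1" "0 \<le> d t" using assms t by (auto simp: ord_def)
    have "c * s t^j \<le> c * s t^i" using s c assms by (intro mult_left_mono power_decreasing) auto
    then show "\<bar>u t\<bar> \<le> c * s t^i" "\<bar>v t\<bar> \<le> c * s t^i" using c(2)[OF t] by auto
    have "c * s t^(j-1) * d t \<le> c * s t^(i-1) * d t"
      using s c assms by (intro mult_left_mono mult_right_mono power_decreasing) auto
    then show "\<bar>u t - v t\<bar> \<le> c * s t^(i-1) * d t" using c(2)[OF t] by auto
  qed (use c assms in \<open>auto simp: ord_def\<close>)
qed

lemma ord_mult_left0: "ord W s d 0 u v \<Longrightarrow> ord W s d j u' v' \<Longrightarrow> ord W s d j (\<lambda>t. u t * u' t) (\<lambda>t. v t * v' t)"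
  using ord_mult[of W s d 0] by simp

lemma ord_mult_right0: "ord W s d j u v \<Longrightarrow> ord W s d 0 u' v' \<Longrightarrow> ord W s d j (\<lambda>t. u t * u' t) (\<lambda>t. v t * v' t)"
  using ord_mult[of W s d j u v 0] by simp

lemma ord_mult11: "ord W s d 1 u v \<Longrightarrow> ord W s d 1 u' v' \<Longrightarrow> ord W s d 2 (\<lambda>t. u t * u' t) (\<lambda>t. v t * v' t)"
  using ord_mult[of W s d 1 u v 1] by (simp add: numeral_2_eq_2)

lemma ord_bounded:
  assumes "\<And>t. t \<in> W \<Longrightarrow> 0 \<le> s t \<and> s t \<le> 1 \<and> 0 \<le> d t" "\<And>t. t \<in> W \<Longrightarrow> \<bar>u t\<bar> \<le> c"
  shows "ord W s d 0 u u"
  unfolding ord_def using assms by (auto intro!: exI[of _ "\<bar>c\<bar>"] intro: order_trans[OF _ abs_ge_self])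

text \<open>Meant for \<open>1 / (v\<^sub>+ + \<eta>)\<close>, which is bounded but not small; hence
  order 0 and a positive lower bound.\<close>

lemma ord_inverse:
  assumes "ord W s d 0 u v" and b: "b > 0" and uv: "\<And>t. t \<in> W \<Longrightarrow> b \<le> u t \<and> b \<le> v t"
  shows "ord W s d 0 (\<lambda>t. 1 / u t) (\<lambda>t. 1 / v t)"
proof -
  from assms obtain c where c: "c \<ge> 0" "\<And>t. t \<in> W \<Longrightarrow> \<bar>u t - v t\<bar> \<le> c * d t"
    unfolding ord_def by auto
  show ?thesis unfolding ord_def
  proof (intro conjI exI[of _ "1 / b + c / b^2"] ballI)
    fix t assume t: "t \<in> W"
    have u: "b \<le> u t" "b \<le> v t" and d: "0 \<le> d t" using uv[OF t] assms(1) t by (auto simp: ord_def)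
    have cb: "0 \<le> c / b^2" using c b by simp
    have "1 / u t \<le> 1 / b" "1 / v t \<le> 1 / b" using u b by (auto intro: divide_left_mono)
    then show "\<bar>1 / u t\<bar> \<le> (1 / b + c / b^2) * s t^0" "\<bar>1 / v t\<bar> \<le> (1 / b + c / b^2) * s t^0"
      using u b cb by (simp_all add: add_increasing2)
    have "\<bar>1 / u t - 1 / v t\<bar> = \<bar>v t - u t\<bar> / (u t * v t)"
      using u b by (simp add: diff_frac_eq abs_divide abs_mult)
    also have "\<dots> \<le> (c * d t) / b^2"
      using u b c(2)[OF t] d c(1) unfolding power2_eq_square
      by (intro frac_le mult_mono) (auto simp: abs_minus_commute)
    also have "\<dots> \<le> (1 / b + c / b^2) * d t" using b d by (simp add: distrib_right)
    finally show "\<bar>1 / u t - 1 / v t\<bar> \<le> (1 / b + c / b^2) * s t^(0-1) * d t" by simp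
  qed (use c assms(1) b in \<open>auto simp: ord_def\<close>)
qed

text \<open>With \<open>x\<close>, \<open>y\<close> and \<open>i\<close> for the values at \<open>r\<close> of \<open>\<eta>\<close>, \<open>\<chi>\<close> and the integral in \<open>F\<close>:
  \<open>transport_source\<close> is \<open>\<epsilon> F / r\<^sup>n\<^sup>-\<^sup>1\<close>, and \<open>diffusion_source\<close> is \<open>\<kappa> r\<^sup>n\<^sup>-\<^sup>1\<close> times the right-hand side of the second
  equation without its \<open>\<alpha>\<close> term, after \<open>\<eta>\<^sub>r\<close> has been eliminated and \<open>\<Phi>\<close> integrated.\<close>

definition transport_source :: "real \<Rightarrow> real \<Rightarrow> real \<Rightarrow> real \<Rightarrow> nat \<Rightarrow> real \<Rightarrow> real \<Rightarrow> real \<Rightarrow> real \<Rightarrow> real \<Rightarrow> real" where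
  "transport_source R mu vp thp k e r x y i =
     R * y * x / (mu * vp * (vp + x)) + R * thp * x^2 / (mu * vp^2 * (vp + x))
     + e^2 * (vp / 2 + x) / (mu * r^(2*k+2)) - e^2 * (real k + 1) / mu * i"

definition diffusion_source :: "real \<Rightarrow> real \<Rightarrow> real \<Rightarrow> real \<Rightarrow> real \<Rightarrow> nat \<Rightarrow> real \<Rightarrow> real \<Rightarrow> real \<Rightarrow> real \<Rightarrow> real \<Rightarrow> real" where
  "diffusion_source R cP nu vp thp k e r x y i =
     e * cP * y - e * (R * y * (vp + 2 * x) / vp - R * thp * x / vp)
     + e^3 * (vp + x)^2 / (2 * r^(2*k+2)) - e^3 * (vp + x) * (vp / 2 + x) / r^(2*k+2)
     + e^3 * (real k + 1) * (vp + x) * i + 2 * e^2 * nu * (real k + 1) * (vp + x)^2 / r^(k+2)"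

text \<open>Two tuples of flux, \<eta>, \<chi> and tail integral at one radius, of size
  \<open>\<sigma>\<close> and distance \<open>d\<close>. The flux is a number, so it carries no
  weight \<open>1 / r^k\<close>; its distance has the extra factor \<open>c\<close> because it may
  depend on \<eta> through the value at 1.\<close>

definition close_data :: "real \<Rightarrow> nat \<Rightarrow> real \<Rightarrow> real \<Rightarrow> real \<Rightarrow> real \<times> real \<times> real \<times> real \<Rightarrow> real \<times> real \<times> real \<times> real \<Rightarrow> bool" where
  "close_data c k r \<sigma> d = (\<lambda>(e1,x1,y1,i1) (e2,x2,y2,i2).
     0 \<le> d \<and> \<bar>e1\<bar> \<le> \<sigma> \<and> \<bar>e2\<bar> \<le> \<sigma> \<and> \<bar>e1 - e2\<bar> \<le> c * d \<and>
     \<bar>x1\<bar> \<le> \<sigma> / r^k \<and> \<bar>x2\<bar> \<le> \<sigma> / r^k \<and> \<bar>x1 - x2\<bar> \<le> d / r^k \<and>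
     \<bar>y1\<bar> \<le> \<sigma> / r^k \<and> \<bar>y2\<bar> \<le> \<sigma> / r^k \<and> \<bar>y1 - y2\<bar> \<le> d / r^k \<and>
     \<bar>i1\<bar> \<le> \<sigma> / r^k \<and> \<bar>i2\<bar> \<le> \<sigma> / r^k \<and> \<bar>i1 - i2\<bar> \<le> d / r^k)"

text \<open>\<open>K\<close> is fixed before the radius, the size and the data, so all later
  thresholds can depend on the gas alone. The transport source must keep the decay
  \<open>1 / r^k\<close>; the diffusion source needs none, since it will be divided by
  \<open>kappa * r^(k+1)\<close> and integrated.\<close>

lemma source_estimates:
  fixes R mu vp thp nu cP c :: real and k :: nat
  assumes mu: "mu > 0" and vp: "vp > 0" and c: "c \<ge> 0"
  obtains K where "K \<ge> 0"
    "\<And>r \<sigma> d e1 x1 y1 i1 e2 x2 y2 i2. r \<ge> 1 \<Longrightarrow> 0 \<le> \<sigma> \<Longrightarrow> \<sigma> \<le> 1 \<Longrightarrow> \<sigma> \<le> vp / 2 \<Longrightarrow>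
        close_data c k r \<sigma> d (e1,x1,y1,i1) (e2,x2,y2,i2) \<Longrightarrow>
        \<bar>transport_source R mu vp thp k e1 r x1 y1 i1\<bar> \<le> K * \<sigma>^2 / r^k \<and>
        \<bar>transport_source R mu vp thp k e1 r x1 y1 i1 - transport_source R mu vp thp k e2 r x2 y2 i2\<bar> \<le> K * \<sigma> * d / r^k \<and>
        \<bar>diffusion_source R cP nu vp thp k e1 r x1 y1 i1\<bar> \<le> K * \<sigma>^2 \<and>
        \<bar>diffusion_source R cP nu vp thp k e1 r x1 y1 i1 - diffusion_source R cP nu vp thp k e2 r x2 y2 i2\<bar> \<le> K * \<sigma> * d"
proof -
  \<comment> \<open>A point of \<open>W\<close> lists every quantity at once: radius, size,
    distance, then the two tuples at positions 3 to 6 and 7 to 10. The constant in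
    \<open>ord\<close> over this set is therefore uniform in all of them.\<close>
  define W :: "(nat \<Rightarrow> real) set" where
    "W = {t. t 0 \<ge> 1 \<and> 0 \<le> t 1 \<and> t 1 \<le> 1 \<and> t 1 \<le> vp / 2 \<and>
      close_data c k (t 0) (t 1) (t 2) (t 3, t 4, t 5, t 6) (t 7, t 8, t 9, t 10)}"
  define s d :: "(nat \<Rightarrow> real) \<Rightarrow> real" where "s = (\<lambda>t. t 1)" and "d = (\<lambda>t. t 2)"
  let ?O = "ord W s d"
  have W: "0 \<le> s t \<and> s t \<le> 1 \<and> 0 \<le> d t" if "t \<in> W" for t
    using that by (auto simp: W_def s_def d_def close_data_def)
  have pw: "x / r^k \<le> x" if "x \<ge> 0" "r \<ge> 1" for x r :: real
    using that by (simp add: divide_le_eq mult_le_cancel_left1 one_le_power)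
  have sd: "s t / t 0^k \<le> s t \<and> d t / t 0^k \<le> d t" if "t \<in> W" for t
    using W[OF that] that by (intro conjI pw) (auto simp: W_def)
  have const: "?O 0 (\<lambda>_. a) (\<lambda>_. a)" for a by (rule ord_bounded[of _ _ _ _ "\<bar>a\<bar>"]) (use W in auto)
  have rpow: "?O 0 (\<lambda>t. t 0^i / t 0^j) (\<lambda>t. t 0^i / t 0^j)" if "i \<le> j" for i j
  proof (rule ord_bounded[of _ _ _ _ 1])
    show "\<bar>t 0^i / t 0^j\<bar> \<le> 1" if "t \<in> W" for t
      using that \<open>i \<le> j\<close> by (auto simp: W_def intro!: power_increasing)
  qed (use W in auto)
  have rinv: "?O 0 (\<lambda>t. 1 / t 0^j) (\<lambda>t. 1 / t 0^j)" for j using rpow[of 0 j] by simp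
  have oe: "?O 1 (\<lambda>t. t 3) (\<lambda>t. t 7)"
    unfolding ord_def
  proof (intro conjI exI[of _ "1 + c"] ballI)
    fix t assume t: "t \<in> W"
    have "s t \<le> (1 + c) * s t" "c * d t \<le> (1 + c) * d t" using W[OF t] c by (auto simp: distrib_right)
    moreover have "\<bar>t 3\<bar> \<le> s t" "\<bar>t 7\<bar> \<le> s t" "\<bar>t 3 - t 7\<bar> \<le> c * d t"
      using t by (auto simp: W_def close_data_def s_def d_def)
    ultimately show "\<bar>t 3\<bar> \<le> (1 + c) * s t^1" "\<bar>t 7\<bar> \<le> (1 + c) * s t^1" "\<bar>t 3 - t 7\<bar> \<le> (1 + c) * s t^(1-1) * d t"
      by auto
  qed (use W c in auto)
  have o1: "?O 1 u v" if "\<And>t. t \<in> W \<Longrightarrow> \<bar>u t\<bar> \<le> s t \<and> \<bar>v t\<bar> \<le> s t \<and> \<bar>u t - v t\<bar> \<le> d t" for u v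
    unfolding ord_def using that W by (auto intro!: exI[of _ 1])
  have sdW: "s t = t 1" "d t = t 2" for t by (auto simp: s_def d_def)
  have o1w: "?O 1 u v"
    if uv: "\<And>t. t \<in> W \<Longrightarrow> \<bar>u t\<bar> \<le> s t / t 0^k \<and> \<bar>v t\<bar> \<le> s t / t 0^k \<and> \<bar>u t - v t\<bar> \<le> d t / t 0^k" for u v
  proof (rule o1)
    fix t assume t: "t \<in> W"
    show "\<bar>u t\<bar> \<le> s t \<and> \<bar>v t\<bar> \<le> s t \<and> \<bar>u t - v t\<bar> \<le> d t" using uv[OF t] sd[OF t] by linarith
  qed
  have bx: "\<bar>t 4\<bar> \<le> s t / t 0^k \<and> \<bar>t 8\<bar> \<le> s t / t 0^k \<and> \<bar>t 4 - t 8\<bar> \<le> d t / t 0^k"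
    and by': "\<bar>t 5\<bar> \<le> s t / t 0^k \<and> \<bar>t 9\<bar> \<le> s t / t 0^k \<and> \<bar>t 5 - t 9\<bar> \<le> d t / t 0^k"
    and bi: "\<bar>t 6\<bar> \<le> s t / t 0^k \<and> \<bar>t 10\<bar> \<le> s t / t 0^k \<and> \<bar>t 6 - t 10\<bar> \<le> d t / t 0^k"
    if "t \<in> W" for t
    using that unfolding W_def close_data_def s_def d_def by simp_all
  note ox = o1w[OF bx] and oy = o1w[OF by'] and oi = o1w[OF bi]
  have scale: "\<bar>t 0^k * u\<bar> \<le> b" if "t \<in> W" "\<bar>u\<bar> \<le> b / t 0^k" for t u b
  proof -
    have "t 0^k > 0" using that by (auto simp: W_def)
    then show ?thesis using that(2) by (simp add: abs_mult pos_le_divide_eq mult.commute)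
  qed
  have o1s: "?O 1 (\<lambda>t. t 0^k * u t) (\<lambda>t. t 0^k * v t)"
    if "\<And>t. t \<in> W \<Longrightarrow> \<bar>u t\<bar> \<le> s t / t 0^k \<and> \<bar>v t\<bar> \<le> s t / t 0^k \<and> \<bar>u t - v t\<bar> \<le> d t / t 0^k" for u v
    by (rule o1) (use scale that in \<open>simp add: right_diff_distrib[symmetric]\<close>)
  note oX = o1s[OF bx] and oY = o1s[OF by'] and oI = o1s[OF bi]
  note o10 = ord_weaken[of W s d 1 _ _ 0, OF _ zero_le_one]
  have oV: "?O 0 (\<lambda>t. vp + t 4) (\<lambda>t. vp + t 8)" by (rule ord_add[OF const[of vp] o10[OF ox]])
  have oV2: "?O 0 (\<lambda>t. vp / 2 + t 4) (\<lambda>t. vp / 2 + t 8)" by (rule ord_add[OF const[of "vp / 2"] o10[OF ox]])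
  have oVi: "?O 0 (\<lambda>t. 1 / (vp + t 4)) (\<lambda>t. 1 / (vp + t 8))"
  proof (rule ord_inverse[OF oV, of "vp / 2"])
    fix t assume t: "t \<in> W"
    have "\<bar>t 4\<bar> \<le> vp / 2" "\<bar>t 8\<bar> \<le> vp / 2"
      using bx[OF t] sd[OF t] t by (auto simp: W_def sdW)
    then show "vp / 2 \<le> vp + t 4 \<and> vp / 2 \<le> vp + t 8" by (auto simp: abs_le_iff)
  qed (use vp in auto)
  note ee = ord_mult11[OF oe oe]
  \<comment> \<open>The weight \<open>r^k\<close> is spent on one decaying factor of each product,
    and the other factor is still small. In the terms with \<open>e * e\<close> it is absorbed by
    \<open>1 / r^(2*k+2)\<close> or by the tail integral.\<close>
  have H: "?O 2 (\<lambda>t. t 0^k * transport_source R mu vp thp k (t 3) (t 0) (t 4) (t 5) (t 6))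
               (\<lambda>t. t 0^k * transport_source R mu vp thp k (t 7) (t 0) (t 8) (t 9) (t 10))"
  proof -
    have eq: "r^k * transport_source R mu vp thp k e r x y i =
       (R / (mu * vp)) * (r^k * y * x) * (1 / (vp + x)) + (R * thp / (mu * vp^2)) * (r^k * x * x) * (1 / (vp + x))
       + e * e * ((vp / 2 + x) * (r^k / r^(2*k+2)) * (1 / mu)) - e * e * ((real k + 1) / mu * (r^k * i))" for r e x y i
      unfolding transport_source_def by (simp add: power2_eq_square algebra_simps divide_simps del: power_Suc)
    show ?thesis unfolding eq
      by (rule ord_diff[OF ord_add[OF ord_add[OF
            ord_mult_right0[OF ord_mult_left0[OF const ord_mult11[OF oY ox]] oVi]
            ord_mult_right0[OF ord_mult_left0[OF const ord_mult11[OF oX ox]] oVi]]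
            ord_mult_right0[OF ee ord_mult_right0[OF ord_mult_right0[OF oV2 rpow[of k "2*k+2"]] const]]]
            ord_mult_right0[OF ee ord_mult_left0[OF const o10[OF oI]]]]) auto
  qed
  have G: "?O 2 (\<lambda>t. diffusion_source R cP nu vp thp k (t 3) (t 0) (t 4) (t 5) (t 6))
               (\<lambda>t. diffusion_source R cP nu vp thp k (t 7) (t 0) (t 8) (t 9) (t 10))"
  proof -
    \<comment> \<open>Every summand is arranged to show a factor \<open>e * y\<close>,
      \<open>e * x\<close> or \<open>e * e\<close>, hence order 2.\<close>
    have eq: "diffusion_source R cP nu vp thp k e r x y i =
       cP * (e * y) - (R / vp * (e * y) * (vp + x + x) - R * thp / vp * (e * x))
       + e * e * (e * ((vp + x) * (vp + x)) * ((1/2) * (1 / r^(2*k+2))))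
       - e * e * (e * ((vp + x) * (vp / 2 + x)) * (1 / r^(2*k+2)))
       + e * e * (e * ((real k + 1) * ((vp + x) * i)))
       + e * e * ((2 * nu * (real k + 1)) * ((vp + x) * (vp + x)) * (1 / r^(k+2)))" for r e x y i
      unfolding diffusion_source_def using vp
      by (simp add: power2_eq_square power3_eq_cube algebra_simps add_divide_distrib del: power_Suc)
    note ey = ord_mult11[OF oe oy] and ex = ord_mult11[OF oe ox]
      and eVV = ord_mult_right0[OF o10[OF oe] ord_mult_right0[OF oV oV]]
    show ?thesis unfolding eq
      by (rule ord_add[OF ord_add[OF ord_diff[OF ord_add[OF ord_diff[OF
            ord_mult_left0[OF const ey]
            ord_diff[OF ord_mult_right0[OF ord_mult_left0[OF const ey] ord_add[OF oV o10[OF ox]]] ord_mult_left0[OF const ex]]]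
            ord_mult_right0[OF ee ord_mult_right0[OF eVV ord_mult_left0[OF const rinv]]]]
            ord_mult_right0[OF ee ord_mult_right0[OF ord_mult_right0[OF o10[OF oe] ord_mult_right0[OF oV oV2]] rinv]]]
            ord_mult_right0[OF ee ord_mult_right0[OF o10[OF oe] ord_mult_left0[OF const ord_mult_right0[OF oV o10[OF oi]]]]]]
            ord_mult_right0[OF ee ord_mult_right0[OF ord_mult_left0[OF const ord_mult_right0[OF oV oV]] rinv]]])
  qed
  from H obtain K1 where K1: "K1 \<ge> 0"
    "\<And>t. t \<in> W \<Longrightarrow> \<bar>t 0^k * transport_source R mu vp thp k (t 3) (t 0) (t 4) (t 5) (t 6)\<bar> \<le> K1 * s t^2 \<and>
       \<bar>t 0^k * transport_source R mu vp thp k (t 3) (t 0) (t 4) (t 5) (t 6) -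
          t 0^k * transport_source R mu vp thp k (t 7) (t 0) (t 8) (t 9) (t 10)\<bar> \<le> K1 * s t * d t"
    unfolding ord_def by auto
  from G obtain K2 where K2: "K2 \<ge> 0"
    "\<And>t. t \<in> W \<Longrightarrow> \<bar>diffusion_source R cP nu vp thp k (t 3) (t 0) (t 4) (t 5) (t 6)\<bar> \<le> K2 * s t^2 \<and>
       \<bar>diffusion_source R cP nu vp thp k (t 3) (t 0) (t 4) (t 5) (t 6) -
          diffusion_source R cP nu vp thp k (t 7) (t 0) (t 8) (t 9) (t 10)\<bar> \<le> K2 * s t * d t"
    unfolding ord_def by auto
  show ?thesis
  proof (rule that[of "K1 + K2"])
    fix r \<sigma> \<delta> e1 x1 y1 i1 e2 x2 y2 i2 :: real
    assume A: "r \<ge> 1" "0 \<le> \<sigma>" "\<sigma> \<le> 1" "\<sigma> \<le> vp / 2" "close_data c k r \<sigma> \<delta> (e1,x1,y1,i1) (e2,x2,y2,i2)"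
    define t :: "nat \<Rightarrow> real" where "t = (\<lambda>j. [r, \<sigma>, \<delta>, e1, x1, y1, i1, e2, x2, y2, i2] ! j)"
    have tt: "t 0 = r" "t 1 = \<sigma>" "t 2 = \<delta>" "t 3 = e1" "t 4 = x1" "t 5 = y1" "t 6 = i1" "t 7 = e2" "t 8 = x2" "t 9 = y2" "t 10 = i2"
      by (simp_all add: t_def)
    have tW: "t \<in> W" using A by (simp only: W_def mem_Collect_eq tt)
    have d0: "\<delta> \<ge> 0" using W[OF tW] by (simp add: sdW tt)
    note B1 = K1(2)[OF tW, unfolded sdW tt right_diff_distrib[symmetric]] and B2 = K2(2)[OF tW, unfolded sdW tt]
    have div: "\<bar>u\<bar> \<le> B' / r^k" if "\<bar>r^k * u\<bar> \<le> B" "B \<le> B'" for u B B'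
      using that A(1) by (simp add: abs_mult pos_le_divide_eq mult.commute)
    have "K1 * \<sigma>^2 \<le> (K1 + K2) * \<sigma>^2" "K1 * \<sigma> * \<delta> \<le> (K1 + K2) * \<sigma> * \<delta>"
      "K2 * \<sigma>^2 \<le> (K1 + K2) * \<sigma>^2" "K2 * \<sigma> * \<delta> \<le> (K1 + K2) * \<sigma> * \<delta>"
      using K1(1) K2(1) A d0 by (auto intro!: mult_right_mono)
    then show "\<bar>transport_source R mu vp thp k e1 r x1 y1 i1\<bar> \<le> (K1 + K2) * \<sigma>^2 / r^k \<and>
        \<bar>transport_source R mu vp thp k e1 r x1 y1 i1 - transport_source R mu vp thp k e2 r x2 y2 i2\<bar> \<le> (K1 + K2) * \<sigma> * \<delta> / r^k \<and>
        \<bar>diffusion_source R cP nu vp thp k e1 r x1 y1 i1\<bar> \<le> (K1 + K2) * \<sigma>^2 \<and>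
        \<bar>diffusion_source R cP nu vp thp k e1 r x1 y1 i1 - diffusion_source R cP nu vp thp k e2 r x2 y2 i2\<bar> \<le> (K1 + K2) * \<sigma> * \<delta>"
      using B1 B2 by (intro conjI div[of _ "K1 * \<sigma>^2"] div[of _ "K1 * \<sigma> * \<delta>"]) auto
  qed (use K1 K2 in auto)
qed

section \<open>The iteration\<close>

text \<open>The paper's \<open>\<chi>\<close> is called \<open>\<theta>\<close> here, since \<open>\<chi>\<close> is binder syntax for vectors.\<close>

locale gas =
  fixes k :: nat and R cV nu mu kappa vp thp :: real
  assumes k: "k \<ge> 1" and R: "R > 0" and mu: "mu > 0" and kappa: "kappa > 0" and vp: "vp > 0" and thp: "thp > 0"
begin

text \<open>The coefficient of \<eta> in the first equation after multiplication by
  \<open>\<epsilon> / r^(n-1)\<close>. Being free of \<epsilon>, it sets the scale for estimates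
  uniform in the flux.\<close>

definition damping :: real where "damping = R * thp / (mu * vp^2)"

definition tail :: "(real \<Rightarrow> real) \<Rightarrow> real \<Rightarrow> real" where
  "tail \<eta> r = integral {r..} (\<lambda>s. \<eta> s / s^(2*k+3))"

definition transport_rhs :: "real \<Rightarrow> (real \<Rightarrow> real) \<Rightarrow> (real \<Rightarrow> real) \<Rightarrow> real \<Rightarrow> real" where
  "transport_rhs e \<eta> \<theta> r = R / (mu * vp) * \<theta> r + transport_source R mu vp thp k e r (\<eta> r) (\<theta> r) (tail \<eta> r)"

definition diffusion_rhs :: "real \<Rightarrow> (real \<Rightarrow> real) \<Rightarrow> (real \<Rightarrow> real) \<Rightarrow> real \<Rightarrow> real" where
  "diffusion_rhs e \<eta> \<theta> r = diffusion_source R (R + cV) nu vp thp k e r (\<eta> r) (\<theta> r) (tail \<eta> r) / (kappa * r^(k+1))"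

definition mass_flux :: "real \<Rightarrow> real \<Rightarrow> (real \<Rightarrow> real) \<Rightarrow> real" where
  "mass_flux um vm \<eta> = (if um > 0 then um / vm else um / (vp + \<eta> 1))"

text \<open>A solution of the original problem satisfies its equations only for \<open>r > 1\<close>, hence \<open>step\<close>; including
  \<open>r = 1\<close> in \<open>closed_step\<close> gives smoothness up to the boundary.\<close>

definition step :: "real \<Rightarrow> real \<Rightarrow> real \<Rightarrow> real \<Rightarrow> (real \<Rightarrow> real) \<Rightarrow> (real \<Rightarrow> real) \<Rightarrow> (real \<Rightarrow> real) \<Rightarrow> (real \<Rightarrow> real) \<Rightarrow> bool" where
  "step um vm \<eta>m \<theta>m \<eta> \<theta> \<eta>' \<theta>' \<longleftrightarrow> (\<exists>A. let e = mass_flux um vm \<eta> in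
     (\<forall>r>1. DERIV \<theta>' r :> - A / r^(k+1) + diffusion_rhs e \<eta> \<theta> r) \<and> (\<theta>' \<longlongrightarrow> 0) at_top \<and> \<theta>' 1 = \<theta>m \<and>
     (\<forall>r>1. DERIV \<eta>' r :> r^(k+1) / e * (transport_rhs e \<eta> \<theta>' r - damping * \<eta>' r)) \<and> (um > 0 \<longrightarrow> \<eta>' 1 = \<eta>m))"

definition closed_step :: "real \<Rightarrow> real \<Rightarrow> real \<Rightarrow> real \<Rightarrow> (real \<Rightarrow> real) \<Rightarrow> (real \<Rightarrow> real) \<Rightarrow> (real \<Rightarrow> real) \<Rightarrow> (real \<Rightarrow> real) \<Rightarrow> bool" where
  "closed_step um vm \<eta>m \<theta>m \<eta> \<theta> \<eta>' \<theta>' \<longleftrightarrow> (\<exists>A. let e = mass_flux um vm \<eta> in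
     (\<forall>r\<ge>1. (\<theta>' has_real_derivative - A / r^(k+1) + diffusion_rhs e \<eta> \<theta> r) (at r within {1..})) \<and>
     (\<theta>' \<longlongrightarrow> 0) at_top \<and> \<theta>' 1 = \<theta>m \<and>
     (\<forall>r\<ge>1. (\<eta>' has_real_derivative r^(k+1) / e * (transport_rhs e \<eta> \<theta>' r - damping * \<eta>' r)) (at r within {1..})) \<and>
     (um > 0 \<longrightarrow> \<eta>' 1 = \<eta>m))"

lemma at_within_Ici_interior: "at r within {1..} = at r" if "r > 1" for r :: real
  by (rule at_within_interior) (use that in \<open>simp add: interior_Ici[of 0]\<close>)

lemma closed_step_imp_step:
  assumes "closed_step um vm \<eta>m \<theta>m \<eta> \<theta> \<eta>' \<theta>'"
  shows "step um vm \<eta>m \<theta>m \<eta> \<theta> \<eta>' \<theta>'"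
proof -
  have *: "DERIV f r :> D" if "(f has_real_derivative D) (at r within {1..})" "r > 1" for f D r
    using that by (simp add: at_within_Ici_interior)
  from assms obtain A where
    "\<forall>r\<ge>1. (\<theta>' has_real_derivative - A / r^(k+1) + diffusion_rhs (mass_flux um vm \<eta>) \<eta> \<theta> r) (at r within {1..})"
    "(\<theta>' \<longlongrightarrow> 0) at_top" "\<theta>' 1 = \<theta>m" "um > 0 \<longrightarrow> \<eta>' 1 = \<eta>m"
    "\<forall>r\<ge>1. (\<eta>' has_real_derivative r^(k+1) / mass_flux um vm \<eta> *
       (transport_rhs (mass_flux um vm \<eta>) \<eta> \<theta>' r - damping * \<eta>' r)) (at r within {1..})"
    unfolding closed_step_def Let_def by blast
  then show ?thesis unfolding step_def Let_def
    by (intro exI[of _ A] conjI allI impI *) (simp_all del: power_Suc)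
qed

section \<open>A priori bounds on the ball of decaying functions\<close>

lemma damping_pos: "damping > 0"
  using R thp mu vp by (simp add: damping_def)

text \<open>The integral decays much faster than stated. The bound \<open>M / r^k\<close> is chosen
  to match the one for \<open>f\<close>, so that the tail can be treated as one more datum of the
  same size.\<close>

lemma tail_bounds:
  assumes f: "continuous_on {1..} f" and le: "\<And>r. r \<ge> 1 \<Longrightarrow> \<bar>f r\<bar> \<le> M / r^k" and r: "r \<ge> 1"
  shows "(\<lambda>s. f s / s^(2*k+3)) integrable_on {r..}" "\<bar>tail f r\<bar> \<le> M / r^k"
    "(tail f has_real_derivative - (f r / r^(2*k+3))) (at r within {1..})"
proof -
  have c: "continuous_on {1..} (\<lambda>s. f s / s^(2*k+3))" by (intro continuous_intros f) auto
  have M: "M \<ge> 0" using le[of 1] by auto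
  have b: "\<bar>f s / s^(2*k+3)\<bar> \<le> M / s^(k+1)" if s: "s \<ge> 1" for s
  proof -
    have "M / s^k \<le> M / 1" using M s by (intro divide_left_mono) auto
    then have "\<bar>f s\<bar> \<le> M" using le[OF s] by simp
    then have "\<bar>f s\<bar> / s^(2*k+3) \<le> M / s^(k+1)"
      using s M by (intro frac_le power_increasing) auto
    then show ?thesis using s by simp
  qed
  show "(\<lambda>s. f s / s^(2*k+3)) integrable_on {r..}" "\<bar>tail f r\<bar> \<le> M / r^k"
    "(tail f has_real_derivative - (f r / r^(2*k+3))) (at r within {1..})"
    unfolding tail_def using power_tail[OF c k b r] by auto
qed

lemma decaysD:
  assumes "decays k \<sigma> f"
  shows "continuous_on {1..} f" "\<And>r. r \<ge> 1 \<Longrightarrow> \<bar>f r\<bar> \<le> \<sigma> / r^k"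
  using assms by (auto simp: decays_def)

lemma decays_pos:
  assumes \<eta>: "decays k \<sigma> \<eta>" and s: "\<sigma> \<le> vp / 2" and r: "r \<ge> 1"
  shows "vp + \<eta> r \<ge> vp / 2"
proof -
  have "\<sigma> \<ge> 0" using decaysD(2)[OF \<eta>, of 1] by auto
  then have "\<sigma> / r^k \<le> \<sigma> / 1" using r by (intro divide_left_mono) auto
  then show ?thesis using decaysD(2)[OF \<eta> r] s by auto
qed

lemma tail_diff_bound:
  assumes "decays k \<sigma> f" "decays k \<sigma> g" "\<And>r. r \<ge> 1 \<Longrightarrow> \<bar>f r - g r\<bar> \<le> d / r^k" "r \<ge> 1"
  shows "\<bar>tail f r - tail g r\<bar> \<le> d / r^k"
proof -
  have "\<bar>tail (\<lambda>r. f r - g r) r\<bar> \<le> d / r^k"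
    using assms by (intro tail_bounds(2) continuous_intros) (auto simp: decays_def)
  moreover have "tail (\<lambda>r. f r - g r) r = tail f r - tail g r"
    unfolding tail_def diff_divide_distrib
    by (rule integral_diff) (use assms in \<open>auto intro!: tail_bounds(1) simp: decays_def\<close>)
  ultimately show ?thesis by simp
qed

lemma tail_continuous: "decays k \<sigma> \<eta> \<Longrightarrow> continuous_on {1..} (tail \<eta>)"
  using tail_bounds(3)[of \<eta> \<sigma>] decaysD[of \<sigma> \<eta>]
  by (auto intro!: DERIV_continuous_on)

lemma rhs_continuous:
  assumes \<eta>: "decays k \<sigma> \<eta>" and \<theta>: "decays k \<sigma> \<theta>" and s: "\<sigma> \<le> vp / 2"
  shows "continuous_on {1..} (transport_rhs e \<eta> \<theta>)" "continuous_on {1..} (diffusion_rhs e \<eta> \<theta>)"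
proof -
  have V: "vp + \<eta> r \<noteq> 0" if "r \<in> {1..}" for r
    using decays_pos[OF \<eta> s, of r] vp that by auto
  note c = decaysD(1)[OF \<eta>] decaysD(1)[OF \<theta>] tail_continuous[OF \<eta>]
  have "continuous_on {1..} (\<lambda>r. R / (mu * vp) * \<theta> r + transport_source R mu vp thp k e r (\<eta> r) (\<theta> r) (tail \<eta> r))"
    unfolding transport_source_def using mu vp V
    by (intro continuous_intros c) auto
  then show "continuous_on {1..} (transport_rhs e \<eta> \<theta>)" by (simp add: transport_rhs_def[abs_def])
  have "continuous_on {1..} (\<lambda>r. diffusion_source R (R + cV) nu vp thp k e r (\<eta> r) (\<theta> r) (tail \<eta> r) / (kappa * r^(k+1)))"
    unfolding diffusion_source_def using kappa vp
    by (intro continuous_intros c) auto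
  then show "continuous_on {1..} (diffusion_rhs e \<eta> \<theta>)" by (simp add: diffusion_rhs_def[abs_def])
qed


lemma mass_flux_bounds:
  assumes \<eta>: "decays k \<sigma> \<eta>" and s: "\<sigma> \<le> vp / 2" and um: "um \<noteq> 0" and vm: "um > 0 \<Longrightarrow> vm \<ge> vp / 2"
  shows "mass_flux um vm \<eta> \<noteq> 0" "mass_flux um vm \<eta> > 0 \<longleftrightarrow> um > 0" "\<bar>mass_flux um vm \<eta>\<bar> \<le> 2 / vp * \<bar>um\<bar>"
proof -
  define V where "V = (if um > 0 then vm else vp + \<eta> 1)"
  have V: "V \<ge> vp / 2" "V > 0" using decays_pos[OF \<eta> s, of 1] vm vp by (auto simp: V_def)
  have e: "mass_flux um vm \<eta> = um / V" by (simp add: mass_flux_def V_def)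
  show "mass_flux um vm \<eta> \<noteq> 0" "mass_flux um vm \<eta> > 0 \<longleftrightarrow> um > 0"
    using e V um by (auto simp: zero_less_divide_iff)
  have "\<bar>um\<bar> / V \<le> \<bar>um\<bar> / (vp / 2)" using V vp by (intro divide_left_mono) auto
  then show "\<bar>mass_flux um vm \<eta>\<bar> \<le> 2 / vp * \<bar>um\<bar>" using e V by (simp add: mult.commute)
qed

text \<open>For \<open>um < 0\<close> the velocity cancels from the quotient, leaving only values
  \<open>vp + \<eta> 1\<close>, so the bound survives as \<open>um\<close> tends to 0. The
  difference of the reciprocals of the two fluxes would not stay bounded in this way.\<close>

lemma mass_flux_ratio:
  assumes \<eta>: "decays k \<sigma> \<eta>1" "decays k \<sigma> \<eta>2" and s: "\<sigma> \<le> vp / 2" and um: "um \<noteq> 0" and vm: "um > 0 \<Longrightarrow> vm \<ge> vp / 2"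
    and d: "\<bar>\<eta>1 1 - \<eta>2 1\<bar> \<le> d"
  shows "\<bar>mass_flux um vm \<eta>1 / mass_flux um vm \<eta>2 - 1\<bar> \<le> 2 / vp * d"
proof (cases "um > 0")
  case True
  then show ?thesis using vm[OF True] vp d by (simp add: mass_flux_def)
next
  case False
  define V1 V2 where "V1 = vp + \<eta>1 1" and "V2 = vp + \<eta>2 1"
  have V: "V1 \<ge> vp / 2" "V1 > 0" "V2 > 0" using decays_pos[OF \<eta>(1) s, of 1] decays_pos[OF \<eta>(2) s, of 1] vp
    by (auto simp: V1_def V2_def)
  have "mass_flux um vm \<eta>1 / mass_flux um vm \<eta>2 - 1 = (V2 - V1) / V1"
    using False um V by (simp add: mass_flux_def V1_def[symmetric] V2_def[symmetric] field_simps)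
  also have "\<bar>\<dots>\<bar> \<le> d / (vp / 2)"
    unfolding abs_divide using V d vp by (intro frac_le) (auto simp: V1_def V2_def)
  finally show ?thesis by (simp add: mult.commute)
qed

lemma close_dataI:
  assumes "decays k \<sigma> \<eta>1" "decays k \<sigma> \<eta>2" "decays k \<sigma> \<theta>1" "decays k \<sigma> \<theta>2"
    and s: "\<sigma> \<le> 1" "\<sigma> \<le> vp / 2" and um: "um \<noteq> 0" "2 / vp * \<bar>um\<bar> \<le> \<sigma>" and vm: "um > 0 \<Longrightarrow> vm \<ge> vp / 2"
    and d: "\<And>r. r \<ge> 1 \<Longrightarrow> \<bar>\<eta>1 r - \<eta>2 r\<bar> \<le> d / r^k" "\<And>r. r \<ge> 1 \<Longrightarrow> \<bar>\<theta>1 r - \<theta>2 r\<bar> \<le> d / r^k" and r: "r \<ge> 1"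
  shows "close_data (2 / vp) k r \<sigma> d (mass_flux um vm \<eta>1, \<eta>1 r, \<theta>1 r, tail \<eta>1 r) (mass_flux um vm \<eta>2, \<eta>2 r, \<theta>2 r, tail \<eta>2 r)"
proof -
  define e1 e2 where "e1 = mass_flux um vm \<eta>1" and "e2 = mass_flux um vm \<eta>2"
  have d0: "d \<ge> 0" using d(1)[of 1] by auto
  have e: "e1 \<noteq> 0" "e2 \<noteq> 0" "\<bar>e1\<bar> \<le> \<sigma>" "\<bar>e2\<bar> \<le> \<sigma>"
    using mass_flux_bounds[OF assms(1) s(2) um(1) vm] mass_flux_bounds[OF assms(2) s(2) um(1) vm] um(2)
    by (auto simp: e1_def e2_def)
  have "\<bar>e1 / e2 - 1\<bar> \<le> 2 / vp * d"
    unfolding e1_def e2_def using mass_flux_ratio[OF assms(1,2) s(2) um(1) vm] d(1)[of 1] by simp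
  \<comment> \<open>Multiplication by \<open>e2\<close>, of modulus at most 1, turns the ratio into
    a difference; this is where the constant \<open>2 / vp\<close> for the flux comes from.\<close>
  then have "\<bar>e2\<bar> * \<bar>e1 / e2 - 1\<bar> \<le> 1 * (2 / vp * d)" using e s vp d0 by (intro mult_mono) auto
  moreover have "\<bar>e2\<bar> * \<bar>e1 / e2 - 1\<bar> = \<bar>e1 - e2\<bar>"
    using e by (simp add: abs_mult[symmetric] right_diff_distrib)
  ultimately have "\<bar>e1 - e2\<bar> \<le> 2 / vp * d" by simp
  moreover have "\<bar>tail \<eta>1 r\<bar> \<le> \<sigma> / r^k" "\<bar>tail \<eta>2 r\<bar> \<le> \<sigma> / r^k"
    using tail_bounds(2)[OF decaysD[OF assms(1)] r] tail_bounds(2)[OF decaysD[OF assms(2)] r] by auto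
  moreover have "\<bar>tail \<eta>1 r - tail \<eta>2 r\<bar> \<le> d / r^k" by (rule tail_diff_bound[OF assms(1,2) d(1) r])
  ultimately show ?thesis
    unfolding close_data_def using d0 e d[OF r] r decaysD(2)[OF assms(1) r] decaysD(2)[OF assms(2) r]
      decaysD(2)[OF assms(3) r] decaysD(2)[OF assms(4) r] by (simp add: e1_def e2_def)
qed

definition source_bound :: "real \<Rightarrow> bool" where
  "source_bound K \<longleftrightarrow> K \<ge> 0 \<and> (\<forall>r \<sigma> d e1 x1 y1 i1 e2 x2 y2 i2. r \<ge> 1 \<longrightarrow> 0 \<le> \<sigma> \<longrightarrow> \<sigma> \<le> 1 \<longrightarrow> \<sigma> \<le> vp / 2 \<longrightarrow>
      close_data (2 / vp) k r \<sigma> d (e1,x1,y1,i1) (e2,x2,y2,i2) \<longrightarrow>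
      \<bar>transport_source R mu vp thp k e1 r x1 y1 i1\<bar> \<le> K * \<sigma>^2 / r^k \<and>
      \<bar>transport_source R mu vp thp k e1 r x1 y1 i1 - transport_source R mu vp thp k e2 r x2 y2 i2\<bar> \<le> K * \<sigma> * d / r^k \<and>
      \<bar>diffusion_source R (R + cV) nu vp thp k e1 r x1 y1 i1\<bar> \<le> K * \<sigma>^2 \<and>
      \<bar>diffusion_source R (R + cV) nu vp thp k e1 r x1 y1 i1 - diffusion_source R (R + cV) nu vp thp k e2 r x2 y2 i2\<bar> \<le> K * \<sigma> * d)"

lemma source_bound_exists: obtains K where "source_bound K"
proof (rule source_estimates[OF mu vp, of "2 / vp" k R thp "R + cV" nu])
  fix K assume "0 \<le> K" and
    *: "\<And>r \<sigma> d e1 x1 y1 i1 e2 x2 y2 i2. r \<ge> 1 \<Longrightarrow> 0 \<le> \<sigma> \<Longrightarrow> \<sigma> \<le> 1 \<Longrightarrow> \<sigma> \<le> vp / 2 \<Longrightarrow>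
        close_data (2 / vp) k r \<sigma> d (e1,x1,y1,i1) (e2,x2,y2,i2) \<Longrightarrow>
        \<bar>transport_source R mu vp thp k e1 r x1 y1 i1\<bar> \<le> K * \<sigma>^2 / r^k \<and>
        \<bar>transport_source R mu vp thp k e1 r x1 y1 i1 - transport_source R mu vp thp k e2 r x2 y2 i2\<bar> \<le> K * \<sigma> * d / r^k \<and>
        \<bar>diffusion_source R (R + cV) nu vp thp k e1 r x1 y1 i1\<bar> \<le> K * \<sigma>^2 \<and>
        \<bar>diffusion_source R (R + cV) nu vp thp k e1 r x1 y1 i1 - diffusion_source R (R + cV) nu vp thp k e2 r x2 y2 i2\<bar> \<le> K * \<sigma> * d"
  show thesis using that[of K] * \<open>0 \<le> K\<close> unfolding source_bound_def by blast
qed (use vp in auto)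

text \<open>In the transport bound \<open>\<bar>\<theta> r\<bar>\<close> is kept rather than
  replaced by \<open>\<sigma> / r^k\<close>: the coefficient of this linear term is not small, so a
  sharper bound on an updated \<open>\<theta>\<close> has to be insertable.\<close>

lemma rhs_bounds:
  assumes K: "source_bound K" and \<eta>: "decays k \<sigma> \<eta>" and \<theta>: "decays k \<sigma> \<theta>"
    and s: "\<sigma> \<le> 1" "\<sigma> \<le> vp / 2" and um: "um \<noteq> 0" "2 / vp * \<bar>um\<bar> \<le> \<sigma>" and vm: "um > 0 \<Longrightarrow> vm \<ge> vp / 2"
    and r: "r \<ge> 1"
  shows "\<bar>diffusion_rhs (mass_flux um vm \<eta>) \<eta> \<theta> r\<bar> \<le> (K * \<sigma>^2 / kappa) / r^(k+1)"
    and "\<bar>transport_rhs (mass_flux um vm \<eta>) \<eta> \<theta> r\<bar> \<le> R / (mu * vp) * \<bar>\<theta> r\<bar> + K * \<sigma>^2 / r^k"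
proof -
  have "\<sigma> \<ge> 0" using decaysD(2)[OF \<eta>, of 1] by auto
  \<comment> \<open>A bound on one tuple is its comparison with itself at distance 0.\<close>
  have c: "close_data (2 / vp) k r \<sigma> 0 (mass_flux um vm \<eta>, \<eta> r, \<theta> r, tail \<eta> r) (mass_flux um vm \<eta>, \<eta> r, \<theta> r, tail \<eta> r)"
    by (rule close_dataI[OF \<eta> \<eta> \<theta> \<theta> s um vm]) (use r in auto)
  from K[unfolded source_bound_def] c \<open>\<sigma> \<ge> 0\<close> s r
  have b: "\<bar>transport_source R mu vp thp k (mass_flux um vm \<eta>) r (\<eta> r) (\<theta> r) (tail \<eta> r)\<bar> \<le> K * \<sigma>^2 / r^k"
    "\<bar>diffusion_source R (R + cV) nu vp thp k (mass_flux um vm \<eta>) r (\<eta> r) (\<theta> r) (tail \<eta> r)\<bar> \<le> K * \<sigma>^2" by blast+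
  show "\<bar>diffusion_rhs (mass_flux um vm \<eta>) \<eta> \<theta> r\<bar> \<le> (K * \<sigma>^2 / kappa) / r^(k+1)"
    using b(2) r kappa unfolding diffusion_rhs_def by (simp add: abs_divide abs_mult divide_right_mono)
  have "\<bar>R / (mu * vp) * \<theta> r\<bar> = R / (mu * vp) * \<bar>\<theta> r\<bar>" using R mu vp by (simp add: abs_mult)
  then show "\<bar>transport_rhs (mass_flux um vm \<eta>) \<eta> \<theta> r\<bar> \<le> R / (mu * vp) * \<bar>\<theta> r\<bar> + K * \<sigma>^2 / r^k"
    using b(1) unfolding transport_rhs_def by linarith
qed

lemma rhs_diff_bounds:
  assumes K: "source_bound K" and "decays k \<sigma> \<eta>1" "decays k \<sigma> \<eta>2" "decays k \<sigma> \<theta>1" "decays k \<sigma> \<theta>2"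
    and s: "\<sigma> \<le> 1" "\<sigma> \<le> vp / 2" and um: "um \<noteq> 0" "2 / vp * \<bar>um\<bar> \<le> \<sigma>" and vm: "um > 0 \<Longrightarrow> vm \<ge> vp / 2"
    and d: "\<And>r. r \<ge> 1 \<Longrightarrow> \<bar>\<eta>1 r - \<eta>2 r\<bar> \<le> d / r^k" "\<And>r. r \<ge> 1 \<Longrightarrow> \<bar>\<theta>1 r - \<theta>2 r\<bar> \<le> d / r^k" and r: "r \<ge> 1"
  shows "\<bar>diffusion_rhs (mass_flux um vm \<eta>1) \<eta>1 \<theta>1 r - diffusion_rhs (mass_flux um vm \<eta>2) \<eta>2 \<theta>2 r\<bar> \<le> (K * \<sigma> * d / kappa) / r^(k+1)"
    and "\<bar>transport_rhs (mass_flux um vm \<eta>1) \<eta>1 \<theta>1 r - transport_rhs (mass_flux um vm \<eta>2) \<eta>2 \<theta>2 r\<bar>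
       \<le> R / (mu * vp) * \<bar>\<theta>1 r - \<theta>2 r\<bar> + K * \<sigma> * d / r^k"
proof -
  have "\<sigma> \<ge> 0" using decaysD(2)[OF assms(2), of 1] by auto
  let ?e1 = "mass_flux um vm \<eta>1" and ?e2 = "mass_flux um vm \<eta>2"
  have c: "close_data (2 / vp) k r \<sigma> d (?e1, \<eta>1 r, \<theta>1 r, tail \<eta>1 r) (?e2, \<eta>2 r, \<theta>2 r, tail \<eta>2 r)"
    by (rule close_dataI[OF assms(2-5) s um vm d r])
  from K[unfolded source_bound_def] c \<open>\<sigma> \<ge> 0\<close> s r
  have b: "\<bar>transport_source R mu vp thp k ?e1 r (\<eta>1 r) (\<theta>1 r) (tail \<eta>1 r) -
       transport_source R mu vp thp k ?e2 r (\<eta>2 r) (\<theta>2 r) (tail \<eta>2 r)\<bar> \<le> K * \<sigma> * d / r^k"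
    "\<bar>diffusion_source R (R + cV) nu vp thp k ?e1 r (\<eta>1 r) (\<theta>1 r) (tail \<eta>1 r) -
       diffusion_source R (R + cV) nu vp thp k ?e2 r (\<eta>2 r) (\<theta>2 r) (tail \<eta>2 r)\<bar> \<le> K * \<sigma> * d" by blast+
  show "\<bar>diffusion_rhs ?e1 \<eta>1 \<theta>1 r - diffusion_rhs ?e2 \<eta>2 \<theta>2 r\<bar> \<le> (K * \<sigma> * d / kappa) / r^(k+1)"
    using b(2) r kappa unfolding diffusion_rhs_def diff_divide_distrib[symmetric]
    by (simp add: abs_divide abs_mult divide_right_mono)
  have "\<bar>R / (mu * vp) * (\<theta>1 r - \<theta>2 r)\<bar> = R / (mu * vp) * \<bar>\<theta>1 r - \<theta>2 r\<bar>"
    using R mu vp by (simp only: abs_mult) simp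
  then show "\<bar>transport_rhs ?e1 \<eta>1 \<theta>1 r - transport_rhs ?e2 \<eta>2 \<theta>2 r\<bar>
       \<le> R / (mu * vp) * \<bar>\<theta>1 r - \<theta>2 r\<bar> + K * \<sigma> * d / r^k"
    using b(1) unfolding transport_rhs_def right_diff_distrib by linarith
qed

text \<open>\<open>c\<close> is the weighted bound for the new \<open>\<theta>'\<close>: its
  boundary value plus a quadratic error. It is \<open>c\<close>, not \<open>\<sigma>\<close>, that
  enters the condition for \<open>\<eta>'\<close>, so the linear coupling costs only a multiple of
  the boundary data, and the ball can be mapped into itself however large the coupling is.\<close>

lemma closed_step_exists:
  assumes K: "source_bound K" and \<eta>: "decays k \<sigma> \<eta>" and \<theta>: "decays k \<sigma> \<theta>"
    and s: "\<sigma> \<le> 1" "\<sigma> \<le> vp / 2" "\<sigma> * real k \<le> damping / 2"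
    and um: "um \<noteq> 0" "2 / vp * \<bar>um\<bar> \<le> \<sigma>" and vm: "um > 0 \<Longrightarrow> vm \<ge> vp / 2"
    and c: "c = \<bar>\<theta>m\<bar> + 2 * (K * \<sigma>^2 / kappa)" "c \<le> \<sigma>"
    and m: "2 * (R / (mu * vp) * c + K * \<sigma>^2) / damping + (if um > 0 then \<bar>\<eta>m\<bar> else 0) \<le> \<sigma>"
  shows "\<exists>\<eta>' \<theta>'. decays k \<sigma> \<eta>' \<and> decays k \<sigma> \<theta>' \<and> closed_step um vm \<eta>m \<theta>m \<eta> \<theta> \<eta>' \<theta>'"
proof -
  define e where "e = mass_flux um vm \<eta>"
  note e = mass_flux_bounds[OF \<eta> s(2) um(1) vm, folded e_def]
  have s0: "\<sigma> \<ge> 0" using decaysD(2)[OF \<eta>, of 1] by auto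
  have K0: "K \<ge> 0" using K by (simp add: source_bound_def)
  note db = rhs_bounds(1)[OF K \<eta> \<theta> s(1,2) um vm, folded e_def]
  have M0: "K * \<sigma>^2 / kappa \<ge> 0" using K0 kappa by simp
  obtain \<theta>' A where T: "\<And>r. r \<ge> 1 \<Longrightarrow> (\<theta>' has_real_derivative - A / r^(k+1) + diffusion_rhs e \<eta> \<theta> r) (at r within {1..})"
    "\<theta>' 1 = \<theta>m" "(\<theta>' \<longlongrightarrow> 0) at_top"
    using diffusion_solution[OF rhs_continuous(2)[OF \<eta> \<theta> s(2)] k db] by metis
  have Tc: "continuous_on {1..} \<theta>'" using T(1) by (intro DERIV_continuous_on) auto
  have Tb: "\<bar>\<theta>' r\<bar> \<le> c / r^k" if "r \<ge> 1" for r
    unfolding c(1) T(2)[symmetric]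
  proof (rule diffusion_bound[OF Tc T(3) k _ db M0 that])
    show "DERIV \<theta>' r :> - A / r^(k+1) + diffusion_rhs e \<eta> \<theta> r" if "r > 1" for r
      using T(1)[of r] that by (simp add: at_within_Ici_interior)
  qed auto
  have \<theta>': "decays k \<sigma> \<theta>'" unfolding decays_def
  proof (intro conjI Tc allI impI)
    fix r :: real assume r: "r \<ge> 1"
    have "c / r^k \<le> \<sigma> / r^k" using c r by (intro divide_right_mono) auto
    then show "\<bar>\<theta>' r\<bar> \<le> \<sigma> / r^k" using Tb[OF r] by simp
  qed
  define M where "M = R / (mu * vp) * c + K * \<sigma>^2"
  have c0: "c \<ge> 0" using c M0 by auto
  have M: "M \<ge> 0" using R mu vp c0 K0 by (simp add: M_def)
  have tb: "\<bar>transport_rhs e \<eta> \<theta>' r\<bar> \<le> M / r^k" if r: "r \<ge> 1" for r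
  proof -
    have "R / (mu * vp) * \<bar>\<theta>' r\<bar> \<le> R / (mu * vp) * (c / r^k)"
      using R mu vp by (intro mult_left_mono Tb r) auto
    then show ?thesis using rhs_bounds(2)[OF K \<eta> \<theta>' s(1,2) um vm r, folded e_def]
      by (simp add: M_def add_divide_distrib)
  qed
  have tb1: "\<bar>transport_rhs e \<eta> \<theta>' r\<bar> \<le> M" if r: "r \<ge> 1" for r
  proof -
    have "M / r^k \<le> M / 1" using M r by (intro divide_left_mono) auto
    then show ?thesis using tb[OF r] by simp
  qed
  obtain \<eta>' where E: "\<And>r. r \<ge> 1 \<Longrightarrow> (\<eta>' has_real_derivative r^(k+1) / e * (transport_rhs e \<eta> \<theta>' r - damping * \<eta>' r)) (at r within {1..})"
    "e > 0 \<Longrightarrow> \<eta>' 1 = \<eta>m" "\<And>r. e < 0 \<Longrightarrow> r \<ge> 1 \<Longrightarrow> \<bar>\<eta>' r\<bar> \<le> M / damping"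
    using transport_solution[OF rhs_continuous(1)[OF \<eta> \<theta>' s(2)] tb1 damping_pos e(1)] by metis
  have Ec: "continuous_on {1..} \<eta>'" using E(1) by (intro DERIV_continuous_on) auto
  have ek: "\<bar>e\<bar> * real k \<le> damping / 2"
  proof -
    have "\<bar>e\<bar> * real k \<le> \<sigma> * real k" using e um by (intro mult_right_mono) auto
    then show ?thesis using s by simp
  qed
  have Eb: "\<bar>\<eta>' r\<bar> \<le> (2 * M / damping + (if e > 0 then \<bar>\<eta>' 1\<bar> else 0)) / r^k" if "r \<ge> 1" for r
  proof (rule transport_bound[OF Ec _ tb M e(1) ek damping_pos k _ that])
    show "DERIV \<eta>' r :> r^(k+1) / e * (transport_rhs e \<eta> \<theta>' r - damping * \<eta>' r)" if "r > 1" for r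
      using E(1)[of r] that by (simp add: at_within_Ici_interior)
  qed (use E(3) in auto)
  have \<eta>': "decays k \<sigma> \<eta>'" unfolding decays_def
  proof (intro conjI Ec allI impI)
    fix r :: real assume r: "r \<ge> 1"
    have "2 * M / damping + (if e > 0 then \<bar>\<eta>' 1\<bar> else 0) \<le> \<sigma>" using m E(2) e(2) by (auto simp: M_def)
    then have "(2 * M / damping + (if e > 0 then \<bar>\<eta>' 1\<bar> else 0)) / r^k \<le> \<sigma> / r^k" using r by (intro divide_right_mono) auto
    then show "\<bar>\<eta>' r\<bar> \<le> \<sigma> / r^k" using Eb[OF r] by simp
  qed
  have "closed_step um vm \<eta>m \<theta>m \<eta> \<theta> \<eta>' \<theta>'"
    unfolding closed_step_def Let_def e_def[symmetric] using T E e(2) by blast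
  with \<eta>' \<theta>' show ?thesis by blast
qed

text \<open>The increment of \<open>\<theta>\<close> is of size \<open>\<sigma> * d\<close> and is
  inserted, in this sharp form, into the linear coupling of the transport equation. Since only
  \<open>step\<close> is assumed and the images are arbitrary members of the ball, the estimate also
  compares two given solutions.\<close>

lemma step_contracts:
  assumes K: "source_bound K"
    and dec: "decays k \<sigma> \<eta>1" "decays k \<sigma> \<theta>1" "decays k \<sigma> \<eta>1'" "decays k \<sigma> \<theta>1'"
      "decays k \<sigma> \<eta>2" "decays k \<sigma> \<theta>2" "decays k \<sigma> \<eta>2'" "decays k \<sigma> \<theta>2'"
    and st: "step um vm \<eta>m \<theta>m \<eta>1 \<theta>1 \<eta>1' \<theta>1'" "step um vm \<eta>m \<theta>m \<eta>2 \<theta>2 \<eta>2' \<theta>2'"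
    and s: "\<sigma> \<le> 1" "\<sigma> \<le> vp / 2" "\<sigma> * real k \<le> damping / 2"
    and um: "um \<noteq> 0" "2 / vp * \<bar>um\<bar> \<le> \<sigma>" and vm: "um > 0 \<Longrightarrow> vm \<ge> vp / 2"
    and q1: "2 * (K * \<sigma> / kappa) \<le> 1/4"
    and q2: "2 * (\<sigma> * (2 * R * K / (mu * vp * kappa) + K + 2 / vp * (R / (mu * vp) + K + damping))) / damping \<le> 1/4"
    and d: "\<And>r. r \<ge> 1 \<Longrightarrow> \<bar>\<eta>1 r - \<eta>2 r\<bar> \<le> d / r^k" "\<And>r. r \<ge> 1 \<Longrightarrow> \<bar>\<theta>1 r - \<theta>2 r\<bar> \<le> d / r^k"
  shows "\<forall>r\<ge>1. \<bar>\<eta>1' r - \<eta>2' r\<bar> \<le> (d/4) / r^k \<and> \<bar>\<theta>1' r - \<theta>2' r\<bar> \<le> (d/4) / r^k"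
proof -
  define e1 e2 where "e1 = mass_flux um vm \<eta>1" and "e2 = mass_flux um vm \<eta>2"
  note e1 = mass_flux_bounds[OF dec(1) s(2) um(1) vm, folded e1_def]
    and e2 = mass_flux_bounds[OF dec(5) s(2) um(1) vm, folded e2_def]
  have s0: "\<sigma> \<ge> 0" using decaysD(2)[OF dec(1), of 1] by auto
  have d0: "d \<ge> 0" using d(1)[of 1] by auto
  have K0: "K \<ge> 0" using K by (simp add: source_bound_def)
  obtain A1 where A1: "\<And>r. r > 1 \<Longrightarrow> DERIV \<theta>1' r :> - A1 / r^(k+1) + diffusion_rhs e1 \<eta>1 \<theta>1 r" "(\<theta>1' \<longlongrightarrow> 0) at_top" "\<theta>1' 1 = \<theta>m"
     "\<And>r. r > 1 \<Longrightarrow> DERIV \<eta>1' r :> r^(k+1) / e1 * (transport_rhs e1 \<eta>1 \<theta>1' r - damping * \<eta>1' r)" "um > 0 \<Longrightarrow> \<eta>1' 1 = \<eta>m"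
    using st(1) unfolding step_def Let_def e1_def by blast
  obtain A2 where A2: "\<And>r. r > 1 \<Longrightarrow> DERIV \<theta>2' r :> - A2 / r^(k+1) + diffusion_rhs e2 \<eta>2 \<theta>2 r" "(\<theta>2' \<longlongrightarrow> 0) at_top" "\<theta>2' 1 = \<theta>m"
     "\<And>r. r > 1 \<Longrightarrow> DERIV \<eta>2' r :> r^(k+1) / e2 * (transport_rhs e2 \<eta>2 \<theta>2' r - damping * \<eta>2' r)" "um > 0 \<Longrightarrow> \<eta>2' 1 = \<eta>m"
    using st(2) unfolding step_def Let_def e2_def by blast
  have T: "\<bar>\<theta>1' r - \<theta>2' r\<bar> \<le> (2 * (K * \<sigma> * d / kappa)) / r^k" if "r \<ge> 1" for r
  proof -
    have "\<bar>\<theta>1' r - \<theta>2' r\<bar> \<le> (\<bar>\<theta>1' 1 - \<theta>2' 1\<bar> + 2 * (K * \<sigma> * d / kappa)) / r^k"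
    proof (rule diffusion_bound[OF _ _ k _ _ _ that])
      show "continuous_on {1..} (\<lambda>r. \<theta>1' r - \<theta>2' r)"
        by (intro continuous_intros decaysD(1)[OF dec(4)] decaysD(1)[OF dec(8)])
      show "((\<lambda>r. \<theta>1' r - \<theta>2' r) \<longlongrightarrow> 0) at_top" using tendsto_diff[OF A1(2) A2(2)] by simp
      fix r :: real assume r: "r > 1"
      show "DERIV (\<lambda>r. \<theta>1' r - \<theta>2' r) r :> - (A1 - A2) / r^(k+1) + (diffusion_rhs e1 \<eta>1 \<theta>1 r - diffusion_rhs e2 \<eta>2 \<theta>2 r)"
        by (rule DERIV_cong[OF DERIV_diff[OF A1(1)[OF r] A2(1)[OF r]]]) (simp add: diff_divide_distrib)
      show "\<bar>diffusion_rhs e1 \<eta>1 \<theta>1 r - diffusion_rhs e2 \<eta>2 \<theta>2 r\<bar> \<le> (K * \<sigma> * d / kappa) / r^(k+1)"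
        unfolding e1_def e2_def using rhs_diff_bounds(1)[OF K dec(1,5,2,6) s(1,2) um vm d] r by simp
    qed (use K0 s0 d0 kappa in auto)
    then show ?thesis using A1(3) A2(3) by simp
  qed
  have T': "2 * (K * \<sigma> * d / kappa) \<le> d/4"
    using mult_right_mono[OF q1 d0] by (simp add: mult_ac)
  have Td: "\<bar>\<theta>1' r - \<theta>2' r\<bar> \<le> (d/4) / r^k" if "r \<ge> 1" for r
    using T[OF that] divide_right_mono[OF T', of "r^k"] that by simp
  have Td': "\<bar>\<theta>1' r - \<theta>2' r\<bar> \<le> d / r^k" if "r \<ge> 1" for r
  proof -
    have "(d/4) / r^k \<le> d / r^k" using d0 that by (intro divide_right_mono) auto
    then show ?thesis using Td[OF that] by simp
  qed
  define m where "m = R / (mu * vp)"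
  have m0: "m \<ge> 0" using R mu vp by (simp add: m_def)
  \<comment> \<open>\<open>Q\<close> is what the source must be for the difference to solve a
    transport equation with the single factor \<open>r^(k+1) / e1\<close>.\<close>
  define Q where "Q = (\<lambda>r. transport_rhs e1 \<eta>1 \<theta>1' r - transport_rhs e2 \<eta>2 \<theta>2' r
      - (e1 / e2 - 1) * (transport_rhs e2 \<eta>2 \<theta>2' r - damping * \<eta>2' r))"
  \<comment> \<open>The three summands come from the increment of \<open>\<theta>\<close> through
    the linear coupling, from the transport source, and from the change of flux.\<close>
  define M where "M = \<sigma> * (2 * m * K / kappa + K + 2 / vp * (m + K + damping)) * d"
  have M0: "M \<ge> 0" using s0 m0 K0 kappa vp damping_pos d0 unfolding M_def
    by (intro mult_nonneg_nonneg add_nonneg_nonneg divide_nonneg_nonneg) auto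
  have Qb: "\<bar>Q r\<bar> \<le> M / r^k" if r: "r > 1" for r
  proof -
    have r1: "r \<ge> 1" using r by simp
    define w where "w = 1 / r^k"
    have w0: "w \<ge> 0" using r by (simp add: w_def)
    have 1: "\<bar>transport_rhs e1 \<eta>1 \<theta>1' r - transport_rhs e2 \<eta>2 \<theta>2' r\<bar> \<le> m * \<bar>\<theta>1' r - \<theta>2' r\<bar> + K * \<sigma> * d * w"
      unfolding e1_def e2_def m_def w_def using rhs_diff_bounds(2)[OF K dec(1,5,4,8) s(1,2) um vm d(1) Td' r1] by simp
    have 2: "m * \<bar>\<theta>1' r - \<theta>2' r\<bar> \<le> m * (2 * (K * \<sigma> * d / kappa) * w)"
      using T[OF r1] m0 by (intro mult_left_mono) (auto simp: w_def)
    have 3: "\<bar>transport_rhs e2 \<eta>2 \<theta>2' r\<bar> \<le> m * \<bar>\<theta>2' r\<bar> + K * \<sigma>^2 * w"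
      unfolding e2_def m_def w_def using rhs_bounds(2)[OF K dec(5,8) s(1,2) um vm r1] by simp
    have 4: "m * \<bar>\<theta>2' r\<bar> \<le> m * (\<sigma> * w)" "damping * \<bar>\<eta>2' r\<bar> \<le> damping * (\<sigma> * w)"
      using decaysD(2)[OF dec(8) r1] decaysD(2)[OF dec(7) r1] m0 damping_pos
      by (intro mult_left_mono; simp add: w_def)+
    have "\<sigma>^2 \<le> \<sigma>" using s0 s by (simp add: power2_eq_square mult_left_le)
    then have 5: "K * \<sigma>^2 * w \<le> K * \<sigma> * w" using K0 w0 by (intro mult_right_mono mult_left_mono)
    have "\<bar>transport_rhs e2 \<eta>2 \<theta>2' r - damping * \<eta>2' r\<bar> \<le> \<bar>transport_rhs e2 \<eta>2 \<theta>2' r\<bar> + damping * \<bar>\<eta>2' r\<bar>"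
      using abs_triangle_ineq4[of "transport_rhs e2 \<eta>2 \<theta>2' r" "damping * \<eta>2' r"] damping_pos by (simp add: abs_mult)
    also have "\<dots> \<le> (m + K + damping) * \<sigma> * w" using 3 4 5 by (simp add: distrib_right mult.assoc)
    finally have 6: "\<bar>transport_rhs e2 \<eta>2 \<theta>2' r - damping * \<eta>2' r\<bar> \<le> (m + K + damping) * \<sigma> * w" .
    have 7: "\<bar>e1 / e2 - 1\<bar> \<le> 2 / vp * d"
      unfolding e1_def e2_def using mass_flux_ratio[OF dec(1,5) s(2) um(1) vm] d(1)[of 1] by simp
    have 8: "\<bar>(e1 / e2 - 1) * (transport_rhs e2 \<eta>2 \<theta>2' r - damping * \<eta>2' r)\<bar> \<le> (2 / vp * d) * ((m + K + damping) * \<sigma> * w)"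
      unfolding abs_mult using 6 7 vp d0 by (intro mult_mono) auto
    have "\<bar>Q r\<bar> \<le> m * (2 * (K * \<sigma> * d / kappa) * w) + K * \<sigma> * d * w + (2 / vp * d) * ((m + K + damping) * \<sigma> * w)"
      unfolding Q_def using 1 2 8 by linarith
    also have "\<dots> = M * w" unfolding M_def by (simp add: algebra_simps add_divide_distrib)
    finally show ?thesis by (simp add: w_def)
  qed
  have ek: "\<bar>e1\<bar> * real k \<le> damping / 2"
  proof -
    have "\<bar>e1\<bar> * real k \<le> \<sigma> * real k" using e1 um by (intro mult_right_mono) auto
    then show ?thesis using s by simp
  qed
  have E: "\<bar>\<eta>1' r - \<eta>2' r\<bar> \<le> (2 * M / damping) / r^k" if "r \<ge> 1" for r
  proof -
    have "\<bar>\<eta>1' r - \<eta>2' r\<bar> \<le> (2 * M / damping + (if e1 > 0 then \<bar>\<eta>1' 1 - \<eta>2' 1\<bar> else 0)) / r^k"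
    proof (rule transport_bound[OF _ _ Qb M0 e1(1) ek damping_pos k _ that])
      show "continuous_on {1..} (\<lambda>r. \<eta>1' r - \<eta>2' r)"
        by (intro continuous_intros decaysD(1)[OF dec(3)] decaysD(1)[OF dec(7)])
      fix r :: real assume r: "r > 1"
      show "DERIV (\<lambda>r. \<eta>1' r - \<eta>2' r) r :> r^(k+1) / e1 * (Q r - damping * (\<eta>1' r - \<eta>2' r))"
      proof (rule DERIV_cong[OF DERIV_diff[OF A1(4)[OF r] A2(4)[OF r]]])
        show "r^(k+1) / e1 * (transport_rhs e1 \<eta>1 \<theta>1' r - damping * \<eta>1' r) -
            r^(k+1) / e2 * (transport_rhs e2 \<eta>2 \<theta>2' r - damping * \<eta>2' r) =
            r^(k+1) / e1 * (Q r - damping * (\<eta>1' r - \<eta>2' r))"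
          unfolding Q_def using e1(1) e2(1) by (simp add: field_simps)
      qed
    next
      \<comment> \<open>For negative flux, membership in the ball supplies the boundedness; for
        positive flux the boundary values at 1 coincide.\<close>
      have "\<bar>\<eta>1' r - \<eta>2' r\<bar> \<le> 2 * \<sigma>" if r: "r \<ge> 1" for r
      proof -
        have "\<sigma> / r^k \<le> \<sigma> / 1" using s0 r by (intro divide_left_mono) auto
        then show ?thesis using decaysD(2)[OF dec(3) r] decaysD(2)[OF dec(7) r] by linarith
      qed
      then show "\<exists>B. \<forall>r\<ge>1. \<bar>\<eta>1' r - \<eta>2' r\<bar> \<le> B" by blast
    qed
    then show ?thesis using A1(5) A2(5) e1(2) by (auto split: if_splits)
  qed
  have "2 * M / damping \<le> d/4"
    using mult_right_mono[OF q2 d0] unfolding M_def m_def by (simp add: mult_ac)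
  then have "\<bar>\<eta>1' r - \<eta>2' r\<bar> \<le> (d/4) / r^k" if "r \<ge> 1" for r
    using E[OF that] divide_right_mono[of "2 * M / damping" "d/4" "r^k"] that by simp
  with Td show ?thesis by blast
qed


section \<open>Choice of constants, existence and uniqueness of the fixed point\<close>

lemma solution_constants:
  obtains C s0 where "C > 0" "s0 > 0" "s0 \<le> 1" "s0 \<le> vp / 2"
    "\<And>um vm \<eta>m \<theta>m \<delta>. um \<noteq> 0 \<Longrightarrow> (um > 0 \<Longrightarrow> vm \<ge> vp / 2) \<Longrightarrow>
       \<bar>um\<bar> + (if um > 0 then \<bar>\<eta>m\<bar> else 0) + \<bar>\<theta>m\<bar> \<le> \<delta> \<Longrightarrow> C * \<delta> \<le> s0 \<Longrightarrow>
       2 / vp * \<bar>um\<bar> \<le> C * \<delta> \<and>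
       (\<exists>\<eta> \<theta> \<eta>' \<theta>'. decays k (C*\<delta>) \<eta> \<and> decays k (C*\<delta>) \<theta> \<and> decays k (C*\<delta>) \<eta>' \<and> decays k (C*\<delta>) \<theta>' \<and>
          closed_step um vm \<eta>m \<theta>m \<eta> \<theta> \<eta>' \<theta>' \<and> (\<forall>r\<ge>1. \<eta> r = \<eta>' r \<and> \<theta> r = \<theta>' r)) \<and>
       (\<forall>\<eta>1 \<theta>1 \<eta>2 \<theta>2. decays k (C*\<delta>) \<eta>1 \<longrightarrow> decays k (C*\<delta>) \<theta>1 \<longrightarrow> decays k (C*\<delta>) \<eta>2 \<longrightarrow> decays k (C*\<delta>) \<theta>2 \<longrightarrow>
          step um vm \<eta>m \<theta>m \<eta>1 \<theta>1 \<eta>1 \<theta>1 \<longrightarrow> step um vm \<eta>m \<theta>m \<eta>2 \<theta>2 \<eta>2 \<theta>2 \<longrightarrow>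
          (\<forall>r\<ge>1. \<eta>1 r = \<eta>2 r \<and> \<theta>1 r = \<theta>2 r))"
proof -
  obtain K where K: "source_bound K" using source_bound_exists by blast
  have K0: "K \<ge> 0" using K by (simp add: source_bound_def)
  define m where "m = R / (mu * vp)"
  have m0: "m > 0" using R mu vp by (simp add: m_def)
  \<comment> \<open>\<open>2 / vp\<close> makes the flux at most \<open>C * \<delta>\<close>;
    \<open>4 * m / damping + 2\<close> pays in the bound for \<eta> for the coupling with
    \<open>c \<le> 2 * \<delta>\<close>, for the quadratic error and for the boundary value, the
    last two at most \<open>\<delta>\<close> each.\<close>
  define C where "C = 2 / vp + 2 + 4 * m / damping"
  have C: "C > 0" "C \<ge> 2" "C \<ge> 2 / vp" "C \<ge> 4 * m / damping + 2"
    using vp m0 damping_pos by (auto simp: C_def add_pos_pos)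
  define q where "q = 2 * m * K / kappa + K + 2 / vp * (m + K + damping)"
  have q0: "q \<ge> 0" unfolding q_def using m0 K0 kappa vp damping_pos
    by (intro add_nonneg_nonneg mult_nonneg_nonneg divide_nonneg_nonneg) auto
  \<comment> \<open>Each smallness condition on the radius has the form
    \<open>x * \<sigma> \<le> 1\<close>; \<open>B\<close> adds up all these \<open>x\<close>, so
    \<open>\<sigma> \<le> 1 / B\<close> meets them together.\<close>
  define B where "B = 1 + 2 / vp + 2 * real k / damping + 2 * K * C / kappa + 2 * K * C / damping + 8 * K / kappa + 8 * q / damping"
  have pos: "0 \<le> 2 / vp" "0 \<le> 2 * real k / damping" "0 \<le> 2 * K * C / kappa" "0 \<le> 2 * K * C / damping" "0 \<le> 8 * K / kappa" "0 \<le> 8 * q / damping"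
    using vp damping_pos K0 C kappa q0 by auto
  have B: "B \<ge> 1" "B \<ge> 2 / vp" "B \<ge> 2 * real k / damping" "B \<ge> 2 * K * C / kappa" "B \<ge> 2 * K * C / damping"
     "B \<ge> 8 * K / kappa" "B \<ge> 8 * q / damping" using pos unfolding B_def by linarith+
  have sm: "x * \<sigma> \<le> 1" if "\<sigma> \<le> 1 / B" "0 \<le> \<sigma>" "x \<le> B" for x \<sigma>
  proof -
    have "x * \<sigma> \<le> B * \<sigma>" using that by (intro mult_right_mono)
    also have "\<dots> \<le> 1" using that B(1) by (simp add: pos_le_divide_eq mult.commute)
    finally show ?thesis .
  qed
  show ?thesis
  proof (rule that[of C "1 / B"])
    show "1 / B > 0" "1 / B \<le> 1" using B by auto
    have "2 / vp * (1 / B) \<le> 1" by (rule sm) (use B in auto)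
    then show "1 / B \<le> vp / 2" using vp B(1) by (simp add: field_simps)
    fix um vm \<eta>m \<theta>m \<delta> :: real
    assume um: "um \<noteq> 0" and vm: "um > 0 \<Longrightarrow> vm \<ge> vp / 2"
      and \<delta>: "\<bar>um\<bar> + (if um > 0 then \<bar>\<eta>m\<bar> else 0) + \<bar>\<theta>m\<bar> \<le> \<delta>" and le: "C * \<delta> \<le> 1 / B"
    define \<sigma> where "\<sigma> = C * \<delta>"
    have d: "\<bar>um\<bar> \<le> \<delta>" "(if um > 0 then \<bar>\<eta>m\<bar> else 0) \<le> \<delta>" "\<bar>\<theta>m\<bar> \<le> \<delta>" "0 \<le> \<delta>"
      using \<delta> by (auto split: if_splits)
    have s0: "0 \<le> \<sigma>" using C d by (simp add: \<sigma>_def)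
    note S = sm[OF le[folded \<sigma>_def] s0]
    have s: "\<sigma> \<le> 1" "\<sigma> \<le> vp / 2" "\<sigma> * real k \<le> damping / 2"
      using S[OF B(1)] S[OF B(2)] S[OF B(3)] vp damping_pos by (auto simp: field_simps)
    have um2: "2 / vp * \<bar>um\<bar> \<le> \<sigma>"
      unfolding \<sigma>_def using C(1,3) d vp by (intro mult_mono) auto
    \<comment> \<open>One factor \<open>\<sigma>\<close> is traded for \<open>C * \<delta>\<close>
      and the other is kept small, so quadratic errors become at most \<open>\<delta>\<close>.
      \<open>B\<close> contains \<open>C\<close>, but \<open>C\<close> does not involve
      \<open>B\<close>, so there is no circularity.\<close>
    have sq: "K * \<sigma>^2 = (K * C * \<sigma>) * \<delta>" by (simp add: \<sigma>_def power2_eq_square)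
    define c where "c = \<bar>\<theta>m\<bar> + 2 * (K * \<sigma>^2 / kappa)"
    have "2 * (K * \<sigma>^2 / kappa) = (2 * K * C / kappa * \<sigma>) * \<delta>" by (simp add: sq)
    also have "\<dots> \<le> 1 * \<delta>" by (rule mult_right_mono[OF S[OF B(4)] d(4)])
    finally have c: "c \<le> 2 * \<delta>" using d by (simp add: c_def)
    have c': "c \<le> \<sigma>" using c mult_right_mono[OF C(2) d(4)] by (simp add: \<sigma>_def)
    have "2 * (K * \<sigma>^2) / damping = (2 * K * C / damping * \<sigma>) * \<delta>" by (simp add: sq)
    also have "\<dots> \<le> 1 * \<delta>" by (rule mult_right_mono[OF S[OF B(5)] d(4)])
    finally have m1: "2 * (K * \<sigma>^2) / damping \<le> \<delta>" by simp
    have "2 * (m * c) / damping \<le> 2 * (m * (2 * \<delta>)) / damping"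
      using c m0 damping_pos by (intro divide_right_mono mult_left_mono) auto
    then have "2 * (m * c + K * \<sigma>^2) / damping + (if um > 0 then \<bar>\<eta>m\<bar> else 0) \<le> 4 * m / damping * \<delta> + \<delta> + \<delta>"
      using m1 d(2) by (simp add: distrib_left add_divide_distrib)
    also have "\<dots> \<le> \<sigma>" using mult_right_mono[OF C(4) d(4)] by (simp add: \<sigma>_def distrib_right)
    finally have m2: "2 * (R / (mu * vp) * c + K * \<sigma>^2) / damping + (if um > 0 then \<bar>\<eta>m\<bar> else 0) \<le> \<sigma>"
      by (simp add: m_def)
    have q1: "2 * (K * \<sigma> / kappa) \<le> 1/4" using S[OF B(6)] by simp
    have q2: "2 * (\<sigma> * (2 * R * K / (mu * vp * kappa) + K + 2 / vp * (R / (mu * vp) + K + damping))) / damping \<le> 1/4"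
      using S[OF B(7)] by (simp add: q_def m_def mult_ac)
    note ex = closed_step_exists[OF K _ _ s um um2 vm c_def c' m2]
    note lip = step_contracts[OF K _ _ _ _ _ _ _ _ _ _ s um um2 vm q1 q2]
    have E: "\<exists>\<eta> \<theta> \<eta>' \<theta>'. decays k \<sigma> \<eta> \<and> decays k \<sigma> \<theta> \<and> decays k \<sigma> \<eta>' \<and> decays k \<sigma> \<theta>' \<and>
          closed_step um vm \<eta>m \<theta>m \<eta> \<theta> \<eta>' \<theta>' \<and> (\<forall>r\<ge>1. \<eta> r = \<eta>' r \<and> \<theta> r = \<theta>' r)"
    proof (rule relational_fixed_point[OF s0 ex])
      show "\<forall>r\<ge>1. \<bar>f1' r - f2' r\<bar> \<le> (d/4) / r^k \<and> \<bar>g1' r - g2' r\<bar> \<le> (d/4) / r^k"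
        if "decays k \<sigma> f1" "decays k \<sigma> g1" "decays k \<sigma> f1'" "decays k \<sigma> g1'"
          "decays k \<sigma> f2" "decays k \<sigma> g2" "decays k \<sigma> f2'" "decays k \<sigma> g2'"
          "closed_step um vm \<eta>m \<theta>m f1 g1 f1' g1'" "closed_step um vm \<eta>m \<theta>m f2 g2 f2' g2'"
          "\<And>r. r \<ge> 1 \<Longrightarrow> \<bar>f1 r - f2 r\<bar> \<le> d / r^k" "\<And>r. r \<ge> 1 \<Longrightarrow> \<bar>g1 r - g2 r\<bar> \<le> d / r^k"
        for f1 g1 f1' g1' f2 g2 f2' g2' d
        by (rule lip[OF that(1-8) closed_step_imp_step[OF that(9)] closed_step_imp_step[OF that(10)] _ that(11,12)])
    qed
    have U: "\<forall>r\<ge>1. \<eta>1 r = \<eta>2 r \<and> \<theta>1 r = \<theta>2 r"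
      if dec: "decays k \<sigma> \<eta>1" "decays k \<sigma> \<theta>1" "decays k \<sigma> \<eta>2" "decays k \<sigma> \<theta>2"
        and st: "step um vm \<eta>m \<theta>m \<eta>1 \<theta>1 \<eta>1 \<theta>1" "step um vm \<eta>m \<theta>m \<eta>2 \<theta>2 \<eta>2 \<theta>2" for \<eta>1 \<theta>1 \<eta>2 \<theta>2
    proof -
      \<comment> \<open>A fixed point is its own image, so the contraction estimate can be repeated
        on the same two pairs, starting from the diameter \<open>2 * \<sigma>\<close> of the
        ball.\<close>
      have P: "\<forall>r\<ge>1. \<bar>\<eta>1 r - \<eta>2 r\<bar> \<le> (2 * \<sigma> * (1/4)^j) / r^k \<and> \<bar>\<theta>1 r - \<theta>2 r\<bar> \<le> (2 * \<sigma> * (1/4)^j) / r^k" for j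
      proof (induction j)
        case 0
        have "\<bar>f r - g r\<bar> \<le> (2 * \<sigma>) / r^k" if "decays k \<sigma> f" "decays k \<sigma> g" "r \<ge> 1" for f g and r :: real
          using decaysD(2)[OF that(1,3)] decaysD(2)[OF that(2,3)] by simp
        then show ?case using dec by simp
      next
        case (Suc j)
        have "\<forall>r\<ge>1. \<bar>\<eta>1 r - \<eta>2 r\<bar> \<le> ((2 * \<sigma> * (1/4)^j) / 4) / r^k \<and> \<bar>\<theta>1 r - \<theta>2 r\<bar> \<le> ((2 * \<sigma> * (1/4)^j) / 4) / r^k"
          by (rule lip[OF dec(1,2,1,2,3,4,3,4) st]) (use Suc in auto)
        then show ?case by simp
      qed
      have lim: "((\<lambda>j. (2 * \<sigma> * (1/4)^j) / r^k) \<longlongrightarrow> (2 * \<sigma> * 0) / r^k) sequentially" if "r \<ge> 1" for r :: real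
        using that by (intro tendsto_intros LIMSEQ_realpow_zero) auto
      have "\<bar>\<eta>1 r - \<eta>2 r\<bar> \<le> 0 \<and> \<bar>\<theta>1 r - \<theta>2 r\<bar> \<le> 0" if "r \<ge> 1" for r
        using LIMSEQ_le_const[OF lim[OF that], of "\<bar>\<eta>1 r - \<eta>2 r\<bar>"] LIMSEQ_le_const[OF lim[OF that], of "\<bar>\<theta>1 r - \<theta>2 r\<bar>"] P that
        by simp
      then show ?thesis by auto
    qed
    show "2 / vp * \<bar>um\<bar> \<le> C * \<delta> \<and>
       (\<exists>\<eta> \<theta> \<eta>' \<theta>'. decays k (C*\<delta>) \<eta> \<and> decays k (C*\<delta>) \<theta> \<and> decays k (C*\<delta>) \<eta>' \<and> decays k (C*\<delta>) \<theta>' \<and>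
          closed_step um vm \<eta>m \<theta>m \<eta> \<theta> \<eta>' \<theta>' \<and> (\<forall>r\<ge>1. \<eta> r = \<eta>' r \<and> \<theta> r = \<theta>' r)) \<and>
       (\<forall>\<eta>1 \<theta>1 \<eta>2 \<theta>2. decays k (C*\<delta>) \<eta>1 \<longrightarrow> decays k (C*\<delta>) \<theta>1 \<longrightarrow> decays k (C*\<delta>) \<eta>2 \<longrightarrow> decays k (C*\<delta>) \<theta>2 \<longrightarrow>
          step um vm \<eta>m \<theta>m \<eta>1 \<theta>1 \<eta>1 \<theta>1 \<longrightarrow> step um vm \<eta>m \<theta>m \<eta>2 \<theta>2 \<eta>2 \<theta>2 \<longrightarrow>
          (\<forall>r\<ge>1. \<eta>1 r = \<eta>2 r \<and> \<theta>1 r = \<theta>2 r))"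
      unfolding \<sigma>_def[symmetric] using um2 E U by blast
  qed (use C in auto)
qed

end

section \<open>Smoothness\<close>

inductive_set generated_algebra :: "(real \<Rightarrow> real) set \<Rightarrow> (real \<Rightarrow> real) set" for B where
  base: "f \<in> B \<Longrightarrow> f \<in> generated_algebra B"
| const: "(\<lambda>_. c) \<in> generated_algebra B"
| add: "f \<in> generated_algebra B \<Longrightarrow> g \<in> generated_algebra B \<Longrightarrow> (\<lambda>x. f x + g x) \<in> generated_algebra B"
| mult: "f \<in> generated_algebra B \<Longrightarrow> g \<in> generated_algebra B \<Longrightarrow> (\<lambda>x. f x * g x) \<in> generated_algebra B"

lemma generated_algebra_power: "f \<in> generated_algebra B \<Longrightarrow> (\<lambda>x. f x ^ j) \<in> generated_algebra B"
  by (induction j) (auto intro: generated_algebra.intros)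

text \<open>By the sum and product rules only the generators need a derivative inside the algebra. A
  derivative is then chosen for every member, and the iterates of this choice form the sequence
  required by \<open>smooth_on\<close>, one-sided at a boundary point of \<open>S\<close>.\<close>

lemma smooth_on_generated_algebra:
  assumes B: "\<And>f. f \<in> B \<Longrightarrow> \<exists>f'\<in>generated_algebra B. \<forall>x\<in>S. (f has_real_derivative f' x) (at x within S)"
    and f: "f \<in> generated_algebra B"
  shows "smooth_on S f"
proof -
  have "\<exists>f'\<in>generated_algebra B. \<forall>x\<in>S. (f has_real_derivative f' x) (at x within S)" if "f \<in> generated_algebra B" for f
    using that
  proof induction
    case (base f)
    then show ?case by (rule B)
  next
    case (const c)
    then show ?case by (intro bexI[of _ "\<lambda>_. 0"]) (auto intro: generated_algebra.const)
  next
    case (add f g)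
    then obtain f' g' where "f' \<in> generated_algebra B" "g' \<in> generated_algebra B"
      "\<forall>x\<in>S. (f has_real_derivative f' x) (at x within S)" "\<forall>x\<in>S. (g has_real_derivative g' x) (at x within S)" by blast
    then show ?case by (intro bexI[of _ "\<lambda>x. f' x + g' x"]) (auto intro: generated_algebra.add DERIV_add)
  next
    case (mult f g)
    then obtain f' g' where "f' \<in> generated_algebra B" "g' \<in> generated_algebra B"
      "\<forall>x\<in>S. (f has_real_derivative f' x) (at x within S)" "\<forall>x\<in>S. (g has_real_derivative g' x) (at x within S)" by blast
    then show ?case using mult by (intro bexI[of _ "\<lambda>x. f' x * g x + g' x * f x"])
       (auto intro: generated_algebra.add generated_algebra.mult DERIV_mult)
  qed
  then obtain der where der: "\<And>f. f \<in> generated_algebra B \<Longrightarrow> der f \<in> generated_algebra B"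
    "\<And>f x. f \<in> generated_algebra B \<Longrightarrow> x \<in> S \<Longrightarrow> (f has_real_derivative der f x) (at x within S)" by metis
  have "(der ^^ j) f \<in> generated_algebra B" for j by (induction j) (auto intro: f der)
  then show ?thesis unfolding smooth_on_def
    by (intro exI[of _ "\<lambda>j. (der ^^ j) f"]) (auto intro: der)
qed

context gas begin

text \<open>The fixed point agrees with its image only on \<open>{1..}\<close>, as functions are
  unconstrained elsewhere. Flux, tail and right-hand sides see only \<open>{1..}\<close>, so the
  input may be replaced by the image.\<close>

lemma closed_step_self:
  assumes "closed_step um vm \<eta>m \<theta>m \<eta> \<theta> \<eta>' \<theta>'" and eq: "\<forall>r\<ge>1. \<eta> r = \<eta>' r \<and> \<theta> r = \<theta>' r"
  shows "closed_step um vm \<eta>m \<theta>m \<eta>' \<theta>' \<eta>' \<theta>'"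
proof -
  have e: "mass_flux um vm \<eta> = mass_flux um vm \<eta>'" using eq by (simp add: mass_flux_def)
  have t: "tail \<eta> r = tail \<eta>' r" if "r \<ge> 1" for r
    unfolding tail_def by (rule integral_cong) (use that eq in auto)
  have d: "diffusion_rhs c \<eta> \<theta> r = diffusion_rhs c \<eta>' \<theta>' r" if "r \<ge> 1" for c r
    using eq t[OF that] that by (simp add: diffusion_rhs_def)
  have h: "transport_rhs c \<eta> \<theta>' r = transport_rhs c \<eta>' \<theta>' r" if "r \<ge> 1" for c r
    using eq t[OF that] that by (simp add: transport_rhs_def)
  show ?thesis using assms(1) unfolding closed_step_def Let_def e by (simp add: d h cong: conj_cong)
qed

lemma closed_step_smooth:
  assumes cs: "closed_step um vm \<eta>m \<theta>m \<eta> \<theta> \<eta> \<theta>" and \<eta>: "decays k \<sigma> \<eta>" and s: "\<sigma> \<le> vp / 2"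
    and e: "mass_flux um vm \<eta> \<noteq> 0"
  shows "smooth_on {1..} \<eta>" "smooth_on {1..} \<theta>"
proof -
  define e where "e = mass_flux um vm \<eta>"
  obtain A where A:
    "\<And>r. r \<ge> 1 \<Longrightarrow> (\<theta> has_real_derivative - A / r^(k+1) + diffusion_rhs e \<eta> \<theta> r) (at r within {1..})"
    "\<And>r. r \<ge> 1 \<Longrightarrow> (\<eta> has_real_derivative r^(k+1) / e * (transport_rhs e \<eta> \<theta> r - damping * \<eta> r)) (at r within {1..})"
    using cs unfolding closed_step_def Let_def e_def by blast
  have V: "vp + \<eta> r \<noteq> 0" if "r \<ge> 1" for r using decays_pos[OF \<eta> s that] vp by auto
  define W where "W = (\<lambda>r. 1 / (vp + \<eta> r))"
  define z where "z = (\<lambda>r::real. 1 / r)"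
  define B where "B = {\<lambda>r. r, z, W, \<eta>, \<theta>, tail \<eta>}"
  let ?A = "generated_algebra B"
  have gens: "(\<lambda>r. r) \<in> ?A" "z \<in> ?A" "W \<in> ?A" "\<eta> \<in> ?A" "\<theta> \<in> ?A" "tail \<eta> \<in> ?A"
    by (auto intro!: generated_algebra.base simp: B_def)
  note ints = generated_algebra.const generated_algebra.add generated_algebra.mult generated_algebra_power gens
  \<comment> \<open>The right-hand side is rewritten as a polynomial in the generators: each
    quotient becomes a product with \<open>W\<close>, a power of \<open>z\<close> or a
    constant.\<close>
  define D\<eta> where "D\<eta> = (\<lambda>r. r^(k+1) * (1 / e) * (R / (mu * vp) * \<theta> r + (R / (mu * vp)) * (\<theta> r * \<eta> r * W r)
      + (R * thp / (mu * vp^2)) * (\<eta> r * \<eta> r * W r) + (e^2 / mu) * ((vp / 2 + \<eta> r) * z r^(2*k+2))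
      + (- (e^2 * (real k + 1) / mu)) * tail \<eta> r + (- damping) * \<eta> r))"
  have D\<eta>: "D\<eta> \<in> ?A" unfolding D\<eta>_def by (intro ints)
  have D\<eta>': "(\<eta> has_real_derivative D\<eta> r) (at r within {1..})" if r: "r \<ge> 1" for r
  proof (rule DERIV_cong[OF A(2)[OF r]])
    show "r^(k+1) / e * (transport_rhs e \<eta> \<theta> r - damping * \<eta> r) = D\<eta> r"
      unfolding D\<eta>_def transport_rhs_def transport_source_def W_def z_def
      by (simp add: power2_eq_square power_one_over mult_ac)
  qed
  define D\<theta> where "D\<theta> = (\<lambda>r. (- A) * z r^(k+1) + (1 / kappa) * z r^(k+1) * (e * (R + cV) * \<theta> r
      + (- (e * R / vp)) * (\<theta> r * (vp + 2 * \<eta> r)) + (e * R * thp / vp) * \<eta> r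
      + (e^3 / 2) * ((vp + \<eta> r)^2 * z r^(2*k+2)) + (- (e^3)) * ((vp + \<eta> r) * (vp / 2 + \<eta> r) * z r^(2*k+2))
      + (e^3 * (real k + 1)) * ((vp + \<eta> r) * tail \<eta> r) + (2 * e^2 * nu * (real k + 1)) * ((vp + \<eta> r)^2 * z r^(k+2))))"
  have D\<theta>: "D\<theta> \<in> ?A" unfolding D\<theta>_def by (intro ints)
  have D\<theta>': "(\<theta> has_real_derivative D\<theta> r) (at r within {1..})" if r: "r \<ge> 1" for r
  proof (rule DERIV_cong[OF A(1)[OF r]])
    have "diffusion_source R (R + cV) nu vp thp k e r (\<eta> r) (\<theta> r) (tail \<eta> r) =
      e * (R + cV) * \<theta> r
      + (- (e * R / vp)) * (\<theta> r * (vp + 2 * \<eta> r)) + (e * R * thp / vp) * \<eta> r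
      + (e^3 / 2) * ((vp + \<eta> r)^2 * z r^(2*k+2)) + (- (e^3)) * ((vp + \<eta> r) * (vp / 2 + \<eta> r) * z r^(2*k+2))
      + (e^3 * (real k + 1)) * ((vp + \<eta> r) * tail \<eta> r) + (2 * e^2 * nu * (real k + 1)) * ((vp + \<eta> r)^2 * z r^(k+2))"
      unfolding diffusion_source_def z_def power_one_over
      by (simp add: right_diff_distrib mult_ac del: power_Suc)
    then show "- A / r^(k+1) + diffusion_rhs e \<eta> \<theta> r = D\<theta> r"
      unfolding D\<theta>_def diffusion_rhs_def by (simp add: z_def power_one_over del: power_Suc)
  qed
  have d1: "\<exists>f'\<in>?A. \<forall>x\<in>{1..}. ((\<lambda>r. r) has_real_derivative f' x) (at x within {1..})"
    by (rule bexI[of _ "\<lambda>_. 1"]) (auto intro: ints)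
  have d2: "\<exists>f'\<in>?A. \<forall>x\<in>{1..}. (z has_real_derivative f' x) (at x within {1..})"
  proof (rule bexI[of _ "\<lambda>r. (-1) * z r^2"])
    show "\<forall>x\<in>{1..}. (z has_real_derivative (-1) * z x^2) (at x within {1..})"
      unfolding z_def by (auto intro!: derivative_eq_intros simp: power2_eq_square)
  qed (intro ints)
  have d3: "\<exists>f'\<in>?A. \<forall>x\<in>{1..}. (W has_real_derivative f' x) (at x within {1..})"
  proof (rule bexI[of _ "\<lambda>r. (-1) * D\<eta> r * W r^2"])
    show "\<forall>x\<in>{1..}. (W has_real_derivative (-1) * D\<eta> x * W x^2) (at x within {1..})"
      unfolding W_def using D\<eta>' V
      by (auto intro!: derivative_eq_intros simp: power2_eq_square)
  qed (intro ints D\<eta>)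
  have d4: "\<exists>f'\<in>?A. \<forall>x\<in>{1..}. (\<eta> has_real_derivative f' x) (at x within {1..})"
    using D\<eta> D\<eta>' by auto
  have d5: "\<exists>f'\<in>?A. \<forall>x\<in>{1..}. (\<theta> has_real_derivative f' x) (at x within {1..})"
    using D\<theta> D\<theta>' by auto
  have d6: "\<exists>f'\<in>?A. \<forall>x\<in>{1..}. (tail \<eta> has_real_derivative f' x) (at x within {1..})"
  proof (rule bexI[of _ "\<lambda>r. (-1) * (\<eta> r * z r^(2*k+3))"])
    show "\<forall>x\<in>{1..}. (tail \<eta> has_real_derivative (-1) * (\<eta> x * z x^(2*k+3))) (at x within {1..})"
      using tail_bounds(3)[OF decaysD[OF \<eta>]] by (auto simp: z_def power_one_over simp del: power_Suc)
  qed (intro ints)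
  have gen': "\<exists>f'\<in>?A. \<forall>x\<in>{1..}. (f has_real_derivative f' x) (at x within {1..})" if "f \<in> B" for f
    using that d1 d2 d3 d4 d5 d6 unfolding B_def by (elim insertE emptyE; simp only:)
  show "smooth_on {1..} \<eta>" "smooth_on {1..} \<theta>"
    by (rule smooth_on_generated_algebra[OF gen']; simp add: gens)+
qed

end

section \<open>Solutions of the original problem\<close>

context gas begin

text \<open>The integrand is the derivative of \<open>- 2 \<epsilon>\<^sup>2 \<nu> (n-1) (v\<^sub>+ + \<eta>)\<^sup>2 / r\<^sup>n\<close>, so no derivative of \<open>\<eta>\<close> survives.\<close>

lemma Phi_term_integral:
  assumes \<eta>: "decays k \<sigma> \<eta>" and s: "\<sigma> \<le> vp / 2"
    and D: "\<And>r. r \<ge> 1 \<Longrightarrow> (\<eta> has_real_derivative D r) (at r within {1..})"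
    and Dc: "continuous_on {1..} D" and Db: "\<And>r. r \<ge> 1 \<Longrightarrow> \<bar>D r\<bar> \<le> B * r" and r: "r > 1"
  shows "(\<lambda>s. Phi_term (k+2) nu e vp \<eta> (deriv \<eta>) s) integrable_on {r..}"
    and "integral {r..} (\<lambda>s. Phi_term (k+2) nu e vp \<eta> (deriv \<eta>) s) = 2 * e^2 * nu * (real k + 1) * (vp + \<eta> r)^2 / r^(k+2)"
proof -
  define p where "p = Phi_term (k+2) nu e vp \<eta> D"
  \<comment> \<open>\<open>deriv\<close> is two-sided, so it is replaced by the one-sided
    \<open>D\<close> only beyond 1; this is possible because \<open>r > 1\<close>.\<close>
  have eq: "Phi_term (k+2) nu e vp \<eta> (deriv \<eta>) t = p t" if "t \<in> {r..}" for t
  proof -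
    have "deriv \<eta> t = D t" using D[of t] that r by (intro DERIV_imp_deriv) (simp add: at_within_Ici_interior)
    then show ?thesis by (simp add: p_def Phi_term_def)
  qed
  have \<eta>c: "continuous_on {1..} \<eta>" by (rule decaysD(1)[OF \<eta>])
  have pc: "continuous_on {1..} p"
    unfolding p_def Phi_term_def by (intro continuous_intros \<eta>c Dc) auto
  define c1 c2 where "c1 = 4 * e^2 * \<bar>nu\<bar> * (real k + 1)" and "c2 = 2 * e^2 * \<bar>nu\<bar> * (real k + 2) * (real k + 1)"
  have c: "c1 \<ge> 0" "c2 \<ge> 0" by (auto simp: c1_def c2_def)
  define M where "M = c1 * (2 * vp * B) + c2 * (2 * vp)^2"
  have s0: "\<sigma> \<ge> 0" using decaysD(2)[OF \<eta>, of 1] by auto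
  have V: "\<bar>vp + \<eta> t\<bar> \<le> 2 * vp" if "t \<ge> 1" for t
  proof -
    have "\<sigma> / t^k \<le> \<sigma> / 1" using s0 that by (intro divide_left_mono) auto
    then show ?thesis using decaysD(2)[OF \<eta> that] s vp by auto
  qed
  \<comment> \<open>Linear growth of \<open>D\<close> costs one power of \<open>t\<close>, and the
    remaining decay is still integrable since \<open>k \<ge> 1\<close>.\<close>
  have pb: "\<bar>p t\<bar> \<le> M / t^(k+1)" if t: "t \<ge> 1" for t
  proof -
    have "\<bar>vp + \<eta> t\<bar> * \<bar>D t\<bar> \<le> (2 * vp) * (B * t)" using V[OF t] Db[OF t] by (intro mult_mono) (use vp in auto)
    then have "\<bar>vp + \<eta> t\<bar> * \<bar>D t\<bar> / t^(k+2) \<le> (2 * vp) * (B * t) / t^(k+2)" using t by (intro divide_right_mono) auto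
    also have "\<dots> = (2 * vp * B) / t^(k+1)" using t by simp
    finally have "c1 * (\<bar>vp + \<eta> t\<bar> * \<bar>D t\<bar> / t^(k+2)) \<le> c1 * ((2 * vp * B) / t^(k+1))"
      using c(1) by (rule mult_left_mono)
    moreover have "\<bar>- 4 * e^2 * nu * (real (k+2) - 1) * (vp + \<eta> t) * D t / t^(k+2)\<bar> = c1 * (\<bar>vp + \<eta> t\<bar> * \<bar>D t\<bar> / t^(k+2))"
      using t by (simp add: c1_def abs_mult abs_divide del: power_Suc)
    ultimately have 1: "\<bar>- 4 * e^2 * nu * (real (k+2) - 1) * (vp + \<eta> t) * D t / t^(k+2)\<bar> \<le> c1 * ((2 * vp * B) / t^(k+1))" by simp
    have "\<bar>vp + \<eta> t\<bar>^2 \<le> (2 * vp)^2" using V[OF t] by (intro power_mono) auto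
    then have "(vp + \<eta> t)^2 / t^(k+3) \<le> (2 * vp)^2 / t^(k+1)"
      using t by (intro frac_le power_increasing) auto
    then have "c2 * ((vp + \<eta> t)^2 / t^(k+3)) \<le> c2 * ((2 * vp)^2 / t^(k+1))" using c(2) by (rule mult_left_mono)
    moreover have "\<bar>2 * e^2 * nu * real (k+2) * (real (k+2) - 1) * (vp + \<eta> t)^2 / t^(k+2+1)\<bar> = c2 * ((vp + \<eta> t)^2 / t^(k+3))"
      using t by (simp add: c2_def abs_mult abs_divide numeral_3_eq_3 add.commute)
    ultimately have 2: "\<bar>2 * e^2 * nu * real (k+2) * (real (k+2) - 1) * (vp + \<eta> t)^2 / t^(k+2+1)\<bar> \<le> c2 * ((2 * vp)^2 / t^(k+1))" by simp
    have "\<bar>p t\<bar> \<le> c1 * ((2 * vp * B) / t^(k+1)) + c2 * ((2 * vp)^2 / t^(k+1))"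
      unfolding p_def Phi_term_def by (rule order_trans[OF abs_triangle_ineq add_mono[OF 1 2]])
    then show ?thesis by (simp add: M_def add_divide_distrib)
  qed
  have M0: "M \<ge> 0" using pb[of 1] by auto
  note T = power_tail[OF pc k pb]
  define P where "P = (\<lambda>t. 2 * e^2 * nu * (real k + 1) * (vp + \<eta> t)^2 / t^(k+2))"
  have P': "(P has_real_derivative - p t) (at t within {1..})" if t: "t \<ge> 1" for t
  proof -
    define c3 where "c3 = 2 * e^2 * nu * (real k + 1)"
    have N: "((\<lambda>t. c3 * (vp + \<eta> t)^2) has_real_derivative c3 * (2 * (vp + \<eta> t) * D t)) (at t within {1..})"
      using t by (auto intro!: derivative_eq_intros D)
    have I: "((\<lambda>t. 1 / t^(k+2)) has_real_derivative - (real (k+2) * 1 / t^(k+2+1))) (at t within {1..})"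
      by (rule inverse_power_has_derivative) (use t in auto)
    have "((\<lambda>t. c3 * (vp + \<eta> t)^2 * (1 / t^(k+2))) has_real_derivative
        c3 * (2 * (vp + \<eta> t) * D t) * (1 / t^(k+2)) + - (real (k+2) * 1 / t^(k+2+1)) * (c3 * (vp + \<eta> t)^2)) (at t within {1..})"
      by (rule DERIV_mult[OF N I])
    moreover have "c3 * (2 * (vp + \<eta> t) * D t) * (1 / t^(k+2)) + - (real (k+2) * 1 / t^(k+2+1)) * (c3 * (vp + \<eta> t)^2) = - p t"
      unfolding p_def Phi_term_def c3_def by (simp add: mult_ac add.commute del: power_Suc)
    ultimately show ?thesis unfolding P_def c3_def by simp
  qed
  have Pc: "continuous_on {1..} P" using P' by (intro DERIV_continuous_on) auto
  have P0: "(P \<longlongrightarrow> 0) at_top"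
  proof (rule Lim_null_comparison)
    show "((\<lambda>t. (2 * e^2 * \<bar>nu\<bar> * (real k + 1) * (2 * vp)^2) / t^(k+2)) \<longlongrightarrow> 0) at_top"
      by (rule tendsto_inverse_power_at_top) simp
    show "\<forall>\<^sub>F t in at_top. norm (P t) \<le> (2 * e^2 * \<bar>nu\<bar> * (real k + 1) * (2 * vp)^2) / t^(k+2)"
    proof (rule eventually_at_top_linorderI[of 1])
      fix t :: real assume t: "t \<ge> 1"
      have "\<bar>vp + \<eta> t\<bar>^2 \<le> (2 * vp)^2" using V[OF t] by (intro power_mono) auto
      then have "2 * e^2 * \<bar>nu\<bar> * (real k + 1) * (vp + \<eta> t)^2 \<le> 2 * e^2 * \<bar>nu\<bar> * (real k + 1) * (2 * vp)^2"
        by (intro mult_left_mono) auto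
      moreover have "norm (P t) = 2 * e^2 * \<bar>nu\<bar> * (real k + 1) * (vp + \<eta> t)^2 / t^(k+2)"
        using t by (simp add: P_def abs_mult abs_divide)
      ultimately show "norm (P t) \<le> (2 * e^2 * \<bar>nu\<bar> * (real k + 1) * (2 * vp)^2) / t^(k+2)"
        using t by (simp only:) (intro divide_right_mono; simp)
    qed
  qed
  define J where "J = (\<lambda>r. integral {r..} p)"
  have J': "(J has_real_derivative - p t) (at t within {1..})" if "t \<ge> 1" for t
    unfolding J_def using T(3)[OF _ that] by simp
  have Jc: "continuous_on {1..} J" using J' by (intro DERIV_continuous_on) auto
  have J0: "(J \<longlongrightarrow> 0) at_top"
    unfolding J_def by (rule Lim_null_comparison[OF _ tendsto_inverse_power_at_top[OF k, of M]])
       (use T(2) in \<open>auto intro!: eventually_at_top_linorderI[of 1]\<close>)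
  \<comment> \<open>\<open>P\<close> and the tail integral \<open>J\<close> have the same derivative
    and the same limit 0; the barrier with \<open>M = 0\<close> makes them equal. As
    \<open>p\<close> may change sign, the rule for nonnegative integrands does not apply
    directly.\<close>
  have "\<bar>P r - J r\<bar> \<le> 0 / r^k"
  proof (rule abs_le_of_DERIV_le_inverse_power[where E = "\<lambda>r. P r - J r" and p = "\<lambda>_. 0" and M = 0 and k = k])
    show "continuous_on {1..} (\<lambda>r. P r - J r)" by (intro continuous_intros Pc Jc)
    show "((\<lambda>r. P r - J r) \<longlongrightarrow> 0) at_top" using tendsto_diff[OF P0 J0] by simp
    show "DERIV (\<lambda>r. P r - J r) t :> 0" if "t > 1" for t
      using DERIV_diff[OF P' J', of t] that by (simp add: at_within_Ici_interior)
  qed (use r k in auto)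
  then have "integral {r..} p = P r" by (simp add: J_def)
  moreover have "p integrable_on {r..}" by (rule T(1)) (use r in auto)
  ultimately show "(\<lambda>s. Phi_term (k+2) nu e vp \<eta> (deriv \<eta>) s) integrable_on {r..}"
    "integral {r..} (\<lambda>s. Phi_term (k+2) nu e vp \<eta> (deriv \<eta>) s) = 2 * e^2 * nu * (real k + 1) * (vp + \<eta> r)^2 / r^(k+2)"
    using integrable_cong[of "{r..}" "\<lambda>s. Phi_term (k+2) nu e vp \<eta> (deriv \<eta>) s" p]
      integral_cong[of "{r..}" "\<lambda>s. Phi_term (k+2) nu e vp \<eta> (deriv \<eta>) s" p] eq by (simp_all add: P_def)
qed

section \<open>Equivalence of the differential equations with the iteration\<close>

lemma transport_equation_iff:
  assumes e: "e \<noteq> 0" and V: "vp + \<eta> r \<noteq> 0" and r: "r > 1"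
  shows "D + R * thp * r^(k+2-1) / (e * mu * vp^2) * \<eta> r = R * r^(k+2-1) / (e * mu * vp) * \<theta> r + F_term (k+2) R mu vp thp e \<eta> \<theta> r
    \<longleftrightarrow> D = r^(k+1) / e * (transport_rhs e \<eta> \<theta> r - damping * \<eta> r)"
proof -
  define w where "w = r^(k+1)"
  have w: "w \<noteq> 0" "r^(2*k+2) = w * w" using r by (simp_all add: w_def mult_2 power_add)
  have n: "k + 2 - 1 = k + 1" "2 * (k + 2) - 1 = 2 * k + 3" by auto
  have "R * w / (e * mu * vp) * \<theta> r + F_term (k+2) R mu vp thp e \<eta> \<theta> r - R * thp * w / (e * mu * vp^2) * \<eta> r =
     w / e * (transport_rhs e \<eta> \<theta> r - damping * \<eta> r)"
    unfolding F_term_def transport_rhs_def transport_source_def damping_def n tail_def[symmetric] w_def[symmetric] w(2)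
    using e V mu vp w(1) by (simp add: divide_simps) (simp add: algebra_simps power2_eq_square)
  then show ?thesis unfolding n w_def[symmetric] by linarith
qed

lemma diffusion_equation_rhs:
  assumes e: "e \<noteq> 0" and V: "vp + \<eta> r \<noteq> 0" and r: "r > 1"
    and D: "D = r^(k+1) / e * (transport_rhs e \<eta> \<theta> r - damping * \<eta> r)"
    and I: "I = 2 * e^2 * nu * (real k + 1) * (vp + \<eta> r)^2 / r^(k+2)"
  shows "- \<alpha> / (kappa * r^(k+2-1)) + e * (R + cV) / (kappa * r^(k+2-1)) * \<theta> r
             + e^3 / 2 * (vp + \<eta> r)^2 / (kappa * r^(3*(k+2-1)))
             - e^2 * mu * (vp + \<eta> r) * D / (kappa * r^(2*(k+2-1)))
             + 1 / (kappa * r^(k+2-1)) * I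
     = - (\<alpha> / kappa) / r^(k+1) + diffusion_rhs e \<eta> \<theta> r"
proof -
  define w V x y i where "w = r^(k+1)" and "V = vp + \<eta> r" and "x = \<eta> r" and "y = \<theta> r" and "i = tail \<eta> r"
  note folds = w_def[symmetric] V_def[symmetric] x_def[symmetric] y_def[symmetric] i_def[symmetric]
  have "2 * k + 2 = (k + 1) * 2" "3 * (k + 1) = (k + 1) * 3" "2 * (k + 1) = (k + 1) * 2" by auto
  then have w: "w \<noteq> 0" "r^(2*k+2) = w^2" "r^(3*(k+1)) = w^3" "r^(2*(k+1)) = w^2"
    using r unfolding w_def by (simp, simp_all only: power_mult)
  have n: "k + 2 - 1 = k + 1" by auto
  have V0: "V \<noteq> 0" and Vx: "V = vp + x" using assms(2) by (simp_all add: V_def x_def)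
  define a1 a2 f where "a1 = R * y * (vp + 2 * x) / vp - R * thp * x / vp" and "a2 = V * (vp / 2 + x) / w^2"
    and "f = 1 / (kappa * w)"
  \<comment> \<open>Two cancellations occur: \<open>e\<close> removes the \<open>1 / e\<close> in
    \<open>D\<close>, and \<open>V\<close> removes the denominators \<open>vp + x\<close> of the
    transport source. The viscous term thus keeps a factor \<open>e\<close> in front of a polynomial
    in \<open>x\<close> and \<open>y\<close>, and stays quadratic uniformly in the flux.\<close>
  have "e * mu * V * D / w = V * mu * (transport_rhs e \<eta> \<theta> r - damping * \<eta> r)"
    unfolding D w_def[symmetric] using w(1) e by simp
  also have "\<dots> = a1 + e^2 * a2 - e^2 * (real k + 1) * V * i"
    unfolding transport_rhs_def transport_source_def damping_def w(2) folds a1_def a2_def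
    using mu vp V0 w(1) unfolding Vx by (simp add: divide_simps) (simp add: algebra_simps power2_eq_square)
  finally have T: "e * mu * V * D / w = a1 + e^2 * a2 - e^2 * (real k + 1) * V * i" .
  have "e^2 * mu * V * D / (kappa * w^2) = f * (e * (e * mu * V * D / w))"
    by (simp add: power2_eq_square f_def)
  then have p3: "e^2 * mu * V * D / (kappa * w^2) = f * (e * (a1 + e^2 * a2 - e^2 * (real k + 1) * V * i))"
    by (simp only: T)
  have p1: "e * (R + cV) / (kappa * w) * y = f * (e * (R + cV) * y)" by (simp add: f_def)
  have p2: "e^3 / 2 * V^2 / (kappa * w^3) = f * (e^3 * V^2 / (2 * w^2))"
    by (simp add: f_def power2_eq_square power3_eq_cube)
  have p4: "diffusion_rhs e \<eta> \<theta> r =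
      f * (e * (R + cV) * y - e * a1 + e^3 * V^2 / (2 * w^2) - e^3 * a2 + e^3 * (real k + 1) * V * i + I)"
    unfolding diffusion_rhs_def diffusion_source_def I w(2) folds a1_def a2_def f_def by (simp add: Vx mult.assoc)
  have p5: "- \<alpha> / (kappa * w) = - (\<alpha> / kappa) / w" by simp
  show ?thesis
    unfolding n w_def[symmetric] V_def[symmetric] y_def[symmetric] w(3,4) p1 p2 p3 p4 p5 f_def[symmetric]
    by (simp add: algebra_simps power2_eq_square power3_eq_cube)
qed


text \<open>\<open>B\<close> contains the reciprocal of the flux and is not uniform. It serves only
  to make the integral of \<open>Phi_term\<close> converge; the value of that integral, and so every
  quantitative estimate, is independent of \<open>B\<close>.\<close>

lemma transport_derivative_bound:
  assumes \<eta>: "decays k \<sigma> \<eta>" and \<theta>: "decays k \<sigma> \<theta>" and s: "\<sigma> \<le> 1" "\<sigma> \<le> vp / 2"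
    and um: "um \<noteq> 0" "2 / vp * \<bar>um\<bar> \<le> \<sigma>" and vm: "um > 0 \<Longrightarrow> vm \<ge> vp / 2"
  obtains B where "B \<ge> 0" "\<And>r. r \<ge> 1 \<Longrightarrow> \<bar>r^(k+1) / mass_flux um vm \<eta> *
      (transport_rhs (mass_flux um vm \<eta>) \<eta> \<theta> r - damping * \<eta> r)\<bar> \<le> B * r"
proof -
  obtain K where K: "source_bound K" using source_bound_exists by blast
  have K0: "K \<ge> 0" using K by (simp add: source_bound_def)
  define e where "e = mass_flux um vm \<eta>"
  have e: "e \<noteq> 0" unfolding e_def by (rule mass_flux_bounds[OF \<eta> s(2) um(1) vm])
  have s0: "\<sigma> \<ge> 0" using decaysD(2)[OF \<eta>, of 1] by auto
  define M where "M = R / (mu * vp) * \<sigma> + K * \<sigma>^2 + damping * \<sigma>"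
  have M0: "M \<ge> 0" using R mu vp s0 K0 damping_pos by (simp add: M_def)
  have "\<bar>r^(k+1) / e * (transport_rhs e \<eta> \<theta> r - damping * \<eta> r)\<bar> \<le> (M / \<bar>e\<bar>) * r" if r: "r \<ge> 1" for r
  proof -
    have "R / (mu * vp) * \<bar>\<theta> r\<bar> \<le> R / (mu * vp) * (\<sigma> / r^k)"
      using R mu vp by (intro mult_left_mono decaysD(2)[OF \<theta> r]) auto
    moreover have "damping * \<bar>\<eta> r\<bar> \<le> damping * (\<sigma> / r^k)"
      using damping_pos by (intro mult_left_mono decaysD(2)[OF \<eta> r]) auto
    moreover have "\<bar>transport_rhs e \<eta> \<theta> r - damping * \<eta> r\<bar> \<le> \<bar>transport_rhs e \<eta> \<theta> r\<bar> + damping * \<bar>\<eta> r\<bar>"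
      using abs_triangle_ineq4[of "transport_rhs e \<eta> \<theta> r" "damping * \<eta> r"] damping_pos by (simp add: abs_mult)
    moreover note rhs_bounds(2)[OF K \<eta> \<theta> s um vm r, folded e_def]
    ultimately have "\<bar>transport_rhs e \<eta> \<theta> r - damping * \<eta> r\<bar> \<le> M / r^k"
      by (simp add: M_def add_divide_distrib)
    then have "r^(k+1) / \<bar>e\<bar> * \<bar>transport_rhs e \<eta> \<theta> r - damping * \<eta> r\<bar> \<le> r^(k+1) / \<bar>e\<bar> * (M / r^k)"
      using r by (intro mult_left_mono) auto
    also have "\<dots> = (M / \<bar>e\<bar>) * r" using r by simp
    finally show ?thesis using r by (simp add: abs_mult abs_divide)
  qed
  then show ?thesis using that[of "M / \<bar>e\<bar>"] M0 by (simp add: e_def)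
qed

lemma closed_step_imp_solution:
  assumes cs: "closed_step um vm (vm - vp) (thm - thp) \<eta> \<theta> \<eta> \<theta>" and lam: "mu = 2 * nu + lam"
    and \<eta>: "decays k \<sigma> \<eta>" and \<theta>: "decays k \<sigma> \<theta>" and s: "\<sigma> \<le> 1" "\<sigma> \<le> vp / 2"
    and um: "um \<noteq> 0" "2 / vp * \<bar>um\<bar> \<le> \<sigma>" and vm: "um > 0 \<Longrightarrow> vm \<ge> vp / 2"
  shows "\<exists>\<alpha>. is_solution (k+2) R cV nu lam kappa vp thp um vm thm \<eta> \<theta> \<alpha>"
proof -
  define e where "e = mass_flux um vm \<eta>"
  have e: "e \<noteq> 0" unfolding e_def by (rule mass_flux_bounds[OF \<eta> s(2) um(1) vm])
  have V: "vp + \<eta> r \<noteq> 0" if "r \<ge> 1" for r using decays_pos[OF \<eta> s(2) that] vp by auto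
  define D where "D = (\<lambda>r. r^(k+1) / e * (transport_rhs e \<eta> \<theta> r - damping * \<eta> r))"
  obtain A where A:
    "\<And>r. r \<ge> 1 \<Longrightarrow> (\<theta> has_real_derivative - A / r^(k+1) + diffusion_rhs e \<eta> \<theta> r) (at r within {1..})"
    "\<And>r. r \<ge> 1 \<Longrightarrow> (\<eta> has_real_derivative D r) (at r within {1..})"
    "(\<theta> \<longlongrightarrow> 0) at_top" "\<theta> 1 = thm - thp" "um > 0 \<Longrightarrow> \<eta> 1 = vm - vp"
    using cs unfolding closed_step_def Let_def e_def D_def by blast
  have Dc: "continuous_on {1..} D" unfolding D_def
    using e by (intro continuous_intros rhs_continuous(1)[OF \<eta> \<theta> s(2)] decaysD(1)[OF \<eta>]) auto
  obtain B where B: "\<And>r. r \<ge> 1 \<Longrightarrow> \<bar>D r\<bar> \<le> B * r"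
    using transport_derivative_bound[OF \<eta> \<theta> s um vm] unfolding D_def e_def by blast
  note Phi = Phi_term_integral[OF \<eta> s(2) A(2) Dc B]
  have d\<eta>: "deriv \<eta> r = D r" if "r > 1" for r
    using A(2)[of r] that by (intro DERIV_imp_deriv) (simp add: at_within_Ici_interior)
  have d\<theta>: "deriv \<theta> r = - A / r^(k+1) + diffusion_rhs e \<eta> \<theta> r" if "r > 1" for r
    using A(1)[of r] that by (intro DERIV_imp_deriv) (simp add: at_within_Ici_interior)
  have \<eta>0: "(\<eta> \<longlongrightarrow> 0) at_top"
    by (rule Lim_null_comparison[OF _ tendsto_inverse_power_at_top[OF k, of \<sigma>]])
       (use decaysD(2)[OF \<eta>] in \<open>auto intro!: eventually_at_top_linorderI[of 1]\<close>)
  have n: "2 * (k + 2) - 1 = 2 * k + 3" by simp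
  \<comment> \<open>The iteration absorbs the conductivity into its constant, so \<alpha> is
    recovered as \<open>kappa * A\<close>.\<close>
  have "is_solution (k+2) R cV nu lam kappa vp thp um vm thm \<eta> \<theta> (kappa * A)"
    unfolding is_solution_def Let_def lam[symmetric] mass_flux_def[symmetric] e_def[symmetric]
  proof (intro conjI allI impI)
    show "smooth_on {1..} \<eta>" "smooth_on {1..} \<theta>"
      using closed_step_smooth[OF cs \<eta> s(2)] e by (simp_all add: e_def)
    show "(\<lambda>s. \<eta> s / s^(2*(k+2)-1)) integrable_on {r..}" if "r > 1" for r
      unfolding n by (rule tail_bounds(1)[OF decaysD[OF \<eta>]]) (use that in auto)
    show "(\<lambda>s. Phi_term (k+2) nu e vp \<eta> (deriv \<eta>) s) integrable_on {r..}" if "r > 1" for r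
      by (rule Phi(1)) (use that in auto)
    show "deriv \<eta> r + R * thp * r^(k+2-1) / (e * mu * vp^2) * \<eta> r
             = R * r^(k+2-1) / (e * mu * vp) * \<theta> r + F_term (k+2) R mu vp thp e \<eta> \<theta> r" if r: "r > 1" for r
      unfolding transport_equation_iff[where \<eta> = \<eta> and r = r, OF e V[OF less_imp_le[OF r]] r] using d\<eta>[OF r] by (simp add: D_def)
    show "deriv \<theta> r = - (kappa * A) / (kappa * r^(k+2-1)) + e * (R + cV) / (kappa * r^(k+2-1)) * \<theta> r
             + e^3 / 2 * (vp + \<eta> r)^2 / (kappa * r^(3*(k+2-1)))
             - e^2 * mu * (vp + \<eta> r) * deriv \<eta> r / (kappa * r^(2*(k+2-1)))
             + 1 / (kappa * r^(k+2-1)) * integral {r..} (\<lambda>s. Phi_term (k+2) nu e vp \<eta> (deriv \<eta>) s)" if r: "r > 1" for r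
    proof -
      have "deriv \<eta> r = r^(k+1) / e * (transport_rhs e \<eta> \<theta> r - damping * \<eta> r)"
        using d\<eta>[OF r] by (simp add: D_def)
      from diffusion_equation_rhs[where \<eta> = \<eta> and r = r, OF e V[OF less_imp_le[OF r]] r this Phi(2)[OF _ _ r], of "kappa * A"]
      show ?thesis using d\<theta>[OF r] kappa by simp
    qed
    show "if um > 0 then \<eta> 1 = vm - vp \<and> \<theta> 1 = thm - thp else \<theta> 1 = thm - thp" using A by simp
  qed (use \<eta>0 A in auto)
  then show ?thesis by blast
qed

lemma solution_imp_step:
  assumes sol: "is_solution (k+2) R cV nu lam kappa vp thp um vm thm \<eta> \<theta> \<alpha>" and lam: "mu = 2 * nu + lam"
    and \<eta>: "decays k \<sigma> \<eta>" and \<theta>: "decays k \<sigma> \<theta>" and s: "\<sigma> \<le> 1" "\<sigma> \<le> vp / 2"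
    and um: "um \<noteq> 0" "2 / vp * \<bar>um\<bar> \<le> \<sigma>" and vm: "um > 0 \<Longrightarrow> vm \<ge> vp / 2"
  shows "step um vm (vm - vp) (thm - thp) \<eta> \<theta> \<eta> \<theta>"
proof -
  define e where "e = mass_flux um vm \<eta>"
  have e: "e \<noteq> 0" unfolding e_def by (rule mass_flux_bounds[OF \<eta> s(2) um(1) vm])
  have V: "vp + \<eta> r \<noteq> 0" if "r \<ge> 1" for r using decays_pos[OF \<eta> s(2) that] vp by auto
  note S = sol[unfolded is_solution_def Let_def, folded lam mass_flux_def, folded e_def]
  from S have "smooth_on {1..} \<eta>" "smooth_on {1..} \<theta>" by blast+
  then obtain D1 D2 where D1: "D1 0 = \<eta>" "\<And>j r. r \<in> {1..} \<Longrightarrow> (D1 j has_real_derivative D1 (Suc j) r) (at r within {1..})"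
    and D2: "D2 0 = \<theta>" "\<And>j r. r \<in> {1..} \<Longrightarrow> (D2 j has_real_derivative D2 (Suc j) r) (at r within {1..})"
    unfolding smooth_on_def by metis
  define D where "D = D1 1"
  have D: "(\<eta> has_real_derivative D r) (at r within {1..})" if "r \<ge> 1" for r
    using D1(2)[of r 0] that by (simp add: D1(1) D_def)
  have Dc: "continuous_on {1..} D" unfolding D_def using D1(2)[of _ 1] by (intro DERIV_continuous_on) auto
  have d\<eta>: "DERIV \<eta> r :> deriv \<eta> r" "deriv \<eta> r = D r" if "r > 1" for r
    using D[of r] that by (auto simp: at_within_Ici_interior DERIV_imp_deriv)
  have d\<theta>: "DERIV \<theta> r :> deriv \<theta> r" if "r > 1" for r
    using D2(2)[of r 0] that by (auto simp: D2(1) at_within_Ici_interior DERIV_imp_deriv)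
  have E1: "deriv \<eta> r = r^(k+1) / e * (transport_rhs e \<eta> \<theta> r - damping * \<eta> r)" if r: "r > 1" for r
    using S r transport_equation_iff[where \<eta> = \<eta> and r = r, OF e V[OF less_imp_le[OF r]] r] by blast
  obtain B where B: "B \<ge> 0" "\<And>r. r \<ge> 1 \<Longrightarrow> \<bar>r^(k+1) / e * (transport_rhs e \<eta> \<theta> r - damping * \<eta> r)\<bar> \<le> B * r"
    using transport_derivative_bound[OF \<eta> \<theta> s um vm] unfolding e_def by blast
  \<comment> \<open>The equation gives the growth bound only for \<open>r > 1\<close>; the one-sided
    derivative at 1, known from smoothness alone, is added by hand.\<close>
  have Db: "\<bar>D r\<bar> \<le> (B + \<bar>D 1\<bar>) * r" if "r \<ge> 1" for r
  proof (cases "r = 1")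
    case False
    then have "\<bar>D r\<bar> \<le> B * r" using B(2)[OF that] E1[of r] d\<eta>(2)[of r] that by simp
    also have "\<dots> \<le> (B + \<bar>D 1\<bar>) * r" using that by (intro mult_right_mono) auto
    finally show ?thesis .
  qed (use B in auto)
  note Phi = Phi_term_integral[OF \<eta> s(2) D Dc Db]
  have E2: "deriv \<theta> r = - (\<alpha> / kappa) / r^(k+1) + diffusion_rhs e \<eta> \<theta> r" if r: "r > 1" for r
  proof -
    have "deriv \<theta> r = - \<alpha> / (kappa * r^(k+2-1)) + e * (R + cV) / (kappa * r^(k+2-1)) * \<theta> r
             + e^3 / 2 * (vp + \<eta> r)^2 / (kappa * r^(3*(k+2-1)))
             - e^2 * mu * (vp + \<eta> r) * deriv \<eta> r / (kappa * r^(2*(k+2-1)))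
             + 1 / (kappa * r^(k+2-1)) * integral {r..} (\<lambda>s. Phi_term (k+2) nu e vp \<eta> (deriv \<eta>) s)"
      using S r by blast
    also have "\<dots> = - (\<alpha> / kappa) / r^(k+1) + diffusion_rhs e \<eta> \<theta> r"
      by (rule diffusion_equation_rhs[where \<eta> = \<eta> and r = r, OF e V[OF less_imp_le[OF r]] r E1[OF r] Phi(2)[OF _ _ r]]) auto
    finally show ?thesis .
  qed
  have "\<forall>r>1. DERIV \<theta> r :> - (\<alpha> / kappa) / r^(k+1) + diffusion_rhs e \<eta> \<theta> r"
    using d\<theta> E2 by metis
  moreover have "\<forall>r>1. DERIV \<eta> r :> r^(k+1) / e * (transport_rhs e \<eta> \<theta> r - damping * \<eta> r)"
    using d\<eta>(1) E1 by metis
  moreover have "(\<theta> \<longlongrightarrow> 0) at_top" "\<theta> 1 = thm - thp" "um > 0 \<longrightarrow> \<eta> 1 = vm - vp"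
    using S by (auto split: if_splits)
  ultimately show ?thesis unfolding step_def Let_def e_def[symmetric] by blast
qed

text \<open>The conditional summand lets one statement cover both signs of \<open>um\<close>: for
  outflow from the unit sphere the value of \<eta> at 1 is prescribed and counted, otherwise it is
  not.\<close>

lemma well_posed:
  assumes lam: "mu = 2 * nu + lam"
  obtains C s0 where "C > 0" "s0 > 0"
    "\<And>um vm thm \<delta>. um \<noteq> 0 \<Longrightarrow> (um > 0 \<Longrightarrow> vm \<ge> vp / 2) \<Longrightarrow>
       \<bar>um\<bar> + (if um > 0 then \<bar>vm - vp\<bar> else 0) + \<bar>thm - thp\<bar> \<le> \<delta> \<Longrightarrow> C * \<delta> \<le> s0 \<Longrightarrow>
       (\<exists>\<eta> \<theta>. (\<exists>\<alpha>. is_solution (k+2) R cV nu lam kappa vp thp um vm thm \<eta> \<theta> \<alpha>) \<and>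
          (\<forall>r\<ge>1. \<bar>\<eta> r\<bar> \<le> C / r^k * \<delta> \<and> \<bar>\<theta> r\<bar> \<le> C / r^k * \<delta>)) \<and>
       (\<forall>\<eta>1 \<theta>1 \<eta>2 \<theta>2.
          (\<exists>\<alpha>. is_solution (k+2) R cV nu lam kappa vp thp um vm thm \<eta>1 \<theta>1 \<alpha>) \<and>
          (\<forall>r\<ge>1. \<bar>\<eta>1 r\<bar> \<le> C / r^k * \<delta> \<and> \<bar>\<theta>1 r\<bar> \<le> C / r^k * \<delta>) \<longrightarrow>
          (\<exists>\<alpha>. is_solution (k+2) R cV nu lam kappa vp thp um vm thm \<eta>2 \<theta>2 \<alpha>) \<and>
          (\<forall>r\<ge>1. \<bar>\<eta>2 r\<bar> \<le> C / r^k * \<delta> \<and> \<bar>\<theta>2 r\<bar> \<le> C / r^k * \<delta>) \<longrightarrow>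
          (\<forall>r\<ge>1. \<eta>1 r = \<eta>2 r \<and> \<theta>1 r = \<theta>2 r))"
proof (rule solution_constants)
  fix C s0 :: real
  assume C: "C > 0" and s0: "s0 > 0" "s0 \<le> 1" "s0 \<le> vp / 2"
    and main: "\<And>um vm \<eta>m \<theta>m \<delta>. um \<noteq> 0 \<Longrightarrow> (um > 0 \<Longrightarrow> vm \<ge> vp / 2) \<Longrightarrow>
       \<bar>um\<bar> + (if um > 0 then \<bar>\<eta>m\<bar> else 0) + \<bar>\<theta>m\<bar> \<le> \<delta> \<Longrightarrow> C * \<delta> \<le> s0 \<Longrightarrow>
       2 / vp * \<bar>um\<bar> \<le> C * \<delta> \<and>
       (\<exists>\<eta> \<theta> \<eta>' \<theta>'. decays k (C*\<delta>) \<eta> \<and> decays k (C*\<delta>) \<theta> \<and> decays k (C*\<delta>) \<eta>' \<and> decays k (C*\<delta>) \<theta>' \<and>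
          closed_step um vm \<eta>m \<theta>m \<eta> \<theta> \<eta>' \<theta>' \<and> (\<forall>r\<ge>1. \<eta> r = \<eta>' r \<and> \<theta> r = \<theta>' r)) \<and>
       (\<forall>\<eta>1 \<theta>1 \<eta>2 \<theta>2. decays k (C*\<delta>) \<eta>1 \<longrightarrow> decays k (C*\<delta>) \<theta>1 \<longrightarrow> decays k (C*\<delta>) \<eta>2 \<longrightarrow> decays k (C*\<delta>) \<theta>2 \<longrightarrow>
          step um vm \<eta>m \<theta>m \<eta>1 \<theta>1 \<eta>1 \<theta>1 \<longrightarrow> step um vm \<eta>m \<theta>m \<eta>2 \<theta>2 \<eta>2 \<theta>2 \<longrightarrow>
          (\<forall>r\<ge>1. \<eta>1 r = \<eta>2 r \<and> \<theta>1 r = \<theta>2 r))"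
  show thesis
  proof (rule that[OF C s0(1)], intro conjI allI impI)
    fix um vm tm \<delta> :: real
    assume um: "um \<noteq> 0" and vm: "um > 0 \<Longrightarrow> vm \<ge> vp / 2"
      and d: "\<bar>um\<bar> + (if um > 0 then \<bar>vm - vp\<bar> else 0) + \<bar>tm - thp\<bar> \<le> \<delta>" "C * \<delta> \<le> s0"
    define \<sigma> where "\<sigma> = C * \<delta>"
    note m = main[OF um vm d, folded \<sigma>_def]
    from m have um2: "2 / vp * \<bar>um\<bar> \<le> \<sigma>" by blast
    have s: "\<sigma> \<le> 1" "\<sigma> \<le> vp / 2" using s0 d by (auto simp: \<sigma>_def)
    have eq: "C / r^k * \<delta> = \<sigma> / r^k" for r :: real by (simp add: \<sigma>_def)
    from m obtain \<eta> \<theta> \<eta>' \<theta>' where F: "decays k \<sigma> \<eta>'" "decays k \<sigma> \<theta>'"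
      "closed_step um vm (vm - vp) (tm - thp) \<eta> \<theta> \<eta>' \<theta>'" "\<forall>r\<ge>1. \<eta> r = \<eta>' r \<and> \<theta> r = \<theta>' r" by blast
    have "\<exists>\<alpha>. is_solution (k+2) R cV nu lam kappa vp thp um vm tm \<eta>' \<theta>' \<alpha>"
      by (rule closed_step_imp_solution[OF closed_step_self[OF F(3,4)] lam F(1,2) s um um2 vm])
    then show "\<exists>\<eta> \<theta>. (\<exists>\<alpha>. is_solution (k+2) R cV nu lam kappa vp thp um vm tm \<eta> \<theta> \<alpha>) \<and>
          (\<forall>r\<ge>1. \<bar>\<eta> r\<bar> \<le> C / r^k * \<delta> \<and> \<bar>\<theta> r\<bar> \<le> C / r^k * \<delta>)"
      unfolding eq using decaysD(2)[OF F(1)] decaysD(2)[OF F(2)] by blast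
    have st: "decays k \<sigma> \<eta> \<and> decays k \<sigma> \<theta> \<and> step um vm (vm - vp) (tm - thp) \<eta> \<theta> \<eta> \<theta>"
      if sol: "(\<exists>\<alpha>. is_solution (k+2) R cV nu lam kappa vp thp um vm tm \<eta> \<theta> \<alpha>) \<and>
          (\<forall>r\<ge>1. \<bar>\<eta> r\<bar> \<le> C / r^k * \<delta> \<and> \<bar>\<theta> r\<bar> \<le> C / r^k * \<delta>)" for \<eta> \<theta>
    proof -
      obtain \<alpha> where \<alpha>: "is_solution (k+2) R cV nu lam kappa vp thp um vm tm \<eta> \<theta> \<alpha>" using sol by blast
      have "continuous_on {1..} f" if "smooth_on {1..} f" for f
        using that unfolding smooth_on_def by (metis DERIV_continuous_on)
      then have "continuous_on {1..} \<eta>" "continuous_on {1..} \<theta>"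
        using \<alpha> unfolding is_solution_def Let_def by blast+
      then have dec: "decays k \<sigma> \<eta>" "decays k \<sigma> \<theta>" using sol unfolding eq decays_def by blast+
      then show ?thesis using solution_imp_step[OF \<alpha> lam dec s um um2 vm] by blast
    qed
    fix \<eta>1 \<theta>1 \<eta>2 \<theta>2 and r :: real
    assume "(\<exists>\<alpha>. is_solution (k+2) R cV nu lam kappa vp thp um vm tm \<eta>1 \<theta>1 \<alpha>) \<and>
          (\<forall>r\<ge>1. \<bar>\<eta>1 r\<bar> \<le> C / r^k * \<delta> \<and> \<bar>\<theta>1 r\<bar> \<le> C / r^k * \<delta>)"
      "(\<exists>\<alpha>. is_solution (k+2) R cV nu lam kappa vp thp um vm tm \<eta>2 \<theta>2 \<alpha>) \<and>
          (\<forall>r\<ge>1. \<bar>\<eta>2 r\<bar> \<le> C / r^k * \<delta> \<and> \<bar>\<theta>2 r\<bar> \<le> C / r^k * \<delta>)" and r: "1 \<le> r"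
    from st[OF this(1)] st[OF this(2)] m r
    have "\<eta>1 r = \<eta>2 r \<and> \<theta>1 r = \<theta>2 r" by blast
    then show "\<eta>1 r = \<eta>2 r" "\<theta>1 r = \<theta>2 r" by auto
  qed
qed

end
theorem theorem2p1:
  fixes n :: nat and R cV nu lam kappa vp thp :: real
  assumes "n \<ge> 3" and "R > 0" and "cV > 0" and "nu > 0"
    and "2 * nu + real n * lam \<ge> 0" and "2 * nu + lam > 0" and "kappa > 0"
    and "vp > 0" and "thp > 0"
  shows "\<exists>eps0 > 0. \<exists>C > 0.
    (\<forall>um vm thm. um > 0 \<longrightarrow> vm > 0 \<longrightarrow> thm > 0 \<longrightarrow>
        \<bar>um\<bar> + \<bar>vm - vp\<bar> + \<bar>thm - thp\<bar> \<le> eps0 \<longrightarrow>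
       (\<exists>eta chi. (\<exists>alpha. is_solution n R cV nu lam kappa vp thp um vm thm eta chi alpha) \<and>
          (\<forall>r\<ge>1. \<bar>eta r\<bar> \<le> C / r^(n-2) * (\<bar>um\<bar> + \<bar>vm - vp\<bar> + \<bar>thm - thp\<bar>) \<and>
                  \<bar>chi r\<bar> \<le> C / r^(n-2) * (\<bar>um\<bar> + \<bar>vm - vp\<bar> + \<bar>thm - thp\<bar>))) \<and>
       (\<forall>eta1 chi1 eta2 chi2.
          (\<exists>alpha. is_solution n R cV nu lam kappa vp thp um vm thm eta1 chi1 alpha) \<and>
          (\<forall>r\<ge>1. \<bar>eta1 r\<bar> \<le> C / r^(n-2) * (\<bar>um\<bar> + \<bar>vm - vp\<bar> + \<bar>thm - thp\<bar>) \<and>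
                  \<bar>chi1 r\<bar> \<le> C / r^(n-2) * (\<bar>um\<bar> + \<bar>vm - vp\<bar> + \<bar>thm - thp\<bar>)) \<longrightarrow>
          (\<exists>alpha. is_solution n R cV nu lam kappa vp thp um vm thm eta2 chi2 alpha) \<and>
          (\<forall>r\<ge>1. \<bar>eta2 r\<bar> \<le> C / r^(n-2) * (\<bar>um\<bar> + \<bar>vm - vp\<bar> + \<bar>thm - thp\<bar>) \<and>
                  \<bar>chi2 r\<bar> \<le> C / r^(n-2) * (\<bar>um\<bar> + \<bar>vm - vp\<bar> + \<bar>thm - thp\<bar>)) \<longrightarrow>
          (\<forall>r\<ge>1. eta1 r = eta2 r \<and> chi1 r = chi2 r))) \<and>
    (\<forall>um vm thm. um < 0 \<longrightarrow> vm > 0 \<longrightarrow> thm > 0 \<longrightarrow>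
        \<bar>um\<bar> + \<bar>thm - thp\<bar> \<le> eps0 \<longrightarrow>
       (\<exists>eta chi. (\<exists>alpha. is_solution n R cV nu lam kappa vp thp um vm thm eta chi alpha) \<and>
          (\<forall>r\<ge>1. \<bar>eta r\<bar> \<le> C / r^(n-2) * (\<bar>um\<bar> + \<bar>thm - thp\<bar>) \<and>
                  \<bar>chi r\<bar> \<le> C / r^(n-2) * (\<bar>um\<bar> + \<bar>thm - thp\<bar>))) \<and>
       (\<forall>eta1 chi1 eta2 chi2.
          (\<exists>alpha. is_solution n R cV nu lam kappa vp thp um vm thm eta1 chi1 alpha) \<and>
          (\<forall>r\<ge>1. \<bar>eta1 r\<bar> \<le> C / r^(n-2) * (\<bar>um\<bar> + \<bar>thm - thp\<bar>) \<and>
                  \<bar>chi1 r\<bar> \<le> C / r^(n-2) * (\<bar>um\<bar> + \<bar>thm - thp\<bar>)) \<longrightarrow>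
          (\<exists>alpha. is_solution n R cV nu lam kappa vp thp um vm thm eta2 chi2 alpha) \<and>
          (\<forall>r\<ge>1. \<bar>eta2 r\<bar> \<le> C / r^(n-2) * (\<bar>um\<bar> + \<bar>thm - thp\<bar>) \<and>
                  \<bar>chi2 r\<bar> \<le> C / r^(n-2) * (\<bar>um\<bar> + \<bar>thm - thp\<bar>)) \<longrightarrow>
          (\<forall>r\<ge>1. eta1 r = eta2 r \<and> chi1 r = chi2 r)))"
proof -
  define k where "k = n - 2"
  have n: "n = k + 2" and k: "k \<ge> 1" using assms(1) by (auto simp: k_def)
  define mu where "mu = 2 * nu + lam"
  interpret gas k R cV nu mu kappa vp thp
    by unfold_locales (use assms k in \<open>auto simp: mu_def\<close>)
  obtain C s0 where C: "C > 0" "s0 > 0" and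
    W: "\<And>um vm thm \<delta>. um \<noteq> 0 \<Longrightarrow> (um > 0 \<Longrightarrow> vm \<ge> vp / 2) \<Longrightarrow>
       \<bar>um\<bar> + (if um > 0 then \<bar>vm - vp\<bar> else 0) + \<bar>thm - thp\<bar> \<le> \<delta> \<Longrightarrow> C * \<delta> \<le> s0 \<Longrightarrow>
       (\<exists>\<eta> \<theta>. (\<exists>\<alpha>. is_solution n R cV nu lam kappa vp thp um vm thm \<eta> \<theta> \<alpha>) \<and>
          (\<forall>r\<ge>1. \<bar>\<eta> r\<bar> \<le> C / r^(n-2) * \<delta> \<and> \<bar>\<theta> r\<bar> \<le> C / r^(n-2) * \<delta>)) \<and>
       (\<forall>\<eta>1 \<theta>1 \<eta>2 \<theta>2.
          (\<exists>\<alpha>. is_solution n R cV nu lam kappa vp thp um vm thm \<eta>1 \<theta>1 \<alpha>) \<and>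
          (\<forall>r\<ge>1. \<bar>\<eta>1 r\<bar> \<le> C / r^(n-2) * \<delta> \<and> \<bar>\<theta>1 r\<bar> \<le> C / r^(n-2) * \<delta>) \<longrightarrow>
          (\<exists>\<alpha>. is_solution n R cV nu lam kappa vp thp um vm thm \<eta>2 \<theta>2 \<alpha>) \<and>
          (\<forall>r\<ge>1. \<bar>\<eta>2 r\<bar> \<le> C / r^(n-2) * \<delta> \<and> \<bar>\<theta>2 r\<bar> \<le> C / r^(n-2) * \<delta>) \<longrightarrow>
          (\<forall>r\<ge>1. \<eta>1 r = \<eta>2 r \<and> \<theta>1 r = \<theta>2 r))"
    using well_posed[OF mu_def] unfolding k_def[symmetric] n[symmetric] by blast
  \<comment> \<open>The bound \<open>vp / 2\<close> is for \<open>um > 0\<close>: there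
    \<open>\<bar>vm - vp\<bar> \<le> eps0\<close> keeps \<open>vm\<close> at least
    \<open>vp / 2\<close>, so that the flux is controlled by \<open>um\<close>.\<close>
  define eps0 where "eps0 = min (s0 / C) (vp / 2)"
  have small: "C * \<delta> \<le> s0" if "\<delta> \<le> eps0" for \<delta>
    using that C(1) by (simp add: eps0_def pos_le_divide_eq mult.commute)
  show ?thesis
  proof (rule exI[of _ eps0], rule conjI, goal_cases)
    case 1
    show ?case using C assms by (simp add: eps0_def)
  next
    case 2
    show ?case
    proof (rule exI[of _ C], rule conjI[OF C(1)], (rule conjI; intro allI impI), goal_cases)
      case (1 um vm tm)
      have "eps0 \<le> vp / 2" unfolding eps0_def by (rule min.cobounded2)
      then have "vm \<ge> vp / 2" using 1(1,4) by linarith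
      then show ?case
        by (intro W) (use 1 small in auto)
    next
      case (2 um vm tm)
      show ?case
        by (rule W) (use 2 small in auto)
    qed
  qed
qed

end
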